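(* Under the assumptions of Lemma 4.3, namely: $\Theta\subseteq\mathbb{R}^d$, functions $f_\theta\colon[0,\infty)\times\mathbb{N}_0\to[0,\infty)$, $\theta_0\in\Theta$, constants $\delta>0$, $C<\infty$, $\kappa_1,\kappa_2\ge0$ with $\kappa_1+\kappa_2<1$ such that for all $\theta'\in\Theta$ with $\|\theta'-\theta_0\|\le\delta$ we have $|f_{\theta'}(\lambda,y)-f_{\theta_0}(\lambda,y)|\le C\|\theta'-\theta_0\|(\lambda+y+1)$ and $|f_{\theta'}(\lambda,y)-f_{\theta'}(\tilde\lambda,\tilde y)|\le\kappa_1|\lambda-\tilde\lambda|+\kappa_2|y-\tilde y|$ for all $\lambda,\tilde\lambda\ge0$, $y,\tilde y\in\mathbb{N}_0$; a strictly stationary process $((N_t,\lambda_t))_{t\in\mathbb{Z}}$ with $N_t\mid\sigma(\lambda_s,N_s:s\le t-1)\sim\mathrm{Poisson}(\lambda_t)$ and $\lambda_t=f_{\theta_0}(\lambda_{t-1},N_{t-1})$; estimators $\widehat\theta_n$ with $\widehat\theta_n-\theta_0=O_P(n^{-1/2})$; an arbitrary almost surely finite starting value $\widehat\lambda_1\ge0$ and $\widehat\lambda_t=f_{\widehat\theta_n}(\widehat\lambda_{t-1},N_{t-1})$ for $t=2,\dots,n$ — the statistic $$\widehat T_n=\frac{1}{\sqrt n}\sum_{t=1}^n\big\{(N_t-\widehat\lambda_t)^2-N_t\big\}$$ satisfies $\widehat T_n\xrightarrow{d}\mathcal{N}(0,2E\lambda_1^2)$ as $n\to\infty$.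
   Context: $O_P(a_n)$ means bounded in probability after division by $a_n$. The special case of a single fixed $f_0$ (i.e. $\widehat\theta_n\equiv\theta_0$) covers the statistic with an arbitrary starting value. *)

theory Defs
  imports "HOL-Probability.Probability"
begin

text \<open>Poisson probability mass, valid for every rate \<open>r \<ge> 0\<close> (rate 0 = point mass at 0,
  using \<open>0 ^ 0 = 1\<close>).\<close>
definition poisson_prob :: "real \<Rightarrow> nat \<Rightarrow> real" where
  "poisson_prob r k = r ^ k / fact k * exp (- r)"

definition past_sigma :: "'w measure \<Rightarrow> (int \<Rightarrow> 'w \<Rightarrow> real) \<Rightarrow> (int \<Rightarrow> 'w \<Rightarrow> nat) \<Rightarrow> int \<Rightarrow> 'w measure" where
  "past_sigma M lam N t = sigma (space M)
     ((\<Union>s\<in>{..t-1}. {lam s -` B \<inter> space M | B. B \<in> sets borel}) \<union>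
      (\<Union>s\<in>{..t-1}. {N s -` B \<inter> space M | B. B \<subseteq> (UNIV :: nat set)}))"

definition strictly_stationary :: "'w measure \<Rightarrow> (int \<Rightarrow> 'w \<Rightarrow> real) \<Rightarrow> (int \<Rightarrow> 'w \<Rightarrow> nat) \<Rightarrow> bool" where
  "strictly_stationary M lam N \<longleftrightarrow>
     (\<forall>J::int set. \<forall>h::int. finite J \<longrightarrow>
        distr M (PiM J (\<lambda>_. borel \<Otimes>\<^sub>M count_space UNIV)) (\<lambda>\<omega>. \<lambda>t\<in>J. (lam (t + h) \<omega>, N (t + h) \<omega>))
      = distr M (PiM J (\<lambda>_. borel \<Otimes>\<^sub>M count_space UNIV)) (\<lambda>\<omega>. \<lambda>t\<in>J. (lam t \<omega>, N t \<omega>)))"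

text \<open>Estimated intensities: \<open>lam_hat f th l1 N k\<close> is \<open>\<lambda>hat_{k+1}\<close>, i.e.
  \<open>\<lambda>hat_1 = l1\<close> and \<open>\<lambda>hat_{t} = f th (\<lambda>hat_{t-1}) (N_{t-1})\<close>.\<close>
primrec lam_hat :: "('p \<Rightarrow> real \<Rightarrow> nat \<Rightarrow> real) \<Rightarrow> 'p \<Rightarrow> real \<Rightarrow> (int \<Rightarrow> nat) \<Rightarrow> nat \<Rightarrow> real" where
  "lam_hat f th l1 Ns 0 = l1"
| "lam_hat f th l1 Ns (Suc k) = f th (lam_hat f th l1 Ns k) (Ns (int k + 1))"

definition T_stat :: "('p \<Rightarrow> real \<Rightarrow> nat \<Rightarrow> real) \<Rightarrow> 'p \<Rightarrow> real \<Rightarrow> (int \<Rightarrow> nat) \<Rightarrow> nat \<Rightarrow> real" where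
  "T_stat f th l1 Ns n = (1 / sqrt (real n)) *
     (\<Sum>k<n. (real (Ns (int k + 1)) - lam_hat f th l1 Ns k)\<^sup>2 - real (Ns (int k + 1)))"

definition normal_measure :: "real \<Rightarrow> real \<Rightarrow> real measure" where
  "normal_measure \<mu> v = (if v = 0 then return borel \<mu> else density lborel (normal_density \<mu> (sqrt v)))"

definition bounded_in_prob :: "'w measure \<Rightarrow> (nat \<Rightarrow> 'w \<Rightarrow> real) \<Rightarrow> (nat \<Rightarrow> real) \<Rightarrow> bool" where
  "bounded_in_prob M X a \<longleftrightarrow>
     (\<forall>\<epsilon>>0. \<exists>K. \<exists>n0. \<forall>n\<ge>n0. measure M {\<omega> \<in> space M. \<bar>X n \<omega> / a n\<bar> > K} < \<epsilon>)"

end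

theory Submission
  imports Defs
begin

text \<open>
  Replacing \<open>lam_hat\<close> by the true intensities \<open>L\<^sub>k\<close> turns the statistic into a sum of martingale differences
  \<open>(Y\<^sub>k - L\<^sub>k)\<^sup>2 - Y\<^sub>k\<close> with conditional variance \<open>2 L\<^sub>k\<^sup>2\<close>. Contractivity makes the transition operator
  of the intensity chain shrink Lipschitz constants by the factor \<open>\<kappa>1 + \<kappa>2\<close>, which gives exponentially
  decaying covariances, a law of large numbers for the conditional variances, and then a central limit theorem
  via compensated characteristic functions.

  In the difference of the two statistics, the delicate term is \<open>\<Sum> (Y\<^sub>k - L\<^sub>k) (lam_hat\<^sub>k - L\<^sub>k) / sqrt n\<close>: the
  estimator anticipates the whole sample and \<open>f\<close> is Lipschitz in the parameter only at \<open>\<theta>0\<close>, so neither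
  orthogonality nor an expansion in the parameter is available. But the perturbed functions are Lipschitz in a
  one-dimensional argument and lie within \<open>O (1 / sqrt n)\<close> of \<open>f \<theta>0\<close>; on compact sets they are covered by
  \<open>exp (O (sqrt n))\<close> functions, while for each fixed one a Poisson exponential inequality bounds the deviation
  probability by \<open>exp (- c n)\<close>.
\<close>

section \<open>The Poisson distribution\<close>

text \<open>Two truncations carry the argument, because only a second moment of the intensity is
  established, while both the expansion of characteristic functions and the exponential inequality
  need bounded rates. In the central limit theorem each summand gets a predictable weight that
  vanishes for large intensities; the discarded part is again a sum of martingale differences, hence
  small in mean square uniformly in n. In the remainder, the difference of the two recursions is
  reset to zero whenever the state exceeds a level B; the price is a discounted sum of tails, small
  in mean square once B is large.

  The covering succeeds because scales match. The perturbations are O(1 / sqrt n) and have to be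
  known only up to a small multiple of 1 / sqrt n, so the number of net values per cell stays
  bounded and only the number of cells grows, like sqrt n. The sums to be controlled have
  predictable factors of order 1 / sqrt n but are compared with sqrt n; hence the exponential
  parameter may be of order sqrt n, and the exponent becomes linear in n.\<close>

definition pois :: "real \<Rightarrow> nat pmf" where
  "pois l = (if 0 < l then poisson_pmf l else return_pmf 0)"

lemma pmf_pois: "0 \<le> l \<Longrightarrow> pmf (pois l) j = poisson_prob l j"
  by (cases "l = 0"; cases "j = 0") (auto simp: pois_def poisson_prob_def)

lemma poisson_prob_nonneg: "0 \<le> l \<Longrightarrow> 0 \<le> poisson_prob l j"
  by (simp add: poisson_prob_def)

lemma poisson_prob_measurable [measurable]: "(\<lambda>l. poisson_prob l j) \<in> borel_measurable borel"
  by (simp add: poisson_prob_def)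

lemma poisson_prob_Suc: "real (Suc j) * poisson_prob l (Suc j) = l * poisson_prob l j"
proof -
  have "(fact (Suc j) :: real) = real (Suc j) * fact j" by simp
  then show ?thesis
    unfolding poisson_prob_def by (simp add: field_simps del: fact_Suc of_nat_Suc)
qed

lemma poisson_prob_exp_sums: "(\<lambda>j. poisson_prob l j * exp (a * real j)) sums exp (l * (exp a - 1))"
proof -
  have "(\<lambda>j. exp (- l) * ((l * exp a) ^ j /\<^sub>R fact j)) sums (exp (- l) * exp (l * exp a))"
    by (intro sums_mult exp_converges)
  moreover have "exp (- l) * exp (l * exp a) = exp (l * (exp a - 1))"
    by (simp add: exp_add[symmetric] algebra_simps)
  moreover have "exp (- l) * ((l * exp a) ^ j /\<^sub>R fact j) = poisson_prob l j * exp (a * real j)" for j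
    by (simp add: poisson_prob_def power_mult_distrib exp_of_nat_mult[symmetric] field_simps)
  ultimately show ?thesis by simp
qed

lemma integrable_pois_iff:
  fixes G :: "nat \<Rightarrow> real"
  assumes "0 \<le> l"
  shows "integrable (pois l) G \<longleftrightarrow> summable (\<lambda>j. poisson_prob l j * \<bar>G j\<bar>)"
  using assms
  by (subst measure_pmf_eq_density, subst integrable_density)
    (auto simp: integrable_count_space_nat_iff pmf_pois abs_mult poisson_prob_nonneg)

lemma sums_integral_pois:
  fixes G :: "nat \<Rightarrow> real"
  assumes "0 \<le> l" "integrable (pois l) G"
  shows "(\<lambda>j. poisson_prob l j * G j) sums (\<integral>j. G j \<partial>pois l)"
proof -
  have "integrable (count_space UNIV) (\<lambda>j. poisson_prob l j * G j)"
    using assms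
    by (auto simp: integrable_count_space_nat_iff integrable_pois_iff abs_mult poisson_prob_nonneg)
  from sums_integral_count_space_nat[OF this] show ?thesis
    using assms(1)
    by (subst measure_pmf_eq_density, subst integral_density) (auto simp: pmf_pois poisson_prob_nonneg)
qed

text \<open>The Poisson law has all exponential moments, so exponential growth in j is harmless.
  This is the criterion behind the integrability of powers, of functions with bounded increments and
  of the cubes of \<open>disp\<close>.\<close>

lemma integrable_pois_exp_bound:
  fixes G :: "nat \<Rightarrow> real"
  assumes "0 \<le> l" "\<And>j. \<bar>G j\<bar> \<le> c * exp (a * real j)"
  shows "integrable (pois l) G"
  unfolding integrable_pois_iff[OF assms(1)]
proof (rule summable_comparison_test')
  show "summable (\<lambda>j. c * (poisson_prob l j * exp (a * real j)))"
    using poisson_prob_exp_sums by (intro summable_mult) (auto simp: sums_iff)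
  show "norm (poisson_prob l j * \<bar>G j\<bar>) \<le> c * (poisson_prob l j * exp (a * real j))" if "0 \<le> j" for j
    using mult_left_mono[OF assms(2)[of j] poisson_prob_nonneg[OF assms(1), of j]]
    by (simp add: poisson_prob_nonneg[OF assms(1)] abs_mult algebra_simps)
qed

lemma integral_pois_exp:
  assumes "0 \<le> l"
  shows "(\<integral>j. exp (a * real j) \<partial>pois l) = exp (l * (exp a - 1))"
proof -
  have "integrable (pois l) (\<lambda>j. exp (a * real j))"
    by (rule integrable_pois_exp_bound[OF assms, of _ 1 a]) auto
  from sums_unique2[OF sums_integral_pois[OF assms this] poisson_prob_exp_sums] show ?thesis .
qed

lemma power_le_fact_exp:
  fixes x :: real assumes "0 \<le> x" shows "x ^ m \<le> fact m * exp x"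
proof -
  have "(\<Sum>n\<in>{m}. x ^ n /\<^sub>R fact n) \<le> (\<Sum>n. x ^ n /\<^sub>R fact n)"
    using assms by (intro sum_le_suminf summable_exp_generic) auto
  then show ?thesis by (simp add: exp_def field_simps)
qed

lemma integrable_pois_power: "0 \<le> l \<Longrightarrow> integrable (pois l) (\<lambda>j. real j ^ m)"
  using power_le_fact_exp[of "real _" m] by (intro integrable_pois_exp_bound[where a=1]) auto

lemma integrable_pois_of_nat: "0 \<le> l \<Longrightarrow> integrable (pois l) real"
  using integrable_pois_power[of l 1] by simp

text \<open>The Stein--Chen identity, from which all moments below are read off.\<close>

lemma integral_pois_stein:
  assumes l: "0 \<le> l" and G: "integrable (pois l) (\<lambda>j. G (Suc j))"
    and jG: "integrable (pois l) (\<lambda>j. real j * G j)"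
  shows "(\<integral>j. real j * G j \<partial>pois l) = l * (\<integral>j. G (Suc j) \<partial>pois l)"
proof -
  \<comment> \<open>The factor \<open>real j\<close> kills the term j = 0, so the series may be
    shifted by one; \<open>poisson_prob_Suc\<close> then trades the factor j + 1 for l.\<close>
  have "(\<lambda>j. poisson_prob l (Suc j) * (real (Suc j) * G (Suc j))) sums (\<integral>j. real j * G j \<partial>pois l)"
    using sums_integral_pois[OF l jG] by (subst sums_Suc_iff) simp
  moreover have "(\<lambda>j. l * (poisson_prob l j * G (Suc j))) sums (l * (\<integral>j. G (Suc j) \<partial>pois l))"
    by (intro sums_mult sums_integral_pois l G)
  moreover have "l * (poisson_prob l j * G (Suc j)) = poisson_prob l (Suc j) * (real (Suc j) * G (Suc j))" for j
    using arg_cong[OF poisson_prob_Suc[of j l], of "\<lambda>x. x * G (Suc j)"] by (simp only: ac_simps)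
  ultimately have "(\<lambda>j. l * (poisson_prob l j * G (Suc j))) sums (\<integral>j. real j * G j \<partial>pois l)"
    and "(\<lambda>j. l * (poisson_prob l j * G (Suc j))) sums (l * (\<integral>j. G (Suc j) \<partial>pois l))"
    by (simp_all only:)
  then show ?thesis by (rule sums_unique2)
qed

lemma integral_pois_moments:
  assumes l: "0 \<le> l"
  shows "(\<integral>j. real j \<partial>pois l) = l"
    and "(\<integral>j. (real j)^2 \<partial>pois l) = l^2 + l"
    and "(\<integral>j. (real j)^3 \<partial>pois l) = l^3 + 3 * l^2 + l"
    and "(\<integral>j. (real j)^4 \<partial>pois l) = l^4 + 6 * l^3 + 7 * l^2 + l"
proof -
  note int = integrable_pois_power[OF l] integrable_pois_of_nat[OF l]
  show m1: "(\<integral>j. real j \<partial>pois l) = l"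
    using integral_pois_stein[OF l, of "\<lambda>_. 1"] int by simp
  \<comment> \<open>Each further moment is the identity for G j = j ^ m: the moment of order m + 1
    is l times the mean of (N + 1) ^ m, which expands in moments already known.\<close>
  have "(\<integral>j. real j * real j \<partial>pois l) = l * (\<integral>j. real (Suc j) \<partial>pois l)"
    using int(1)[of 2] int(2) by (intro integral_pois_stein[OF l]) (auto simp: power2_eq_square)
  also have "(\<integral>j. real (Suc j) \<partial>pois l) = l + 1"
    using int by (simp add: m1)
  finally show m2: "(\<integral>j. (real j)^2 \<partial>pois l) = l^2 + l"
    by (simp add: power2_eq_square algebra_simps)
  have s: "(real (Suc j))^2 = real j ^ 2 + 2 * real j + 1" "(real (Suc j))^3 = real j ^ 3 + 3 * real j ^2 + 3 * real j + 1" for j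
    by (auto simp: power2_eq_square power3_eq_cube algebra_simps)
  have p3: "real j * real j ^ 2 = real j ^ 3" and p4: "real j * real j ^ 3 = real j ^ 4" for j
    by (simp_all add: power_numeral_reduce)
  have int_s: "integrable (pois l) (\<lambda>j. (real (Suc j))^2)" "integrable (pois l) (\<lambda>j. (real (Suc j))^3)"
    unfolding s by (intro Bochner_Integration.integrable_add integrable_mult_right int integrable_const; simp)+
  have "(\<integral>j. real j * real j^2 \<partial>pois l) = l * (\<integral>j. (real (Suc j))^2 \<partial>pois l)"
    by (rule integral_pois_stein[OF l int_s(1)]) (simp add: p3 int)
  also have "(\<integral>j. (real (Suc j))^2 \<partial>pois l) = l^2 + 3 * l + 1"
    unfolding s using int by (simp add: m1 m2)
  finally show m3: "(\<integral>j. (real j)^3 \<partial>pois l) = l^3 + 3 * l^2 + l"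
    unfolding p3 by (simp add: power2_eq_square power3_eq_cube algebra_simps)
  have "(\<integral>j. real j * real j^3 \<partial>pois l) = l * (\<integral>j. (real (Suc j))^3 \<partial>pois l)"
    by (rule integral_pois_stein[OF l int_s(2)]) (simp add: p4 int)
  also have "(\<integral>j. (real (Suc j))^3 \<partial>pois l) = l^3 + 6 * l^2 + 7 * l + 1"
    unfolding s using int by (simp add: m1 m2 m3)
  finally show "(\<integral>j. (real j)^4 \<partial>pois l) = l^4 + 6 * l^3 + 7 * l^2 + l"
    unfolding p4 by (simp add: power_numeral_reduce algebra_simps)
qed

lemma integral_pois_centered:
  assumes l: "0 \<le> l"
  shows "(\<integral>j. (real j - l)^2 \<partial>pois l) = l" and "integrable (pois l) (\<lambda>j. (real j - l)^2)"
proof -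
  note int = integrable_pois_power[OF l] integrable_pois_of_nat[OF l]
  have s: "(real j - l)^2 = real j ^2 - 2 * l * real j + l^2" for j
    by (simp add: power2_eq_square algebra_simps)
  show "integrable (pois l) (\<lambda>j. (real j - l)^2)" using int unfolding s by simp
  have "(\<integral>j. (real j - l)^2 \<partial>pois l) = (l^2 + l) - 2 * l * l + l^2"
    unfolding s using int by (simp add: integral_pois_moments[OF l])
  then show "(\<integral>j. (real j - l)^2 \<partial>pois l) = l"
    by (simp add: power2_eq_square)
qed

text \<open>Subtracting j or l from the square centres it equally well, but the observation is
  correlated with the square: subtracting it cancels the linear part of the variance and leaves 2
  l^2 instead of 2 l^2 + l.\<close>

definition disp :: "real \<Rightarrow> nat \<Rightarrow> real" where
  "disp l j = (real j - l)^2 - real j"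

lemma disp_moments:
  assumes l: "0 \<le> l"
  shows "integrable (pois l) (disp l)" "integrable (pois l) (\<lambda>j. (disp l j)^2)"
    "(\<integral>j. disp l j \<partial>pois l) = 0" "(\<integral>j. (disp l j)^2 \<partial>pois l) = 2 * l^2"
proof -
  note int = integrable_pois_power[OF l] integrable_pois_of_nat[OF l]
  show "integrable (pois l) (disp l)"
    unfolding disp_def using integral_pois_centered(2)[OF l] int(2) by simp
  show "(\<integral>j. disp l j \<partial>pois l) = 0"
    unfolding disp_def using integral_pois_centered[OF l] int(2)
    by (simp add: integral_pois_moments[OF l])
  have s: "(disp l j)^2 = real j ^4 - (4*l+2) * real j ^3 + (6*l^2+4*l+1) * real j^2 - (4*l^3+2*l^2) * real j + l^4" for j
    by (simp add: disp_def power_numeral_reduce algebra_simps)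
  show "integrable (pois l) (\<lambda>j. (disp l j)^2)" using int unfolding s by simp
  have "(\<integral>j. (disp l j)^2 \<partial>pois l) = (l^4 + 6 * l^3 + 7 * l^2 + l) - (4*l+2) * (l^3 + 3 * l^2 + l)
      + (6*l^2+4*l+1) * (l^2 + l) - (4*l^3+2*l^2) * l + l^4"
    unfolding s using int by (simp add: integral_pois_moments[OF l])
  then show "(\<integral>j. (disp l j)^2 \<partial>pois l) = 2 * l^2"
    by (simp add: power_numeral_reduce algebra_simps)
qed

text \<open>\<open>disp\<close> grows quadratically, so its cube is at most a sixth power of j + l +
  1; the constant 720 is 6!, from one term of the exponential series.\<close>

lemma abs_disp_cube_le: "0 \<le> l \<Longrightarrow> \<bar>disp l j\<bar> ^ 3 \<le> 720 * exp (l + 1) * exp (1 * real j)"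
proof -
  assume l: "0 \<le> l"
  let ?y = "real j + l + 1"
  have "\<bar>disp l j\<bar> \<le> ?y ^ 2"
    using l by (simp add: disp_def abs_le_iff power2_eq_square algebra_simps)
  then have "\<bar>disp l j\<bar> ^ 3 \<le> (?y ^ 2) ^ 3" by (intro power_mono) auto
  also have "\<dots> = ?y ^ 6" by (simp add: power_mult[symmetric])
  also have "\<dots> \<le> fact 6 * exp ?y" using l by (intro power_le_fact_exp) auto
  also have "\<dots> = 720 * exp (l + 1) * exp (1 * real j)"
    by (simp add: fact_numeral exp_add)
  finally show ?thesis .
qed

text \<open>The third absolute moment controls the Taylor remainder of the conditional
  characteristic function. What matters about the explicit bound is that it increases with l, so
  that it is uniform over bounded rates.\<close>

lemma disp_cube_moment:
  assumes l: "0 \<le> l"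
  shows "integrable (pois l) (\<lambda>j. \<bar>disp l j\<bar>^3)"
    "(\<integral>j. \<bar>disp l j\<bar>^3 \<partial>pois l) \<le> 720 * exp (l + 1) * exp (l * (exp 1 - 1))"
proof -
  show i: "integrable (pois l) (\<lambda>j. \<bar>disp l j\<bar>^3)"
    by (rule integrable_pois_exp_bound[OF l, of _ "720 * exp (l + 1)" 1])
      (use abs_disp_cube_le[OF l] in auto)
  have "(\<integral>j. \<bar>disp l j\<bar>^3 \<partial>pois l) \<le> (\<integral>j. 720 * exp (l + 1) * exp (1 * real j) \<partial>pois l)"
    by (intro integral_mono i integrable_pois_exp_bound[OF l, of _ "720 * exp (l + 1)" 1] abs_disp_cube_le l) auto
  also have "\<dots> = 720 * exp (l + 1) * exp (l * (exp 1 - 1))"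
    using integral_pois_exp[OF l, of 1] by simp
  finally show "(\<integral>j. \<bar>disp l j\<bar>^3 \<partial>pois l) \<le> 720 * exp (l + 1) * exp (l * (exp 1 - 1))" .
qed

section \<open>Poisson expectations as functions of the rate\<close>

lemma increments_bound:
  fixes u :: "nat \<Rightarrow> real"
  assumes "\<And>j. \<bar>u (Suc j) - u j\<bar> \<le> K"
  shows "\<bar>u j - u 0\<bar> \<le> K * real j"
proof (induction j)
  case (Suc j)
  then show ?case using assms[of j] by (simp add: algebra_simps abs_le_iff)
qed auto

lemma integrable_pois_increments:
  fixes u :: "nat \<Rightarrow> real"
  assumes "0 \<le> l" and K: "\<And>j. \<bar>u (Suc j) - u j\<bar> \<le> K"
  shows "integrable (pois l) u"
proof (rule integrable_pois_exp_bound[OF assms(1), of _ "\<bar>u 0\<bar> + K" 1])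
  fix j
  have K0: "0 \<le> K" using K[of 0] by linarith
  have "\<bar>u j\<bar> \<le> \<bar>u 0\<bar> + K * real j" using increments_bound[of u K j, OF K] by linarith
  also have "\<dots> \<le> \<bar>u 0\<bar> * exp (real j) + K * exp (real j)"
  proof (intro add_mono mult_left_mono K0)
    show "\<bar>u 0\<bar> \<le> \<bar>u 0\<bar> * exp (real j)" by (simp add: mult_le_cancel_left1)
    show "real j \<le> exp (real j)" using exp_ge_add_one_self[of "real j"] by linarith
  qed
  finally show "\<bar>u j\<bar> \<le> (\<bar>u 0\<bar> + K) * exp (1 * real j)" by (simp add: algebra_simps)
qed

text \<open>The map \<open>l \<mapsto> E u(N)\<close>, \<open>N\<close> Poisson with rate \<open>l\<close>, has derivative \<open>E (u(N+1) - u(N))\<close>.\<close>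

lemma integral_pois_lipschitz:
  fixes u :: "nat \<Rightarrow> real"
  assumes l: "0 \<le> l" "0 \<le> l'" and K: "\<And>j. \<bar>u (Suc j) - u j\<bar> \<le> K"
  shows "\<bar>(\<integral>j. u j \<partial>pois l) - (\<integral>j. u j \<partial>pois l')\<bar> \<le> K * \<bar>l - l'\<bar>"
proof -
  \<comment> \<open>Up to the factor exp (- x), the Poisson mean of u is the power series with
    coefficients \<open>a\<close>; its formal derivative \<open>diffs a\<close> belongs to the
    shifted function u (j + 1).\<close>
  define a where "a j = u j / fact j" for j
  have diffs_a: "diffs a j = u (Suc j) / fact j" for j
    by (simp add: a_def diffs_def field_simps del: of_nat_Suc)
  have K': "\<bar>u (Suc (Suc j)) - u (Suc j)\<bar> \<le> K" for j by (rule K)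
  have intu: "integrable (pois x) u" "integrable (pois x) (\<lambda>j. u (Suc j))" if "0 \<le> x" for x
    using integrable_pois_increments[OF that, of u K] integrable_pois_increments[OF that, of "\<lambda>j. u (Suc j)" K] K
    by auto
  have sums: "(\<lambda>j. a j * x ^ j) sums (exp x * (\<integral>j. u j \<partial>pois x))"
    "(\<lambda>j. diffs a j * x ^ j) sums (exp x * (\<integral>j. u (Suc j) \<partial>pois x))" if "0 \<le> x" for x
    using sums_mult[OF sums_integral_pois[OF that intu(1)[OF that]], of "exp x"]
      sums_mult[OF sums_integral_pois[OF that intu(2)[OF that]], of "exp x"]
    by (simp_all add: poisson_prob_def a_def diffs_a exp_minus field_simps)
  \<comment> \<open>Poisson integrability gives convergence at nonnegative arguments only; a power
    series that converges at \<bar>y\<bar> + 1 converges at y of either sign.\<close>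
  have "summable (\<lambda>n. a n * y ^ n)" for y
  proof (rule powser_inside)
    show "summable (\<lambda>n. a n * (\<bar>y\<bar> + 1) ^ n)"
      using sums(1)[of "\<bar>y\<bar> + 1"] by (simp add: sums_iff)
  qed auto
  then have der: "((\<lambda>x. \<Sum>n. a n * x^n) has_field_derivative (\<Sum>n. diffs a n * x^n)) (at x)" for x
    by (rule termdiffs_strong_converges_everywhere)
  \<comment> \<open>The series extends the Poisson mean to all real rates, so a two-sided derivative
    exists even at the boundary rate 0.\<close>
  define I where "I x = exp (- x) * (\<Sum>n. a n * x^n)" for x :: real
  have I_eq: "I x = (\<integral>j. u j \<partial>pois x)" if "0 \<le> x" for x
    using sums(1)[OF that] by (simp add: I_def sums_iff exp_minus)
  have derI: "(I has_field_derivative (\<integral>j. (u (Suc j) - u j) \<partial>pois x)) (at x)" if "0 \<le> x" for x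
  proof -
    have "(I has_field_derivative exp (- x) * (\<Sum>n. diffs a n * x^n) - exp (- x) * (\<Sum>n. a n * x^n)) (at x)"
      unfolding I_def by (auto intro!: derivative_eq_intros der)
    then show ?thesis
      using sums(1)[OF that] sums(2)[OF that] intu[OF that] by (simp add: sums_iff exp_minus mult.assoc[symmetric])
  qed
  have "norm (I l - I l') \<le> K * norm (l - l')"
  proof (rule field_differentiable_bound[where S="{0..}" and f'="\<lambda>x. (\<integral>j. (u (Suc j) - u j) \<partial>pois x)"])
    show "norm (\<integral>j. (u (Suc j) - u j) \<partial>pois x) \<le> K" if "x \<in> {0..}" for x
    proof -
      have "norm (\<integral>j. (u (Suc j) - u j) \<partial>pois x) \<le> (\<integral>j. norm (u (Suc j) - u j) \<partial>pois x)"
        by (rule integral_norm_bound)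
      also have "\<dots> \<le> (\<integral>j. K \<partial>pois x)"
        using K intu[of x] that by (intro integral_mono) auto
      finally show ?thesis by simp
    qed
  qed (use l derI in \<open>auto intro: has_field_derivative_at_within\<close>)
  then show ?thesis by (simp add: I_eq l)
qed

section \<open>Exponential moments of the centred Poisson law\<close>

lemma exp_le_quadratic:
  fixes x :: real assumes "\<bar>x\<bar> \<le> 1" shows "exp x \<le> 1 + x + x\<^sup>2"
proof (cases "0 \<le> x")
  case True
  then show ?thesis using assms by (intro exp_bound) auto
next
  case False
  have "(1 - x) * exp x \<le> exp (- x) * exp x"
    using exp_ge_add_one_self[of "- x"] by (intro mult_right_mono) auto
  also have "\<dots> = 1" by (simp add: exp_minus)
  \<comment> \<open>The product equals 1 - x^3, and x is negative here.\<close>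
  also have "1 \<le> (1 - x) * (1 + x + x\<^sup>2)"
    using False mult_nonneg_nonneg[of "x\<^sup>2" "-x"] by (simp add: algebra_simps power2_eq_square)
  finally show ?thesis using False by (simp add: mult_le_cancel_left)
qed

text \<open>The logarithm of the exponential moment is l * (exp a - 1 - a), which is comparable to l
  * a^2 only for bounded a. The restriction \<bar>a\<bar> \<le> 1 and the factor l are the reasons
  why perturbations are later clipped and reset.\<close>

lemma integral_pois_exp_centered_le:
  assumes l: "0 \<le> l" and a: "\<bar>a\<bar> \<le> 1"
  shows "(\<integral>j. exp (a * (real j - l)) \<partial>pois l) \<le> exp (l * a\<^sup>2)"
    and "integrable (pois l) (\<lambda>j. exp (a * (real j - l)))"
proof -
  have s: "exp (a * (real j - l)) = exp (- a * l) * exp (a * real j)" for j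
    by (simp add: exp_add[symmetric] algebra_simps)
  show "integrable (pois l) (\<lambda>j. exp (a * (real j - l)))"
    unfolding s by (rule integrable_pois_exp_bound[OF l, of _ "exp (-a*l)" a]) auto
  have "(\<integral>j. exp (a * (real j - l)) \<partial>pois l) = exp (l * (exp a - 1 - a))"
  proof -
    have "(\<integral>j. exp (a * (real j - l)) \<partial>pois l) = exp (- a * l) * exp (l * (exp a - 1))"
      unfolding s by (simp add: integral_pois_exp[OF l])
    then show ?thesis by (simp add: exp_add[symmetric] algebra_simps)
  qed
  also have "\<dots> \<le> exp (l * a\<^sup>2)"
    using exp_le_quadratic[OF a] l by (simp add: mult_left_mono)
  finally show "(\<integral>j. exp (a * (real j - l)) \<partial>pois l) \<le> exp (l * a\<^sup>2)" .
qed

section \<open>Poisson autoregressions with a contractive intensity map\<close>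

text \<open>\<open>L k\<close> is known in \<open>F k\<close>, whereas \<open>Y k\<close> is known
  only in \<open>F (Suc k)\<close>. The conditional law is given as an identity of measures on every
  event of the past, ready for Fubini, and stationarity is asked of the marginal law of
  \<open>L\<close> alone. The map \<open>g\<close> is contractive on all reals, which makes it
  continuous and measurable at once.\<close>

locale poisson_chain = prob_space M for M :: "'w measure" +
  fixes F :: "nat \<Rightarrow> 'w measure" and L :: "nat \<Rightarrow> 'w \<Rightarrow> real" and Y :: "nat \<Rightarrow> 'w \<Rightarrow> nat"
    and g :: "real \<Rightarrow> nat \<Rightarrow> real" and \<kappa>1 \<kappa>2 :: real
  assumes subalg: "subalgebra M (F k)"
    and filtration: "sets (F k) \<subseteq> sets (F (Suc k))"
    and L_meas_F: "L k \<in> borel_measurable (F k)"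
    and Y_meas_F: "Y k \<in> measurable (F (Suc k)) (count_space UNIV)"
    and L_nonneg: "\<omega> \<in> space M \<Longrightarrow> 0 \<le> L k \<omega>"
    and kernel: "A \<in> sets (F k) \<Longrightarrow> emeasure M (A \<inter> Y k -` {j})
                   = (\<integral>\<^sup>+\<omega>. ennreal (poisson_prob (L k \<omega>) j) * indicator A \<omega> \<partial>M)"
    and kappa_nonneg: "0 \<le> \<kappa>1" "0 \<le> \<kappa>2" and kappa_sum: "\<kappa>1 + \<kappa>2 < 1"
    and g_nonneg: "0 \<le> g l y"
    and g_contr: "\<bar>g l y - g l' y'\<bar> \<le> \<kappa>1 * \<bar>l - l'\<bar> + \<kappa>2 * \<bar>real y - real y'\<bar>"
    and rec: "AE \<omega> in M. L (Suc k) \<omega> = g (L k \<omega>) (Y k \<omega>)"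
    and stat: "distr M borel (L k) = distr M borel (L 0)"
begin

lemma space_F: "space (F k) = space M"
  using subalg[of k] by (simp add: subalgebra_def)

lemma sets_F_mono: "k \<le> n \<Longrightarrow> sets (F k) \<subseteq> sets (F n)"
  using lift_Suc_mono_le[of "\<lambda>k. sets (F k)"] filtration by blast

lemma measurable_F_mono: "k \<le> n \<Longrightarrow> f \<in> measurable (F k) N \<Longrightarrow> f \<in> measurable (F n) N"
  using sets_F_mono[of k n] by (auto simp: measurable_def space_F)

lemma measurable_F_M: "f \<in> measurable (F k) N \<Longrightarrow> f \<in> measurable M N"
  by (rule measurable_from_subalg[OF subalg])

lemma L_measurable [measurable]: "L k \<in> borel_measurable M"
  by (rule measurable_F_M[OF L_meas_F])

lemma Y_measurable [measurable]: "Y k \<in> measurable M (count_space UNIV)"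
  by (rule measurable_F_M[OF Y_meas_F])

lemma L_meas_F_le: "k \<le> n \<Longrightarrow> L k \<in> borel_measurable (F n)"
  by (rule measurable_F_mono[OF _ L_meas_F])

lemma Y_meas_F_le: "k < n \<Longrightarrow> Y k \<in> measurable (F n) (count_space UNIV)"
  by (rule measurable_F_mono[OF _ Y_meas_F]) simp

subsection \<open>Conditioning on the past\<close>

abbreviation restrF :: "nat \<Rightarrow> 'w measure" where
  "restrF k \<equiv> restr_to_subalg M (F k)"

lemma prob_space_restrF: "prob_space (restrF k)"
  by (rule prob_space_restr_to_subalg[OF subalg prob_space_axioms])

lemma measurable_restrF: "f \<in> measurable (F k) N \<Longrightarrow> f \<in> measurable (restrF k) N"
  by (rule measurable_in_subalg[OF subalg])

lemma measurable_restrF_pair: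
  fixes H :: "nat \<Rightarrow> 'w \<Rightarrow> 'b"
  assumes "\<And>j. (\<lambda>\<omega>. H j \<omega>) \<in> measurable (F k) N"
  shows "(\<lambda>(\<omega>, j). H j \<omega>) \<in> measurable (restrF k \<Otimes>\<^sub>M count_space UNIV) N"
proof -
  have [measurable]: "H j \<in> measurable (restrF k) N" for j
    using measurable_restrF[OF assms] .
  have "(\<lambda>z. H (snd z) (fst z)) \<in> measurable (restrF k \<Otimes>\<^sub>M count_space (UNIV :: nat set)) N"
    by (rule measurable_compose_countable'[where f="\<lambda>j z. H j (fst z)" and g=snd and I=UNIV]) simp_all
  then show ?thesis by (simp add: case_prod_beta')
qed

text \<open>The second coordinate is countable, so a measurable set splits into sections that are
  events of the past, and \<open>kernel\<close> settles each of them. Conditioning on the past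
  thereby becomes integration over a product with the counting measure.\<close>

lemma kernel_distr:
  "distr M (restrF k \<Otimes>\<^sub>M count_space UNIV) (\<lambda>\<omega>. (\<omega>, Y k \<omega>))
   = density (restrF k \<Otimes>\<^sub>M count_space UNIV) (\<lambda>(\<omega>, j). ennreal (poisson_prob (L k \<omega>) j))"
    (is "distr M ?P ?h = density ?P ?p")
proof (rule measure_eqI)
  fix S assume "S \<in> sets (distr M ?P ?h)"
  then have S [measurable]: "S \<in> sets ?P" by simp
  have id: "(\<lambda>\<omega>. \<omega>) \<in> measurable M (restrF k)"
    using sets_restr_to_subalg[OF subalg[of k]]
    by (intro measurable_F_M[of _ k] measurable_ident_sets) simp
  have h: "?h \<in> measurable M ?P"
    using id by (intro measurable_Pair) auto
  define T where "T j = {\<omega>\<in>space M. (\<omega>, j) \<in> S}" for j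
  have T: "T j \<in> sets (F k)" for j
  proof -
    have "(\<lambda>\<omega>. (\<omega>, j)) -` S \<in> sets (restrF k)" by (rule sets_Pair2[OF S])
    moreover have "(\<lambda>\<omega>. (\<omega>, j)) -` S = T j"
      using sets.sets_into_space[OF S] by (auto simp: T_def space_pair_measure space_restr_to_subalg)
    ultimately show ?thesis by (simp add: sets_restr_to_subalg[OF subalg])
  qed
  have TM: "T j \<inter> Y k -` {j} \<in> sets M" for j
  proof -
    have "T j \<inter> Y k -` {j} = T j \<inter> (Y k -` {j} \<inter> space M)" by (auto simp: T_def)
    moreover have "T j \<in> sets M" using T[of j] subalg[of k] by (auto simp: subalgebra_def)
    ultimately show ?thesis using measurable_sets[OF Y_measurable, of "{j}" k] by simp
  qed
  have pm: "(\<lambda>\<omega>. ennreal (poisson_prob (L k \<omega>) j) * indicator (T j) \<omega>) \<in> borel_measurable (F k)" for j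
    using L_meas_F[of k] T[of j] by simp
  have "?h -` S \<inter> space M = (\<Union>j. T j \<inter> Y k -` {j})"
    by (auto simp: T_def)
  then have "emeasure (distr M ?P ?h) S = emeasure M (\<Union>j. T j \<inter> Y k -` {j})"
    by (simp add: emeasure_distr[OF h S])
  also have "\<dots> = (\<Sum>j. emeasure M (T j \<inter> Y k -` {j}))"
    using TM by (intro suminf_emeasure[symmetric]) (auto simp: disjoint_family_on_def)
  also have "\<dots> = (\<Sum>j. \<integral>\<^sup>+\<omega>. ennreal (poisson_prob (L k \<omega>) j) * indicator (T j) \<omega> \<partial>restrF k)"
    using nn_integral_subalgebra2[OF subalg pm] by (simp add: kernel[OF T])
  also have "\<dots> = (\<integral>\<^sup>+\<omega>. (\<Sum>j. ennreal (poisson_prob (L k \<omega>) j) * indicator (T j) \<omega>) \<partial>restrF k)"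
    using pm measurable_restrF by (intro nn_integral_suminf[symmetric]) blast
  also have "\<dots> = (\<integral>\<^sup>+\<omega>. \<integral>\<^sup>+j. ?p (\<omega>, j) * indicator S (\<omega>, j) \<partial>count_space UNIV \<partial>restrF k)"
    by (intro nn_integral_cong)
      (auto simp: nn_integral_count_space_nat T_def space_restr_to_subalg indicator_def intro!: suminf_cong)
  also have "\<dots> = (\<integral>\<^sup>+z. ?p z * indicator S z \<partial>?P)"
    using measurable_restrF_pair[of "\<lambda>j \<omega>. ennreal (poisson_prob (L k \<omega>) j)" k borel] L_meas_F[of k]
    by (intro sigma_finite_measure.nn_integral_fst sigma_finite_measure_count_space) auto
  also have "\<dots> = emeasure (density ?P ?p) S"
    using measurable_restrF_pair[of "\<lambda>j \<omega>. ennreal (poisson_prob (L k \<omega>) j)" k borel] L_meas_F[of k]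
    by (intro emeasure_density[symmetric]) auto
  finally show "emeasure (distr M ?P ?h) S = emeasure (density ?P ?p) S" .
qed simp

text \<open>Fubini for \<open>kernel_distr\<close> gives the tower property: \<open>H\<close> may
  use the past through \<omega>, which stays frozen while j is averaged out.\<close>

lemma kernel_nn_integral:
  assumes H: "\<And>j. (\<lambda>\<omega>. H j \<omega>) \<in> borel_measurable (F k)"
  shows "(\<integral>\<^sup>+\<omega>. H (Y k \<omega>) \<omega> \<partial>M) = (\<integral>\<^sup>+\<omega>. (\<integral>\<^sup>+j. H j \<omega> \<partial>pois (L k \<omega>)) \<partial>M)"
proof -
  let ?P = "restrF k \<Otimes>\<^sub>M count_space UNIV"
  have id: "(\<lambda>\<omega>. \<omega>) \<in> measurable M (restrF k)"
    using sets_restr_to_subalg[OF subalg[of k]]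
    by (intro measurable_F_M[of _ k] measurable_ident_sets) simp
  have Hm: "(\<lambda>(\<omega>, j). H j \<omega>) \<in> borel_measurable ?P"
    by (rule measurable_restrF_pair[OF H])
  have pm: "(\<lambda>(\<omega>, j). ennreal (poisson_prob (L k \<omega>) j)) \<in> borel_measurable ?P"
    using L_meas_F[of k] by (intro measurable_restrF_pair) simp
  have "(\<integral>\<^sup>+\<omega>. H (Y k \<omega>) \<omega> \<partial>M) = (\<integral>\<^sup>+z. (\<lambda>(\<omega>, j). H j \<omega>) z \<partial>distr M ?P (\<lambda>\<omega>. (\<omega>, Y k \<omega>)))"
    using Hm id by (subst nn_integral_distr) (auto intro!: measurable_Pair)
  also have "\<dots> = (\<integral>\<^sup>+z. (\<lambda>(\<omega>, j). ennreal (poisson_prob (L k \<omega>) j)) z * (\<lambda>(\<omega>, j). H j \<omega>) z \<partial>?P)"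
    unfolding kernel_distr by (rule nn_integral_density[OF pm Hm])
  also have "\<dots> = (\<integral>\<^sup>+\<omega>. \<integral>\<^sup>+j. ennreal (poisson_prob (L k \<omega>) j) * H j \<omega> \<partial>count_space UNIV \<partial>restrF k)"
    using pm Hm
    by (subst sigma_finite_measure.nn_integral_fst[OF sigma_finite_measure_count_space, symmetric]) auto
  also have "\<dots> = (\<integral>\<^sup>+\<omega>. \<integral>\<^sup>+j. ennreal (poisson_prob (L k \<omega>) j) * H j \<omega> \<partial>count_space UNIV \<partial>M)"
    using H L_meas_F[of k]
    by (intro nn_integral_subalgebra2 subalg) (simp add: nn_integral_count_space_nat)
  also have "\<dots> = (\<integral>\<^sup>+\<omega>. (\<integral>\<^sup>+j. H j \<omega> \<partial>pois (L k \<omega>)) \<partial>M)"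
    by (intro nn_integral_cong) (simp add: nn_integral_measure_pmf pmf_pois L_nonneg)
  finally show ?thesis .
qed

lemma kernel_integral_measurable:
  fixes H :: "nat \<Rightarrow> 'w \<Rightarrow> 'b::{banach, second_countable_topology}"
  assumes H: "\<And>j. (\<lambda>\<omega>. H j \<omega>) \<in> borel_measurable (F k)"
  shows "(\<lambda>\<omega>. \<integral>j. H j \<omega> \<partial>pois (L k \<omega>)) \<in> borel_measurable (F k)"
    (is "?I \<in> _")
proof -
  have [measurable]: "(\<lambda>(\<omega>, j). poisson_prob (L k \<omega>) j *\<^sub>R H j \<omega>) \<in> borel_measurable (restrF k \<Otimes>\<^sub>M count_space UNIV)"
    using L_meas_F[of k] H by (intro measurable_restrF_pair) simp
  have "(\<lambda>\<omega>. \<integral>j. poisson_prob (L k \<omega>) j *\<^sub>R H j \<omega> \<partial>count_space UNIV) \<in> borel_measurable (restrF k)"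
    by (rule sigma_finite_measure.borel_measurable_lebesgue_integral[OF sigma_finite_measure_count_space]) simp
  then have "(\<lambda>\<omega>. \<integral>j. poisson_prob (L k \<omega>) j *\<^sub>R H j \<omega> \<partial>count_space UNIV) \<in> borel_measurable (F k)"
    by (rule measurable_in_subalg'[OF subalg])
  also have "?this \<longleftrightarrow> ?thesis"
    by (intro measurable_cong)
      (simp add: measure_pmf_eq_density[of "pois _"] integral_density pmf_pois L_nonneg poisson_prob_nonneg space_F)
  finally show ?thesis .
qed

text \<open>The tower property for Banach valued integrands, since it is applied to real moments as
  well as to complex exponentials.\<close>

lemma kernel_integral:
  fixes H :: "nat \<Rightarrow> 'w \<Rightarrow> 'b::{banach, second_countable_topology}"
  assumes H: "\<And>j. (\<lambda>\<omega>. H j \<omega>) \<in> borel_measurable (F k)"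
    and int: "integrable M (\<lambda>\<omega>. H (Y k \<omega>) \<omega>)"
  shows "(\<integral>\<omega>. H (Y k \<omega>) \<omega> \<partial>M) = (\<integral>\<omega>. (\<integral>j. H j \<omega> \<partial>pois (L k \<omega>)) \<partial>M)"
    and "integrable M (\<lambda>\<omega>. \<integral>j. H j \<omega> \<partial>pois (L k \<omega>))"
proof -
  let ?P = "restrF k \<Otimes>\<^sub>M count_space (UNIV :: nat set)"
  let ?q = "\<lambda>(\<omega>, j). poisson_prob (L k \<omega>) j"
  interpret R: prob_space "restrF k" by (rule prob_space_restrF)
  interpret PS: pair_sigma_finite "restrF k" "count_space (UNIV :: nat set)"
    by (intro pair_sigma_finite.intro R.sigma_finite_measure_axioms sigma_finite_measure_count_space)
  have id: "(\<lambda>\<omega>. \<omega>) \<in> measurable M (restrF k)"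
    using sets_restr_to_subalg[OF subalg[of k]]
    by (intro measurable_F_M[of _ k] measurable_ident_sets) simp
  have h: "(\<lambda>\<omega>. (\<omega>, Y k \<omega>)) \<in> measurable M ?P"
    using id by (intro measurable_Pair) auto
  have Hm [measurable]: "(\<lambda>(\<omega>, j). H j \<omega>) \<in> borel_measurable ?P"
    by (rule measurable_restrF_pair[OF H])
  have qm [measurable]: "?q \<in> borel_measurable ?P"
    using L_meas_F[of k] by (intro measurable_restrF_pair) simp
  have q0: "AE z in ?P. 0 \<le> ?q z"
    by (intro AE_I2) (auto simp: space_pair_measure space_restr_to_subalg L_nonneg poisson_prob_nonneg)
  have dens: "density ?P (\<lambda>(\<omega>, j). ennreal (poisson_prob (L k \<omega>) j)) = density ?P (\<lambda>z. ennreal (?q z))"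
    by (simp add: case_prod_beta')
  have inner: "(\<integral>j. ?q (\<omega>, j) *\<^sub>R H j \<omega> \<partial>count_space UNIV) = (\<integral>j. H j \<omega> \<partial>pois (L k \<omega>))"
    if "\<omega> \<in> space M" for \<omega>
    by (simp add: measure_pmf_eq_density[of "pois _"] integral_density pmf_pois L_nonneg that poisson_prob_nonneg)
  have "integrable (distr M ?P (\<lambda>\<omega>. (\<omega>, Y k \<omega>))) (\<lambda>(\<omega>, j). H j \<omega>)"
    using int by (simp add: integrable_distr_eq[OF h Hm])
  then have I: "integrable ?P (\<lambda>z. ?q z *\<^sub>R (\<lambda>(\<omega>, j). H j \<omega>) z)"
    unfolding kernel_distr dens integrable_density[OF Hm qm q0] .
  have If: "(\<lambda>\<omega>. \<integral>j. ?q (\<omega>, j) *\<^sub>R H j \<omega> \<partial>count_space UNIV) \<in> borel_measurable (F k)"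
    using PS.integrable_fst'[OF I] by (intro measurable_in_subalg'[OF subalg]) auto
  have "integrable M (\<lambda>\<omega>. \<integral>j. ?q (\<omega>, j) *\<^sub>R H j \<omega> \<partial>count_space UNIV)"
    using PS.integrable_fst'[OF I] by (intro integrable_from_subalg[OF subalg]) simp
  also have "?this \<longleftrightarrow> integrable M (\<lambda>\<omega>. \<integral>j. H j \<omega> \<partial>pois (L k \<omega>))"
    by (intro Bochner_Integration.integrable_cong refl inner)
  finally show "integrable M (\<lambda>\<omega>. \<integral>j. H j \<omega> \<partial>pois (L k \<omega>))" .
  have "(\<integral>\<omega>. H (Y k \<omega>) \<omega> \<partial>M) = (\<integral>z. (\<lambda>(\<omega>, j). H j \<omega>) z \<partial>distr M ?P (\<lambda>\<omega>. (\<omega>, Y k \<omega>)))"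
    by (simp add: integral_distr[OF h Hm])
  also have "\<dots> = (\<integral>z. ?q z *\<^sub>R (\<lambda>(\<omega>, j). H j \<omega>) z \<partial>?P)"
    unfolding kernel_distr dens by (rule integral_density[OF Hm qm q0])
  also have "\<dots> = (\<integral>\<omega>. \<integral>j. ?q (\<omega>, j) *\<^sub>R H j \<omega> \<partial>count_space UNIV \<partial>restrF k)"
    using PS.integral_fst'[OF I] by simp
  also have "\<dots> = (\<integral>\<omega>. \<integral>j. ?q (\<omega>, j) *\<^sub>R H j \<omega> \<partial>count_space UNIV \<partial>M)"
    by (rule integral_subalgebra2[OF subalg If])
  also have "\<dots> = (\<integral>\<omega>. (\<integral>j. H j \<omega> \<partial>pois (L k \<omega>)) \<partial>M)"
    by (intro Bochner_Integration.integral_cong refl inner)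
  finally show "(\<integral>\<omega>. H (Y k \<omega>) \<omega> \<partial>M) = (\<integral>\<omega>. (\<integral>j. H j \<omega> \<partial>pois (L k \<omega>)) \<partial>M)" .
qed

text \<open>The converse direction, by Tonelli: integrability of conditional absolute moments, which
  are explicit functions of \<open>L k\<close>, yields integrability of functions of
  \<open>Y k\<close>.\<close>

lemma kernel_integrable:
  fixes H :: "nat \<Rightarrow> 'w \<Rightarrow> real"
  assumes H: "\<And>j. (\<lambda>\<omega>. H j \<omega>) \<in> borel_measurable (F k)"
    and pint: "\<And>\<omega>. \<omega> \<in> space M \<Longrightarrow> integrable (pois (L k \<omega>)) (\<lambda>j. H j \<omega>)"
    and int: "integrable M (\<lambda>\<omega>. \<integral>j. \<bar>H j \<omega>\<bar> \<partial>pois (L k \<omega>))"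
  shows "integrable M (\<lambda>\<omega>. H (Y k \<omega>) \<omega>)"
proof (rule integrableI_bounded)
  have [measurable]: "H j \<in> borel_measurable M" for j
    by (rule measurable_F_M[OF H])
  show "(\<lambda>\<omega>. H (Y k \<omega>) \<omega>) \<in> borel_measurable M"
    by (rule measurable_compose_countable[OF _ Y_measurable]) simp
  have "(\<integral>\<^sup>+\<omega>. ennreal (norm (H (Y k \<omega>) \<omega>)) \<partial>M) = (\<integral>\<^sup>+\<omega>. \<integral>\<^sup>+j. ennreal \<bar>H j \<omega>\<bar> \<partial>pois (L k \<omega>) \<partial>M)"
    using H by (subst kernel_nn_integral[of "\<lambda>j \<omega>. ennreal (norm (H j \<omega>))"]) simp_all
  also have "\<dots> = (\<integral>\<^sup>+\<omega>. ennreal (\<integral>j. \<bar>H j \<omega>\<bar> \<partial>pois (L k \<omega>)) \<partial>M)"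
    using pint by (intro nn_integral_cong nn_integral_eq_integral) auto
  also have "\<dots> < \<infinity>"
    using int by (subst nn_integral_eq_integral) auto
  finally show "(\<integral>\<^sup>+\<omega>. ennreal (norm (H (Y k \<omega>) \<omega>)) \<partial>M) < \<infinity>" .
qed

lemma g_lipschitz: "\<bar>g l y - g l' y\<bar> \<le> \<kappa>1 * \<bar>l - l'\<bar>"
  using g_contr[of l y l' y] by simp

lemma g_measurable [measurable]: "(\<lambda>l. g l y) \<in> borel_measurable borel"
proof (rule borel_measurable_continuous_onI)
  have "\<kappa>1-lipschitz_on UNIV (\<lambda>l. g l y)"
    using g_lipschitz kappa_nonneg by (intro lipschitz_onI) (auto simp: dist_real_def)
  then show "continuous_on UNIV (\<lambda>l. g l y)"
    by (rule lipschitz_on_continuous_on)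
qed

lemma g_le: "0 \<le> l \<Longrightarrow> g l y \<le> g 0 0 + \<kappa>1 * l + \<kappa>2 * real y"
  using g_contr[of l y 0 0] by (auto simp: abs_le_iff)

subsection \<open>Second moments\<close>

lemma
  fixes \<phi> :: "real \<Rightarrow> real"
  assumes [measurable]: "\<phi> \<in> borel_measurable borel"
  shows expectation_L_stat: "(\<integral>\<omega>. \<phi> (L k \<omega>) \<partial>M) = (\<integral>\<omega>. \<phi> (L 0 \<omega>) \<partial>M)"
    and integrable_L_stat: "integrable M (\<lambda>\<omega>. \<phi> (L k \<omega>)) \<longleftrightarrow> integrable M (\<lambda>\<omega>. \<phi> (L 0 \<omega>))"
proof -
  have "(\<integral>\<omega>. \<phi> (L k \<omega>) \<partial>M) = (\<integral>x. \<phi> x \<partial>distr M borel (L k))"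
    by (subst integral_distr) auto
  also have "\<dots> = (\<integral>\<omega>. \<phi> (L 0 \<omega>) \<partial>M)"
    unfolding stat[of k] by (subst integral_distr) auto
  finally show "(\<integral>\<omega>. \<phi> (L k \<omega>) \<partial>M) = (\<integral>\<omega>. \<phi> (L 0 \<omega>) \<partial>M)" .
  have "integrable M (\<lambda>\<omega>. \<phi> (L k \<omega>)) \<longleftrightarrow> integrable (distr M borel (L k)) \<phi>"
    by (subst integrable_distr_eq) auto
  also have "\<dots> \<longleftrightarrow> integrable M (\<lambda>\<omega>. \<phi> (L 0 \<omega>))"
    unfolding stat[of k] by (subst integrable_distr_eq) auto
  finally show "integrable M (\<lambda>\<omega>. \<phi> (L k \<omega>)) \<longleftrightarrow> integrable M (\<lambda>\<omega>. \<phi> (L 0 \<omega>))" .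
qed

text \<open>The Markov property tested against a bounded function of the past. The case Z = 1 turns
  stationarity into an inequality for moments; general Z produces covariances.\<close>

lemma expectation_step:
  fixes \<phi> :: "real \<Rightarrow> real"
  assumes [measurable]: "\<phi> \<in> borel_measurable borel" and bd: "\<And>x. \<bar>\<phi> x\<bar> \<le> c"
    and Z: "Z \<in> borel_measurable (F k)" "\<And>\<omega>. \<omega> \<in> space M \<Longrightarrow> \<bar>Z \<omega>\<bar> \<le> d"
  shows "(\<integral>\<omega>. Z \<omega> * \<phi> (L (Suc k) \<omega>) \<partial>M) = (\<integral>\<omega>. Z \<omega> * (\<integral>j. \<phi> (g (L k \<omega>) j) \<partial>pois (L k \<omega>)) \<partial>M)"
proof -
  have [measurable]: "Z \<in> borel_measurable M" by (rule measurable_F_M[OF Z(1)])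
  have m: "(\<lambda>\<omega>. Z \<omega> * \<phi> (g (L k \<omega>) j)) \<in> borel_measurable (F k)" for j
    using Z(1) L_meas_F[of k] by measurable
  have mM: "(\<lambda>\<omega>. Z \<omega> * \<phi> (g (L k \<omega>) (Y k \<omega>))) \<in> borel_measurable M"
    by (rule measurable_compose_countable[where f="\<lambda>j \<omega>. Z \<omega> * \<phi> (g (L k \<omega>) j)", OF _ Y_measurable]) measurable
  have "(\<integral>\<omega>. Z \<omega> * \<phi> (L (Suc k) \<omega>) \<partial>M) = (\<integral>\<omega>. Z \<omega> * \<phi> (g (L k \<omega>) (Y k \<omega>)) \<partial>M)"
    using rec[of k] mM by (intro integral_cong_AE) auto
  also have "\<dots> = (\<integral>\<omega>. (\<integral>j. Z \<omega> * \<phi> (g (L k \<omega>) j) \<partial>pois (L k \<omega>)) \<partial>M)"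
  proof (rule kernel_integral(1)[OF m])
    have "\<bar>Z \<omega> * \<phi> (g (L k \<omega>) (Y k \<omega>))\<bar> \<le> d * c" if "\<omega> \<in> space M" for \<omega>
      using Z(2)[OF that] bd[of "g (L k \<omega>) (Y k \<omega>)"] by (auto simp: abs_mult intro!: mult_mono)
    then show "integrable M (\<lambda>\<omega>. Z \<omega> * \<phi> (g (L k \<omega>) (Y k \<omega>)))"
      using mM by (intro integrable_const_bound[where B="d * c"]) auto
  qed
  finally show ?thesis by simp
qed

text \<open>Integrability of \<open>L\<^sup>2\<close> is not assumed: the drift inequality below is integrated after
  truncating \<open>L\<^sup>2\<close> at \<open>K\<close>, where stationarity makes both sides finite and comparable.\<close>

lemma drift:
  obtains \<rho> b where "\<rho> < 1" "0 \<le> \<rho>" "0 \<le> b"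
    "\<And>l. 0 \<le> l \<Longrightarrow> (\<integral>j. (g l j)\<^sup>2 \<partial>pois l) \<le> \<rho> * l\<^sup>2 + b"
    "\<And>l. 0 \<le> l \<Longrightarrow> integrable (pois l) (\<lambda>j. (g l j)\<^sup>2)"
proof -
  define c where "c = g 0 0"
  define \<kappa> where "\<kappa> = \<kappa>1 + \<kappa>2"
  have c0: "0 \<le> c" unfolding c_def by (rule g_nonneg)
  have \<kappa>: "0 \<le> \<kappa>" "\<kappa> < 1" using kappa_nonneg kappa_sum by (auto simp: \<kappa>_def)
  \<comment> \<open>The gap left by the contraction; half of it will be spent on the linear term d *
    l, so the final rate is 1 - e / 2.\<close>
  define e where "e = 1 - \<kappa>\<^sup>2"
  have e: "0 < e" using \<kappa> by (simp add: e_def power_less_one_iff abs_square_less_1)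
  define d where "d = 2 * c * \<kappa> + \<kappa>2\<^sup>2"
  define b where "b = c\<^sup>2 + d\<^sup>2 / (2 * e)"
  have bound: "(\<integral>j. (g l j)\<^sup>2 \<partial>pois l) \<le> (1 - e / 2) * l\<^sup>2 + b \<and> integrable (pois l) (\<lambda>j. (g l j)\<^sup>2)" if l: "0 \<le> l" for l
  proof -
    note int = integrable_pois_power[OF l] integrable_pois_of_nat[OF l]
    define v where "v = c + \<kappa>1 * l"
    have s: "(v + \<kappa>2 * real j)\<^sup>2 = v\<^sup>2 + (2 * v * \<kappa>2) * real j + \<kappa>2\<^sup>2 * (real j)\<^sup>2" for j
      by (simp add: power2_eq_square algebra_simps)
    have i: "integrable (pois l) (\<lambda>j. (v + \<kappa>2 * real j)\<^sup>2)"
      unfolding s using int by simp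
    have le: "(g l j)\<^sup>2 \<le> (v + \<kappa>2 * real j)\<^sup>2" for j
      using g_le[OF l, of j] g_nonneg[of l j] by (intro power_mono) (auto simp: v_def c_def)
    have i': "integrable (pois l) (\<lambda>j. (g l j)\<^sup>2)"
      by (rule Bochner_Integration.integrable_bound[OF i]) (use le in auto)
    have "(\<integral>j. (g l j)\<^sup>2 \<partial>pois l) \<le> (\<integral>j. (v + \<kappa>2 * real j)\<^sup>2 \<partial>pois l)"
      by (intro integral_mono i i' le)
    also have "\<dots> = v\<^sup>2 + (2 * v * \<kappa>2) * l + \<kappa>2\<^sup>2 * (l\<^sup>2 + l)"
      unfolding s using int by (simp add: integral_pois_moments[OF l])
    \<comment> \<open>The Poisson variance contributes only \<kappa>2^2 * l, hence the leading
      coefficient is the square of \<kappa>1 + \<kappa>2 and is below 1.\<close>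
    also have "\<dots> = \<kappa>\<^sup>2 * l\<^sup>2 + d * l + c\<^sup>2"
      by (simp add: v_def \<kappa>_def d_def power2_eq_square algebra_simps)
    also have "d * l \<le> (e / 2) * l\<^sup>2 + d\<^sup>2 / (2 * e)"
    proof -
      have "0 \<le> (e * l - d)\<^sup>2 / (2 * e)" using e by simp
      also have "\<dots> = (e / 2) * l\<^sup>2 + d\<^sup>2 / (2 * e) - d * l"
        using e by (simp add: power2_eq_square field_simps)
      finally show ?thesis by simp
    qed
    finally have "(\<integral>j. (g l j)\<^sup>2 \<partial>pois l) \<le> \<kappa>\<^sup>2 * l\<^sup>2 + ((e / 2) * l\<^sup>2 + d\<^sup>2 / (2 * e)) + c\<^sup>2"
      by simp
    also have "\<dots> = (1 - e / 2) * l\<^sup>2 + b"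
    proof -
      have "\<kappa>\<^sup>2 * l\<^sup>2 = l\<^sup>2 - e * l\<^sup>2" by (simp add: e_def algebra_simps)
      then show ?thesis by (simp add: b_def left_diff_distrib)
    qed
    finally show ?thesis using i' by simp
  qed
  show thesis
  proof (rule that[of "1 - e / 2" b])
    have "e \<le> 1" by (simp add: e_def)
    then show "0 \<le> 1 - e / 2" by simp
  qed (use e bound in \<open>auto simp: b_def\<close>)
qed

lemma integrable_L_sq: "integrable M (\<lambda>\<omega>. (L k \<omega>)\<^sup>2)"
proof -
  obtain \<rho> b where \<rho>: "\<rho> < 1" "0 \<le> \<rho>" and b: "0 \<le> b"
    and dr: "\<And>l. 0 \<le> l \<Longrightarrow> (\<integral>j. (g l j)\<^sup>2 \<partial>pois l) \<le> \<rho> * l\<^sup>2 + b"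
    and di: "\<And>l. 0 \<le> l \<Longrightarrow> integrable (pois l) (\<lambda>j. (g l j)\<^sup>2)"
    by (rule drift) blast
  \<comment> \<open>Truncation by an indicator rather than by a minimum: the pointwise comparison
    below then also holds above the level.\<close>
  define S where "S n \<omega> = (L 0 \<omega>)\<^sup>2 * indicator {\<omega>. (L 0 \<omega>)\<^sup>2 < real n} \<omega>" for n \<omega>
  have S_le: "(1 - \<rho>) * (\<integral>\<omega>. S n \<omega> \<partial>M) \<le> b" and S_int: "integrable M (S n)" for n
  proof -
    let ?K = "real n"
    define m where "m l = min (l\<^sup>2) ?K" for l :: real
    have m_meas [measurable]: "m \<in> borel_measurable borel" unfolding m_def by measurable
    have m_bd: "\<bar>m x\<bar> \<le> ?K" for x by (auto simp: m_def)
    have i1: "integrable M (\<lambda>\<omega>. m (L 0 \<omega>))"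
      using m_bd by (intro integrable_const_bound[where B="?K"]) auto
    have i2: "integrable M (\<lambda>\<omega>. min (\<rho> * (L 0 \<omega>)\<^sup>2 + b) ?K)"
      using \<rho> b by (intro integrable_const_bound[where B="?K"]) (auto simp: abs_le_iff min_def intro: order_trans)
    show i3: "integrable M (S n)"
      unfolding S_def by (intro integrable_const_bound[where B="?K"]) (auto simp: indicator_def)
    have km: "(\<lambda>\<omega>. \<integral>j. m (g (L 0 \<omega>) j) \<partial>pois (L 0 \<omega>)) \<in> borel_measurable M"
      by (intro measurable_F_M[OF kernel_integral_measurable] measurable_compose[OF L_meas_F]) measurable
    have le: "(\<integral>j. m (g (L 0 \<omega>) j) \<partial>pois (L 0 \<omega>)) \<le> min (\<rho> * (L 0 \<omega>)\<^sup>2 + b) ?K" if "\<omega> \<in> space M" for \<omega>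
    proof -
      note l = L_nonneg[OF that, of 0]
      have i: "integrable (pois (L 0 \<omega>)) (\<lambda>j. m (g (L 0 \<omega>) j))"
        using m_bd by (intro measure_pmf.integrable_const_bound[where B="?K"]) auto
      have "(\<integral>j. m (g (L 0 \<omega>) j) \<partial>pois (L 0 \<omega>)) \<le> (\<integral>j. (g (L 0 \<omega>) j)\<^sup>2 \<partial>pois (L 0 \<omega>))"
        using i di[OF l] by (intro integral_mono) (auto simp: m_def)
      moreover have "(\<integral>j. m (g (L 0 \<omega>) j) \<partial>pois (L 0 \<omega>)) \<le> (\<integral>j. ?K \<partial>pois (L 0 \<omega>))"
        using i by (intro integral_mono) (auto simp: m_def)
      ultimately show ?thesis using dr[OF l] by simp
    qed
    have i4: "integrable M (\<lambda>\<omega>. \<integral>j. m (g (L 0 \<omega>) j) \<partial>pois (L 0 \<omega>))"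
    proof (intro integrable_const_bound[where B="?K"])
      show "AE \<omega> in M. norm (\<integral>j. m (g (L 0 \<omega>) j) \<partial>pois (L 0 \<omega>)) \<le> ?K"
      proof (rule AE_I2)
        fix \<omega> assume "\<omega> \<in> space M"
        moreover have "0 \<le> (\<integral>j. m (g (L 0 \<omega>) j) \<partial>pois (L 0 \<omega>))"
          by (intro Bochner_Integration.integral_nonneg) (auto simp: m_def)
        ultimately show "norm (\<integral>j. m (g (L 0 \<omega>) j) \<partial>pois (L 0 \<omega>)) \<le> ?K"
          using le by auto
      qed
    qed (rule km)
    \<comment> \<open>Stationarity identifies the truncated second moments at times 0 and 1, so the
      one-step bound compares a quantity with itself.\<close>
    have "(\<integral>\<omega>. m (L 0 \<omega>) \<partial>M) = (\<integral>\<omega>. 1 * m (L (Suc 0) \<omega>) \<partial>M)"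
      using expectation_L_stat[OF m_meas, of 1] by simp
    also have "\<dots> = (\<integral>\<omega>. 1 * (\<integral>j. m (g (L 0 \<omega>) j) \<partial>pois (L 0 \<omega>)) \<partial>M)"
      by (rule expectation_step[OF m_meas m_bd, where d=1]) auto
    also have "\<dots> \<le> (\<integral>\<omega>. min (\<rho> * (L 0 \<omega>)\<^sup>2 + b) ?K \<partial>M)"
      using le i4 i2 by (intro integral_mono_AE) auto
    finally have A: "(\<integral>\<omega>. m (L 0 \<omega>) - min (\<rho> * (L 0 \<omega>)\<^sup>2 + b) ?K \<partial>M) \<le> 0"
      using i1 i2 by simp
    \<comment> \<open>Below the level the difference is at least (1 - \<rho>) * l^2 - b; above it
      the first minimum equals the level, so the difference is nonnegative while \<open>S n\<close>
      vanishes.\<close>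
    have "(\<integral>\<omega>. (1 - \<rho>) * S n \<omega> - b \<partial>M) \<le> (\<integral>\<omega>. m (L 0 \<omega>) - min (\<rho> * (L 0 \<omega>)\<^sup>2 + b) ?K \<partial>M)"
    proof (intro integral_mono)
      fix \<omega>
      show "(1 - \<rho>) * S n \<omega> - b \<le> m (L 0 \<omega>) - min (\<rho> * (L 0 \<omega>)\<^sup>2 + b) ?K"
        using b by (auto simp: S_def m_def indicator_def algebra_simps min_def)
    qed (use i1 i2 i3 in auto)
    with A show "(1 - \<rho>) * (\<integral>\<omega>. S n \<omega> \<partial>M) \<le> b"
      using i3 by (simp add: prob_space)
  qed
  have "(\<integral>\<^sup>+\<omega>. ennreal ((L 0 \<omega>)\<^sup>2) \<partial>M) = (\<integral>\<^sup>+\<omega>. (SUP n. ennreal (S n \<omega>)) \<partial>M)"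
  proof (intro nn_integral_cong)
    fix \<omega>
    obtain n where n: "(L 0 \<omega>)\<^sup>2 < real n" using reals_Archimedean2 by blast
    show "ennreal ((L 0 \<omega>)\<^sup>2) = (SUP n. ennreal (S n \<omega>))"
    proof (rule antisym)
      show "ennreal ((L 0 \<omega>)\<^sup>2) \<le> (SUP n. ennreal (S n \<omega>))"
        using n by (intro SUP_upper2[of n]) (auto simp: S_def)
      show "(SUP n. ennreal (S n \<omega>)) \<le> ennreal ((L 0 \<omega>)\<^sup>2)"
        by (intro SUP_least ennreal_leI) (auto simp: S_def indicator_def)
    qed
  qed
  also have "\<dots> = (SUP n. \<integral>\<^sup>+\<omega>. ennreal (S n \<omega>) \<partial>M)"
  proof (rule nn_integral_monotone_convergence_SUP)
    show "incseq (\<lambda>n \<omega>. ennreal (S n \<omega>))"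
      by (auto simp: incseq_def le_fun_def S_def indicator_def intro!: ennreal_leI)
  qed (use borel_measurable_integrable[OF S_int] in measurable)
  also have "\<dots> \<le> ennreal (b / (1 - \<rho>))"
  proof (rule SUP_least)
    fix n
    have "(\<integral>\<^sup>+\<omega>. ennreal (S n \<omega>) \<partial>M) = ennreal (\<integral>\<omega>. S n \<omega> \<partial>M)"
      by (intro nn_integral_eq_integral S_int AE_I2) (simp add: S_def)
    also have "\<dots> \<le> ennreal (b / (1 - \<rho>))"
      using S_le[of n] \<rho> by (intro ennreal_leI) (simp add: pos_le_divide_eq mult.commute)
    finally show "(\<integral>\<^sup>+\<omega>. ennreal (S n \<omega>) \<partial>M) \<le> ennreal (b / (1 - \<rho>))" .
  qed
  finally have fin: "(\<integral>\<^sup>+\<omega>. ennreal ((L 0 \<omega>)\<^sup>2) \<partial>M) \<le> ennreal (b / (1 - \<rho>))" .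
  have "integrable M (\<lambda>\<omega>. (L 0 \<omega>)\<^sup>2)"
  proof (rule integrableI_bounded)
    show "(\<integral>\<^sup>+\<omega>. ennreal (norm ((L 0 \<omega>)\<^sup>2)) \<partial>M) < \<infinity>"
      using le_less_trans[OF fin ennreal_less_top] by simp
  qed measurable
  moreover have "integrable M (\<lambda>\<omega>. (L k \<omega>)\<^sup>2) \<longleftrightarrow> integrable M (\<lambda>\<omega>. (L 0 \<omega>)\<^sup>2)"
    by (rule integrable_L_stat) measurable
  ultimately show ?thesis by blast
qed

lemma integrable_L: "integrable M (L k)"
  by (rule square_integrable_imp_integrable[OF L_measurable integrable_L_sq])

lemma Y_second_moment:
  shows integrable_Y_sq: "integrable M (\<lambda>\<omega>. (real (Y k \<omega>))\<^sup>2)"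
    and integrable_Y: "integrable M (\<lambda>\<omega>. real (Y k \<omega>))"
proof -
  have "integrable M (\<lambda>\<omega>. \<integral>j. \<bar>(real j)\<^sup>2\<bar> \<partial>pois (L k \<omega>)) \<longleftrightarrow> integrable M (\<lambda>\<omega>. (L k \<omega>)\<^sup>2 + L k \<omega>)"
    by (intro Bochner_Integration.integrable_cong refl) (simp add: integral_pois_moments L_nonneg)
  then show sq: "integrable M (\<lambda>\<omega>. (real (Y k \<omega>))\<^sup>2)"
    using integrable_L_sq integrable_L integrable_pois_power L_nonneg
    by (intro kernel_integrable[of "\<lambda>j \<omega>. (real j)\<^sup>2"]) auto
  show "integrable M (\<lambda>\<omega>. real (Y k \<omega>))"
    by (rule square_integrable_imp_integrable[OF _ sq]) measurable
qed

end

text \<open>Both constants are kept explicit: a transition preserves the bound c and shrinks the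
  Lipschitz constant K.\<close>

definition lipb :: "real \<Rightarrow> real \<Rightarrow> (real \<Rightarrow> real) \<Rightarrow> bool" where
  "lipb c K \<phi> \<longleftrightarrow> (\<forall>l. \<bar>\<phi> l\<bar> \<le> c) \<and> (\<forall>l l'. \<bar>\<phi> l - \<phi> l'\<bar> \<le> K * \<bar>l - l'\<bar>)"

lemma lipbD: "lipb c K \<phi> \<Longrightarrow> \<bar>\<phi> l\<bar> \<le> c" "lipb c K \<phi> \<Longrightarrow> \<bar>\<phi> l - \<phi> l'\<bar> \<le> K * \<bar>l - l'\<bar>"
  by (auto simp: lipb_def)

lemma lipb_nonneg:
  assumes "lipb c K \<phi>" shows "0 \<le> c" "0 \<le> K"
  using lipbD(1)[OF assms, of 0] lipbD(2)[OF assms, of 1 0] by auto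

lemma lipb_measurable:
  assumes "lipb c K \<phi>" shows "\<phi> \<in> borel_measurable borel"
proof (rule borel_measurable_continuous_onI)
  have "K-lipschitz_on UNIV \<phi>"
    using lipbD(2)[OF assms] lipb_nonneg[OF assms] by (intro lipschitz_onI) (auto simp: dist_real_def)
  then show "continuous_on UNIV \<phi>" by (rule lipschitz_on_continuous_on)
qed

context poisson_chain
begin

subsection \<open>Law of large numbers\<close>

text \<open>One step of the intensity chain. Cutting negative arguments off at 0 extends it to all
  reals, so that it maps the class \<open>lipb\<close> to itself and can be iterated.\<close>

definition trans_op :: "(real \<Rightarrow> real) \<Rightarrow> real \<Rightarrow> real" where
  "trans_op \<phi> l = (\<integral>j. \<phi> (g (max 0 l) j) \<partial>pois (max 0 l))"

abbreviation \<kappa> :: real where "\<kappa> \<equiv> \<kappa>1 + \<kappa>2"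

text \<open>Moving the argument of \<open>g\<close> under a fixed Poisson law costs K * \<kappa>1.
  Moving the rate costs K * \<kappa>2, because \<phi> (g b j) has increments of at most K *
  \<kappa>2 in j and \<open>integral_pois_lipschitz\<close> turns them into a slope in the
  rate.\<close>

lemma lipb_trans_op:
  assumes \<phi>: "lipb c K \<phi>"
  shows "lipb c (K * \<kappa>) (trans_op \<phi>)"
  unfolding lipb_def
proof (intro conjI allI)
  note nn = lipb_nonneg[OF \<phi>]
  have int: "integrable (pois a) (\<lambda>j. \<phi> (g b j))" for a b
    using lipbD(1)[OF \<phi>] by (intro measure_pmf.integrable_const_bound[where B=c]) auto
  fix l :: real
  have "\<bar>trans_op \<phi> l\<bar> \<le> (\<integral>j. \<bar>\<phi> (g (max 0 l) j)\<bar> \<partial>pois (max 0 l))"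
    unfolding trans_op_def by (rule integral_abs_bound)
  also have "\<dots> \<le> (\<integral>j. c \<partial>pois (max 0 l))"
    using int lipbD(1)[OF \<phi>] by (intro integral_mono) auto
  finally show "\<bar>trans_op \<phi> l\<bar> \<le> c" by simp
  fix l' :: real
  define a b where "a = max 0 l" and "b = max 0 l'"
  have ab: "0 \<le> a" "0 \<le> b" "\<bar>a - b\<bar> \<le> \<bar>l - l'\<bar>" by (auto simp: a_def b_def)
  have "\<bar>(\<integral>j. \<phi> (g a j) \<partial>pois a) - (\<integral>j. \<phi> (g b j) \<partial>pois a)\<bar> \<le> K * (\<kappa>1 * \<bar>a - b\<bar>)"
  proof -
    have "\<bar>(\<integral>j. \<phi> (g a j) - \<phi> (g b j) \<partial>pois a)\<bar> \<le> (\<integral>j. \<bar>\<phi> (g a j) - \<phi> (g b j)\<bar> \<partial>pois a)"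
      by (rule integral_abs_bound)
    also have "\<dots> \<le> (\<integral>j. K * (\<kappa>1 * \<bar>a - b\<bar>) \<partial>pois a)"
      using int order_trans[OF lipbD(2)[OF \<phi>] mult_left_mono[OF g_lipschitz nn(2)]]
      by (intro integral_mono) auto
    finally show ?thesis using int by simp
  qed
  moreover have "\<bar>(\<integral>j. \<phi> (g b j) \<partial>pois a) - (\<integral>j. \<phi> (g b j) \<partial>pois b)\<bar> \<le> (K * \<kappa>2) * \<bar>a - b\<bar>"
  proof (rule integral_pois_lipschitz[OF ab(1,2)])
    fix j
    have "\<bar>\<phi> (g b (Suc j)) - \<phi> (g b j)\<bar> \<le> K * \<bar>g b (Suc j) - g b j\<bar>" by (rule lipbD(2)[OF \<phi>])
    also have "\<bar>g b (Suc j) - g b j\<bar> \<le> \<kappa>2" using g_contr[of b "Suc j" b j] by simp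
    finally show "\<bar>\<phi> (g b (Suc j)) - \<phi> (g b j)\<bar> \<le> K * \<kappa>2" using nn by (simp add: mult_left_mono)
  qed
  ultimately have "\<bar>trans_op \<phi> l - trans_op \<phi> l'\<bar> \<le> K * (\<kappa>1 * \<bar>a - b\<bar>) + (K * \<kappa>2) * \<bar>a - b\<bar>"
    unfolding trans_op_def a_def[symmetric] b_def[symmetric] by linarith
  also have "\<dots> = (K * \<kappa>) * \<bar>a - b\<bar>" by (simp add: algebra_simps)
  also have "\<dots> \<le> (K * \<kappa>) * \<bar>l - l'\<bar>"
    using nn kappa_nonneg ab by (intro mult_left_mono) auto
  finally show "\<bar>trans_op \<phi> l - trans_op \<phi> l'\<bar> \<le> (K * \<kappa>) * \<bar>l - l'\<bar>" .
qed

lemma lipb_trans_op_pow: "lipb c K \<phi> \<Longrightarrow> lipb c (K * \<kappa> ^ m) ((trans_op ^^ m) \<phi>)"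
proof (induction m)
  case (Suc m)
  from lipb_trans_op[OF Suc.IH[OF Suc.prems]] show ?case by (simp add: mult_ac)
qed simp

text \<open>The last transition is averaged out first. The induction therefore varies \<phi> while Z
  stays a function of the past at time k.\<close>

lemma expectation_steps:
  assumes \<phi>: "lipb c K \<phi>"
    and Z: "Z \<in> borel_measurable (F k)" "\<And>\<omega>. \<omega> \<in> space M \<Longrightarrow> \<bar>Z \<omega>\<bar> \<le> d"
  shows "(\<integral>\<omega>. Z \<omega> * \<phi> (L (k + m) \<omega>) \<partial>M) = (\<integral>\<omega>. Z \<omega> * (trans_op ^^ m) \<phi> (L k \<omega>) \<partial>M)"
  using \<phi>
proof (induction m arbitrary: \<phi> K)
  case (Suc m)
  have "(\<integral>\<omega>. Z \<omega> * \<phi> (L (k + Suc m) \<omega>) \<partial>M)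
      = (\<integral>\<omega>. Z \<omega> * (\<integral>j. \<phi> (g (L (k + m) \<omega>) j) \<partial>pois (L (k + m) \<omega>)) \<partial>M)"
    using expectation_step[OF lipb_measurable[OF Suc.prems] lipbD(1)[OF Suc.prems]
        measurable_F_mono[OF _ Z(1), of "k + m"] Z(2)] by simp
  also have "\<dots> = (\<integral>\<omega>. Z \<omega> * trans_op \<phi> (L (k + m) \<omega>) \<partial>M)"
    by (intro Bochner_Integration.integral_cong refl) (simp add: trans_op_def L_nonneg max_absorb2)
  also have "\<dots> = (\<integral>\<omega>. Z \<omega> * (trans_op ^^ m) (trans_op \<phi>) (L k \<omega>) \<partial>M)"
    by (rule Suc.IH[OF lipb_trans_op[OF Suc.prems]])
  finally show ?case by (simp add: funpow_swap1)
qed simp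

text \<open>After m steps the conditional mean of \<phi> has Lipschitz constant K * \<kappa> ^ m, so
  it is almost constant. Covariances thus decay geometrically, and the variance of a sum grows at
  most linearly.\<close>

lemma lln_L2:
  assumes \<phi>: "lipb c K \<phi>"
  defines "\<mu> \<equiv> (\<integral>\<omega>. \<phi> (L 0 \<omega>) \<partial>M)"
  shows "\<exists>D\<ge>0. \<forall>n. (\<integral>\<omega>. (\<Sum>k<n. \<phi> (L k \<omega>) - \<mu>)\<^sup>2 \<partial>M) \<le> D * real n"
proof -
  note nn = lipb_nonneg[OF \<phi>] and [measurable] = lipb_measurable[OF \<phi>]
  define EL where "EL = (\<integral>\<omega>. L 0 \<omega> \<partial>M)"
  have EL0: "0 \<le> EL" unfolding EL_def by (intro integral_nonneg_AE AE_I2 L_nonneg)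
  have EL: "(\<integral>\<omega>. L k \<omega> \<partial>M) = EL" for k
    unfolding EL_def using expectation_L_stat[of "\<lambda>l. l" k] by simp
  have \<mu>: "(\<integral>\<omega>. \<phi> (L k \<omega>) \<partial>M) = \<mu>" for k
    unfolding \<mu>_def by (rule expectation_L_stat) measurable
  have \<phi>_int: "integrable M (\<lambda>\<omega>. \<phi> (L k \<omega>))" for k
    using lipbD(1)[OF \<phi>] by (intro integrable_const_bound[where B=c]) auto
  have \<mu>_le: "\<bar>\<mu>\<bar> \<le> c"
  proof -
    have "\<bar>\<mu>\<bar> \<le> (\<integral>\<omega>. \<bar>\<phi> (L 0 \<omega>)\<bar> \<partial>M)" unfolding \<mu>_def by (rule integral_abs_bound)
    also have "\<dots> \<le> (\<integral>\<omega>. c \<partial>M)" using lipbD(1)[OF \<phi>] \<phi>_int by (intro integral_mono) auto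
    finally show ?thesis by (simp add: prob_space)
  qed
  define \<psi> where "\<psi> k \<omega> = \<phi> (L k \<omega>) - \<mu>" for k \<omega>
  have \<psi>_meas [measurable]: "\<psi> k \<in> borel_measurable M" for k unfolding \<psi>_def by measurable
  have \<psi>_F: "\<psi> k \<in> borel_measurable (F k)" for k
    unfolding \<psi>_def by (intro borel_measurable_diff measurable_compose[OF L_meas_F]) auto
  have \<psi>_le: "\<bar>\<psi> k \<omega>\<bar> \<le> 2 * c" for k \<omega>
    unfolding \<psi>_def using lipbD(1)[OF \<phi>, of "L k \<omega>"] \<mu>_le by linarith
  have \<psi>_prod: "\<bar>\<psi> k \<omega> * \<psi> m \<omega>\<bar> \<le> (2 * c) * (2 * c)" for k m \<omega>
    unfolding abs_mult by (intro mult_mono \<psi>_le) (use nn in auto)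
  have \<psi>\<psi>_int: "integrable M (\<lambda>\<omega>. \<psi> k \<omega> * \<psi> m \<omega>)" for k m
    using \<psi>_prod by (intro integrable_const_bound[where B="(2 * c) * (2 * c)"]) auto
  \<comment> \<open>The iterate has mean \<mu> under the stationary law, so its distance from \<mu>
    at l is at most K * \<kappa> ^ m times the mean of \<bar>l - L 0\<bar>.\<close>
  have close: "\<bar>(trans_op ^^ m) \<phi> l - \<mu>\<bar> \<le> K * \<kappa> ^ m * (l + EL)" if "0 \<le> l" for m l
  proof -
    note T = lipb_trans_op_pow[OF \<phi>, of m]
    have [measurable]: "(trans_op ^^ m) \<phi> \<in> borel_measurable borel" by (rule lipb_measurable[OF T])
    have i: "integrable M (\<lambda>\<omega>. (trans_op ^^ m) \<phi> (L 0 \<omega>))"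
      using lipbD(1)[OF T] by (intro integrable_const_bound[where B=c]) auto
    have "\<mu> = (\<integral>\<omega>. 1 * \<phi> (L (0 + m) \<omega>) \<partial>M)" using \<mu> by simp
    also have "\<dots> = (\<integral>\<omega>. 1 * (trans_op ^^ m) \<phi> (L 0 \<omega>) \<partial>M)"
      by (rule expectation_steps[OF \<phi>, where d=1]) auto
    finally have eq: "(trans_op ^^ m) \<phi> l - \<mu> = (\<integral>\<omega>. (trans_op ^^ m) \<phi> l - (trans_op ^^ m) \<phi> (L 0 \<omega>) \<partial>M)"
      using i by (simp add: prob_space)
    have "\<bar>(trans_op ^^ m) \<phi> l - \<mu>\<bar> \<le> (\<integral>\<omega>. \<bar>(trans_op ^^ m) \<phi> l - (trans_op ^^ m) \<phi> (L 0 \<omega>)\<bar> \<partial>M)"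
      unfolding eq by (rule integral_abs_bound)
    also have "\<dots> \<le> (\<integral>\<omega>. K * \<kappa> ^ m * (l + L 0 \<omega>) \<partial>M)"
    proof (rule integral_mono)
      fix \<omega> assume "\<omega> \<in> space M"
      have "\<bar>(trans_op ^^ m) \<phi> l - (trans_op ^^ m) \<phi> (L 0 \<omega>)\<bar> \<le> K * \<kappa> ^ m * \<bar>l - L 0 \<omega>\<bar>"
        by (rule lipbD(2)[OF T])
      also have "\<dots> \<le> K * \<kappa> ^ m * (l + L 0 \<omega>)"
        using nn kappa_nonneg that L_nonneg[OF \<open>\<omega> \<in> space M\<close>, of 0] by (intro mult_left_mono) auto
      finally show "\<bar>(trans_op ^^ m) \<phi> l - (trans_op ^^ m) \<phi> (L 0 \<omega>)\<bar> \<le> K * \<kappa> ^ m * (l + L 0 \<omega>)" .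
    qed (use i integrable_L in auto)
    also have "\<dots> = K * \<kappa> ^ m * (l + EL)"
      using integrable_L[of 0] by (simp add: EL_def prob_space)
    finally show ?thesis .
  qed
  \<comment> \<open>The factor 2 * c bounds the centred variable, and K * (L k + EL) integrates to 2
    * K * EL.\<close>
  define A where "A = 4 * c * K * EL"
  have A0: "0 \<le> A" unfolding A_def using nn EL0 by simp
  have cov: "(\<integral>\<omega>. \<psi> k \<omega> * \<psi> (k + m) \<omega> \<partial>M) \<le> A * \<kappa> ^ m" for k m
  proof -
    note T = lipb_trans_op_pow[OF \<phi>, of m]
    have [measurable]: "(trans_op ^^ m) \<phi> \<in> borel_measurable borel" by (rule lipb_measurable[OF T])
    have bdd: "\<bar>\<psi> k \<omega> * h\<bar> \<le> (2 * c) * c" if "\<bar>h\<bar> \<le> c" for h \<omega>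
      unfolding abs_mult using that nn by (intro mult_mono \<psi>_le) auto
    have i1: "integrable M (\<lambda>\<omega>. \<psi> k \<omega> * \<phi> (L (k + m) \<omega>))"
      using bdd lipbD(1)[OF \<phi>] by (intro integrable_const_bound[where B="(2 * c) * c"]) auto
    have i2: "integrable M (\<lambda>\<omega>. \<psi> k \<omega> * (trans_op ^^ m) \<phi> (L k \<omega>))"
      using bdd lipbD(1)[OF T] by (intro integrable_const_bound[where B="(2 * c) * c"]) auto
    have i3: "integrable M (\<lambda>\<omega>. \<psi> k \<omega> * \<mu>)"
      using bdd \<mu>_le by (intro integrable_const_bound[where B="(2 * c) * c"]) auto
    have "(\<integral>\<omega>. \<psi> k \<omega> * \<psi> (k + m) \<omega> \<partial>M) = (\<integral>\<omega>. \<psi> k \<omega> * \<phi> (L (k + m) \<omega>) \<partial>M) - (\<integral>\<omega>. \<psi> k \<omega> * \<mu> \<partial>M)"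
      unfolding Bochner_Integration.integral_diff[OF i1 i3, symmetric]
      by (intro Bochner_Integration.integral_cong refl) (simp add: \<psi>_def[of "k + m"] algebra_simps)
    also have "\<dots> = (\<integral>\<omega>. \<psi> k \<omega> * (trans_op ^^ m) \<phi> (L k \<omega>) \<partial>M) - (\<integral>\<omega>. \<psi> k \<omega> * \<mu> \<partial>M)"
      using expectation_steps[OF \<phi> \<psi>_F \<psi>_le, of k m] by simp
    also have "\<dots> = (\<integral>\<omega>. \<psi> k \<omega> * ((trans_op ^^ m) \<phi> (L k \<omega>) - \<mu>) \<partial>M)"
      unfolding Bochner_Integration.integral_diff[OF i2 i3, symmetric]
      by (intro Bochner_Integration.integral_cong refl) (simp add: algebra_simps)
    also have "\<dots> \<le> (\<integral>\<omega>. (2 * c) * (K * \<kappa> ^ m * (L k \<omega> + EL)) \<partial>M)"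
    proof (rule integral_mono)
      fix \<omega> assume "\<omega> \<in> space M"
      have "\<psi> k \<omega> * ((trans_op ^^ m) \<phi> (L k \<omega>) - \<mu>) \<le> \<bar>\<psi> k \<omega>\<bar> * \<bar>(trans_op ^^ m) \<phi> (L k \<omega>) - \<mu>\<bar>"
        by (metis abs_ge_self abs_mult)
      also have "\<dots> \<le> (2 * c) * (K * \<kappa> ^ m * (L k \<omega> + EL))"
        using nn by (intro mult_mono \<psi>_le close L_nonneg \<open>\<omega> \<in> space M\<close>) auto
      finally show "\<psi> k \<omega> * ((trans_op ^^ m) \<phi> (L k \<omega>) - \<mu>) \<le> (2 * c) * (K * \<kappa> ^ m * (L k \<omega> + EL))" .
    next
      show "integrable M (\<lambda>\<omega>. \<psi> k \<omega> * ((trans_op ^^ m) \<phi> (L k \<omega>) - \<mu>))"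
        using Bochner_Integration.integrable_diff[OF i2 i3] by (simp add: algebra_simps)
    qed (use integrable_L in auto)
    also have "\<dots> = A * \<kappa> ^ m"
      using integrable_L[of k] EL[of k] by (simp add: prob_space A_def algebra_simps)
    finally show ?thesis .
  qed
  have \<kappa>01: "0 \<le> \<kappa>" "\<kappa> < 1" using kappa_nonneg kappa_sum by auto
  \<comment> \<open>One more summand adds its own square, at most (2 * c)^2, and twice its
    covariances with all earlier ones, a geometric series.\<close>
  define D where "D = 4 * c\<^sup>2 + 2 * (A / (1 - \<kappa>))"
  define S where "S n \<omega> = (\<Sum>k<n. \<psi> k \<omega>)" for n \<omega>
  have S_sq: "(\<integral>\<omega>. (S n \<omega>)\<^sup>2 \<partial>M) \<le> D * real n \<and> integrable M (\<lambda>\<omega>. (S n \<omega>)\<^sup>2)" for n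
  proof (induction n)
    case 0
    then show ?case by (simp add: S_def)
  next
    case (Suc n)
    have i: "integrable M (\<lambda>\<omega>. S n \<omega> * \<psi> n \<omega>)"
      unfolding S_def sum_distrib_right by (intro Bochner_Integration.integrable_sum \<psi>\<psi>_int)
    have "(\<integral>\<omega>. S n \<omega> * \<psi> n \<omega> \<partial>M) = (\<Sum>k<n. \<integral>\<omega>. \<psi> k \<omega> * \<psi> n \<omega> \<partial>M)"
      unfolding S_def sum_distrib_right by (intro Bochner_Integration.integral_sum \<psi>\<psi>_int)
    also have "\<dots> \<le> (\<Sum>k<n. A * \<kappa> ^ (n - k))"
      using cov[of _ "n - _"] by (intro sum_mono) (metis add_diff_inverse_nat lessThan_iff less_imp_le not_less)
    \<comment> \<open>Lowering the exponent by one makes the sum a geometric series from exponent 0,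
      read backwards.\<close>
    also have "\<dots> \<le> (\<Sum>k<n. A * \<kappa> ^ (n - Suc k))"
      using \<kappa>01 A0 by (intro sum_mono mult_left_mono power_decreasing) auto
    also have "\<dots> = A * (\<Sum>k<n. \<kappa> ^ k)"
      unfolding sum_distrib_left[symmetric] using sum.nat_diff_reindex[of "\<lambda>k. \<kappa> ^ k" n] by simp
    also have "(\<Sum>k<n. \<kappa> ^ k) \<le> 1 / (1 - \<kappa>)"
      using \<kappa>01 sum_gp_strict[of \<kappa> n] by (simp add: divide_right_mono)
    finally have 1: "(\<integral>\<omega>. S n \<omega> * \<psi> n \<omega> \<partial>M) \<le> A / (1 - \<kappa>)"
      using A0 by (simp add: mult_left_mono)
    have "(\<integral>\<omega>. \<psi> n \<omega> * \<psi> n \<omega> \<partial>M) \<le> (\<integral>\<omega>. (2 * c) * (2 * c) \<partial>M)"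
      using \<psi>\<psi>_int abs_le_D1[OF \<psi>_prod] by (intro integral_mono) auto
    then have 2: "(\<integral>\<omega>. \<psi> n \<omega> * \<psi> n \<omega> \<partial>M) \<le> 4 * c\<^sup>2"
      by (simp add: prob_space power2_eq_square)
    have s: "(S (Suc n) \<omega>)\<^sup>2 = (S n \<omega>)\<^sup>2 + 2 * (S n \<omega> * \<psi> n \<omega>) + \<psi> n \<omega> * \<psi> n \<omega>" for \<omega>
      by (simp add: S_def power2_eq_square algebra_simps)
    have "(\<integral>\<omega>. (S (Suc n) \<omega>)\<^sup>2 \<partial>M)
        = (\<integral>\<omega>. (S n \<omega>)\<^sup>2 \<partial>M) + 2 * (\<integral>\<omega>. S n \<omega> * \<psi> n \<omega> \<partial>M) + (\<integral>\<omega>. \<psi> n \<omega> * \<psi> n \<omega> \<partial>M)"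
      unfolding s using Suc.IH i \<psi>\<psi>_int by simp
    also have "\<dots> \<le> D * real n + 2 * (A / (1 - \<kappa>)) + 4 * c\<^sup>2"
      using Suc.IH 1 2 by linarith
    also have "\<dots> = D * real (Suc n)" by (simp add: D_def algebra_simps add_divide_distrib)
    finally show ?case unfolding s using Suc.IH i \<psi>\<psi>_int by auto
  qed
  moreover have "0 \<le> D" using A0 \<kappa>01 by (simp add: D_def)
  ultimately show ?thesis unfolding S_def \<psi>_def by blast
qed

text \<open>Convergence in mean is what the compensation argument consumes: there the average of
  conditional variances is multiplied by a bounded factor and integrated.\<close>

lemma lln:
  assumes \<phi>: "lipb c K \<phi>"
  shows "(\<lambda>n. \<integral>\<omega>. \<bar>(\<Sum>k<n. \<phi> (L k \<omega>)) / real n - (\<integral>\<omega>. \<phi> (L 0 \<omega>) \<partial>M)\<bar> \<partial>M) \<longlonglongrightarrow> 0"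
proof -
  define \<mu> where "\<mu> = (\<integral>\<omega>. \<phi> (L 0 \<omega>) \<partial>M)"
  note [measurable] = lipb_measurable[OF \<phi>]
  obtain D where D0: "0 \<le> D" and D: "\<And>n. (\<integral>\<omega>. (\<Sum>k<n. \<phi> (L k \<omega>) - \<mu>)\<^sup>2 \<partial>M) \<le> D * real n"
    using lln_L2[OF \<phi>] unfolding \<mu>_def by blast
  have bound: "(\<integral>\<omega>. \<bar>(\<Sum>k<n. \<phi> (L k \<omega>)) / real n - \<mu>\<bar> \<partial>M) \<le> sqrt D * (1 / sqrt (real n))" if n: "0 < n" for n
  proof -
    define X where "X \<omega> = \<bar>(\<Sum>k<n. \<phi> (L k \<omega>)) / real n - \<mu>\<bar>" for \<omega>
    have [measurable]: "X \<in> borel_measurable M" unfolding X_def by measurable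
    have X_le: "\<bar>X \<omega>\<bar> \<le> c + \<bar>\<mu>\<bar>" for \<omega>
    proof -
      have "\<bar>\<Sum>k<n. \<phi> (L k \<omega>)\<bar> \<le> (\<Sum>k<n. c)"
        by (rule order_trans[OF sum_abs sum_mono]) (rule lipbD(1)[OF \<phi>])
      then have "\<bar>(\<Sum>k<n. \<phi> (L k \<omega>)) / real n\<bar> \<le> c"
        using n by (simp add: abs_mult field_simps)
      then show ?thesis unfolding X_def by linarith
    qed
    have X_int: "integrable M X" using X_le by (intro integrable_const_bound[where B="c + \<bar>\<mu>\<bar>"]) auto
    have "\<bar>(X \<omega>)\<^sup>2\<bar> \<le> (c + \<bar>\<mu>\<bar>)\<^sup>2" for \<omega>
      using power_mono[OF X_le[of \<omega>], of 2] by simp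
    then have X2_int: "integrable M (\<lambda>\<omega>. (X \<omega>)\<^sup>2)"
      by (intro integrable_const_bound[where B="(c + \<bar>\<mu>\<bar>)\<^sup>2"]) auto
    have "(\<integral>\<omega>. X \<omega> \<partial>M)\<^sup>2 \<le> (\<integral>\<omega>. (X \<omega>)\<^sup>2 \<partial>M)"
      using variance_eq[OF X_int X2_int] variance_positive[of X] by linarith
    also have "(\<integral>\<omega>. (X \<omega>)\<^sup>2 \<partial>M) = (\<integral>\<omega>. (\<Sum>k<n. \<phi> (L k \<omega>) - \<mu>)\<^sup>2 / (real n)\<^sup>2 \<partial>M)"
      using n by (intro Bochner_Integration.integral_cong refl)
        (simp add: X_def sum_subtractf power_divide[symmetric] diff_divide_distrib)
    also have "\<dots> = (\<integral>\<omega>. (\<Sum>k<n. \<phi> (L k \<omega>) - \<mu>)\<^sup>2 \<partial>M) / (real n)\<^sup>2" by simp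
    also have "\<dots> \<le> D * real n / (real n)\<^sup>2"
      by (intro divide_right_mono D) simp
    also have "\<dots> = D / real n" using n by (simp add: power2_eq_square)
    finally have "(\<integral>\<omega>. X \<omega> \<partial>M) \<le> sqrt (D / real n)" by (rule real_le_rsqrt)
    then show ?thesis by (simp add: X_def real_sqrt_divide)
  qed
  have lim: "(\<lambda>n. sqrt D * (1 / sqrt (real n))) \<longlonglongrightarrow> 0"
    by (intro tendsto_mult_right_zero tendsto_divide_0[OF tendsto_const] filterlim_at_top_imp_at_infinity
        filterlim_compose[OF sqrt_at_top filterlim_real_sequentially])
  show ?thesis unfolding \<mu>_def[symmetric]
  proof (rule tendsto_sandwich[OF _ _ tendsto_const lim])
    show "\<forall>\<^sub>F n in sequentially. (\<integral>\<omega>. \<bar>(\<Sum>k<n. \<phi> (L k \<omega>)) / real n - \<mu>\<bar> \<partial>M) \<le> sqrt D * (1 / sqrt (real n))"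
      using bound by (intro eventually_sequentiallyI[of 1]) auto
  qed auto
qed

end

text \<open>A tent with peak B at l = B that vanishes from 2 * B on. Unlike \<open>min l B\<close>,
  it switches large intensities off entirely, where the third moments of \<open>disp\<close> are out
  of control, and it is still Lipschitz, as the law of large numbers requires.\<close>

definition trunc :: "real \<Rightarrow> real \<Rightarrow> real" where
  "trunc B l = max 0 (min l (2 * B - l))"

text \<open>The weight that turns the conditional variance 2 * l^2 into twice the square of
  \<open>trunc B l\<close>. It is a function of the intensity alone, so weighted summands remain
  martingale differences.\<close>

definition wt :: "real \<Rightarrow> real \<Rightarrow> real" where
  "wt B l = trunc B l / l"

lemma trunc_nonneg: "0 \<le> trunc B l"
  and trunc_le_bound: "0 \<le> B \<Longrightarrow> trunc B l \<le> B"
  and trunc_le: "0 \<le> l \<Longrightarrow> trunc B l \<le> l"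
  by (auto simp: trunc_def)

lemma trunc_eq: "0 \<le> l \<Longrightarrow> l \<le> B \<Longrightarrow> trunc B l = l"
  by (auto simp: trunc_def)

lemma trunc_measurable [measurable]: "trunc B \<in> borel_measurable borel"
  unfolding trunc_def by measurable

lemma wt_measurable [measurable]: "wt B \<in> borel_measurable borel"
  unfolding wt_def by measurable

lemma wt_mult: "0 \<le> l \<Longrightarrow> wt B l * l = trunc B l"
  by (cases "l = 0") (auto simp: wt_def trunc_def)

lemma wt_bounds: "0 \<le> l \<Longrightarrow> 0 \<le> wt B l" "0 \<le> l \<Longrightarrow> wt B l \<le> 1"
  using trunc_nonneg[of B l] trunc_le[of l B]
  by (cases "l = 0"; auto simp: wt_def divide_le_eq)+

lemma wt_eq_0: "0 \<le> B \<Longrightarrow> 2 * B < l \<Longrightarrow> wt B l = 0"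
  by (auto simp: wt_def trunc_def)

lemma lipb_trunc_sq:
  assumes "0 \<le> B" shows "lipb (B\<^sup>2) (2 * B) (\<lambda>l. (trunc B l)\<^sup>2)"
  unfolding lipb_def
proof (intro conjI allI)
  fix l l' :: real
  show "\<bar>(trunc B l)\<^sup>2\<bar> \<le> B\<^sup>2"
    using trunc_le_bound[OF assms, of l] trunc_nonneg[of B l] by (simp add: power_mono)
  have "\<bar>(trunc B l)\<^sup>2 - (trunc B l')\<^sup>2\<bar> = \<bar>trunc B l + trunc B l'\<bar> * \<bar>trunc B l - trunc B l'\<bar>"
    by (simp add: abs_mult[symmetric] power2_eq_square algebra_simps)
  also have "\<dots> \<le> (2 * B) * \<bar>l - l'\<bar>"
  proof (intro mult_mono)
    show "\<bar>trunc B l + trunc B l'\<bar> \<le> 2 * B"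
      using trunc_nonneg[of B l] trunc_nonneg[of B l'] trunc_le_bound[OF assms, of l]
        trunc_le_bound[OF assms, of l'] by simp
    show "\<bar>trunc B l - trunc B l'\<bar> \<le> \<bar>l - l'\<bar>" by (auto simp: trunc_def)
  qed (use assms in auto)
  finally show "\<bar>(trunc B l)\<^sup>2 - (trunc B l')\<^sup>2\<bar> \<le> (2 * B) * \<bar>l - l'\<bar>" .
qed

text \<open>The third moment bound of \<open>disp\<close> at rate 2 * B, the largest at which the
  weight is active, divided by the 6 of the Taylor remainder: 720 / 6 = 120.\<close>

definition cube_bound :: "real \<Rightarrow> real" where
  "cube_bound B = 120 * exp (2 * B + 1) * exp (2 * B * (exp 1 - 1))"

text \<open>Second order Taylor expansion: the mean is 0 and the conditional variance is twice the
  squared truncation. The error is uniform in l, because beyond 2 * B the weight is 0 and both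
  quantities equal 1.\<close>

lemma cond_char_bound:
  assumes B: "0 \<le> B" and l: "0 \<le> l"
  shows "cmod ((\<integral>j. iexp (t * (wt B l * disp l j)) \<partial>pois l) - complex_of_real (1 - t\<^sup>2 * (trunc B l)\<^sup>2))
    \<le> cube_bound B * \<bar>t\<bar> ^ 3"
proof (cases "2 * B < l")
  case True
  then show ?thesis using B l by (simp add: wt_eq_0 trunc_def cube_bound_def)
next
  case False
  define X where "X j = wt B l * disp l j" for j
  note dm = disp_moments[OF l] and cm = disp_cube_moment[OF l]
  note w = wt_bounds[OF l, of B]
  have iX: "integrable (pois l) X" and iX2: "integrable (pois l) (\<lambda>j. (X j)\<^sup>2)"
    and iX3: "integrable (pois l) (\<lambda>j. \<bar>X j\<bar> ^ 3)"
    unfolding X_def power_mult_distrib abs_mult using dm cm by (auto simp del: power_abs)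
  have EX: "(\<integral>j. X j \<partial>pois l) = 0" unfolding X_def using dm by simp
  have EX2: "(\<integral>j. (X j)\<^sup>2 \<partial>pois l) = 2 * (trunc B l)\<^sup>2"
    unfolding X_def power_mult_distrib using dm by (simp add: wt_mult[OF l, symmetric] power_mult_distrib)
  have var: "measure_pmf.variance (pois l) X = 2 * (trunc B l)\<^sup>2"
    using EX EX2 by simp
  have "cmod (char (distr (pois l) borel X) t - (1 - t\<^sup>2 * (2 * (trunc B l)\<^sup>2) / 2))
    \<le> (t\<^sup>2 / 6) * (\<integral>j. min (6 * (X j)\<^sup>2) (\<bar>t\<bar> * \<bar>X j\<bar> ^ 3) \<partial>pois l)"
    using iX iX2 EX var by (intro prob_space.char_approx3'[OF prob_space_measure_pmf]) auto
  also have "\<dots> \<le> (t\<^sup>2 / 6) * (\<integral>j. \<bar>t\<bar> * \<bar>disp l j\<bar> ^ 3 \<partial>pois l)"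
  proof (intro mult_left_mono integral_mono)
    show "integrable (pois l) (\<lambda>j. min (6 * (X j)\<^sup>2) (\<bar>t\<bar> * \<bar>X j\<bar> ^ 3))"
      using iX2 iX3 by (intro Bochner_Integration.integrable_min) auto
    show "integrable (pois l) (\<lambda>j. \<bar>t\<bar> * \<bar>disp l j\<bar> ^ 3)" using cm(1) by simp
    fix j
    have "\<bar>X j\<bar> \<le> \<bar>disp l j\<bar>"
      using w by (simp add: X_def abs_mult mult_left_le_one_le)
    then have "\<bar>X j\<bar> ^ 3 \<le> \<bar>disp l j\<bar> ^ 3" by (intro power_mono) auto
    then show "min (6 * (X j)\<^sup>2) (\<bar>t\<bar> * \<bar>X j\<bar> ^ 3) \<le> \<bar>t\<bar> * \<bar>disp l j\<bar> ^ 3"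
      by (intro min.coboundedI2 mult_left_mono) auto
  qed auto
  also have "\<dots> = (\<bar>t\<bar> ^ 3 / 6) * (\<integral>j. \<bar>disp l j\<bar> ^ 3 \<partial>pois l)"
  proof -
    have "\<bar>t\<bar> ^ 3 = t\<^sup>2 * \<bar>t\<bar>" by (simp add: power3_eq_cube power2_eq_square)
    then show ?thesis by simp
  qed
  also have "\<dots> \<le> (\<bar>t\<bar> ^ 3 / 6) * (720 * exp (2 * B + 1) * exp (2 * B * (exp 1 - 1)))"
  proof (intro mult_left_mono)
    have "(\<integral>j. \<bar>disp l j\<bar> ^ 3 \<partial>pois l) \<le> 720 * exp (l + 1) * exp (l * (exp 1 - 1))"
      by (rule cm(2))
    also have "\<dots> \<le> 720 * exp (2 * B + 1) * exp (2 * B * (exp 1 - 1))"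
      using False l by (intro mult_mono) (auto intro!: mult_right_mono)
    finally show "(\<integral>j. \<bar>disp l j\<bar> ^ 3 \<partial>pois l) \<le> 720 * exp (2 * B + 1) * exp (2 * B * (exp 1 - 1))" .
  qed auto
  also have "\<dots> = cube_bound B * \<bar>t\<bar> ^ 3" by (simp add: cube_bound_def)
  also have "char (distr (pois l) borel X) t = (\<integral>j. iexp (t * X j) \<partial>pois l)"
    unfolding char_def by (subst integral_distr) auto
  finally show ?thesis by (simp add: X_def)
qed

lemma exp_neg_quadratic:
  fixes a :: real assumes "0 \<le> a" shows "\<bar>(1 - a) - exp (- a)\<bar> \<le> a\<^sup>2"
proof -
  have "1 - a \<le> exp (- a)" using exp_ge_add_one_self[of "-a"] by simp
  moreover have "exp (- a) \<le> 1 - a + a\<^sup>2"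
  proof (cases "a \<le> 1")
    case True
    then show ?thesis using exp_le_quadratic[of "-a"] assms by simp
  next
    case False
    then have "a * 1 \<le> a * a" by (intro mult_left_mono) auto
    then have "1 \<le> 1 - a + a\<^sup>2" by (simp add: power2_eq_square)
    moreover have "exp (- a) \<le> 1" using assms by simp
    ultimately show ?thesis by linarith
  qed
  ultimately show ?thesis by linarith
qed

lemma abs_one_minus_exp: "\<bar>1 - exp x\<bar> \<le> \<bar>x\<bar> * exp \<bar>x\<bar>" for x :: real
proof (cases "0 \<le> x")
  case True
  have "(1 - x) * exp x \<le> exp (- x) * exp x"
    using exp_ge_add_one_self[of "- x"] by (intro mult_right_mono) auto
  also have "\<dots> = 1" by (simp add: exp_minus)
  finally show ?thesis using True by (simp add: algebra_simps)
next
  case False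
  have "1 - exp x \<le> - x" using exp_ge_add_one_self[of x] by linarith
  also have "\<dots> \<le> - x * exp (- x)" using False by (simp add: mult_le_cancel_left1)
  finally show ?thesis using False by simp
qed

lemma cmod_iexp_diff: "cmod (iexp x - iexp y) \<le> \<bar>x - y\<bar>"
proof -
  have "iexp x - iexp y = iexp y * (iexp (x - y) - 1)"
    by (simp add: exp_diff right_diff_distrib of_real_diff) 
  then have "cmod (iexp x - iexp y) = cmod (iexp (x - y) - 1)"
    by (simp add: norm_mult)
  also have "\<dots> \<le> \<bar>x - y\<bar>" using iexp_approx1[of "x - y" 0] by simp
  finally show ?thesis .
qed

lemma norm_integral_le_integral:
  fixes f :: "'a \<Rightarrow> 'b::{banach, second_countable_topology}"
  assumes "integrable M f" "integrable M h" "\<And>x. x \<in> space M \<Longrightarrow> norm (f x) \<le> h x"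
  shows "norm (\<integral>x. f x \<partial>M) \<le> (\<integral>x. h x \<partial>M)"
proof -
  have "norm (\<integral>x. f x \<partial>M) \<le> (\<integral>x. norm (f x) \<partial>M)" by (rule integral_norm_bound)
  also have "\<dots> \<le> (\<integral>x. h x \<partial>M)" using assms by (intro integral_mono) auto
  finally show ?thesis .
qed

lemma integrable_mult_of_squares:
  fixes f h :: "'a \<Rightarrow> real"
  assumes [measurable]: "f \<in> borel_measurable M" "h \<in> borel_measurable M"
    and "integrable M (\<lambda>x. (f x)\<^sup>2)" "integrable M (\<lambda>x. (h x)\<^sup>2)"
  shows "integrable M (\<lambda>x. f x * h x)"
proof (rule Bochner_Integration.integrable_bound)
  show "integrable M (\<lambda>x. (f x)\<^sup>2 + (h x)\<^sup>2)" using assms by simp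
  have "\<bar>a * b\<bar> \<le> a\<^sup>2 + b\<^sup>2" for a b :: real
  proof -
    have "2 * (\<bar>a\<bar> * \<bar>b\<bar>) \<le> a\<^sup>2 + b\<^sup>2"
      using sum_squares_bound[of "\<bar>a\<bar>" "\<bar>b\<bar>"] by simp
    moreover have "0 \<le> \<bar>a\<bar> * \<bar>b\<bar>" by simp
    ultimately show ?thesis unfolding abs_mult by linarith
  qed
  then show "AE x in M. norm (f x * h x) \<le> norm ((f x)\<^sup>2 + (h x)\<^sup>2)" by simp
qed measurable

context poisson_chain
begin

subsection \<open>Central limit theorem\<close>

definition Xi :: "nat \<Rightarrow> 'w \<Rightarrow> real" where
  "Xi k \<omega> = disp (L k \<omega>) (Y k \<omega>)"

lemma disp_meas_F: "(\<lambda>\<omega>. disp (L k \<omega>) j) \<in> borel_measurable (F k)"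
  unfolding disp_def by (intro borel_measurable_diff borel_measurable_power borel_measurable_const L_meas_F)

lemma Xi_meas_F: "k < n \<Longrightarrow> Xi k \<in> borel_measurable (F n)"
  unfolding Xi_def
  by (rule measurable_F_mono[of "Suc k"])
    (auto intro!: measurable_compose_countable[OF measurable_F_mono[OF _ disp_meas_F] Y_meas_F])

lemma Xi_measurable [measurable]: "Xi k \<in> borel_measurable M"
  by (rule measurable_F_M[OF Xi_meas_F[OF lessI]])

text \<open>Compensating \<open>exp (i u S\<^sub>k / sqrt n)\<close> by the exponential of the accumulated conditional
  variance makes its expectation almost constant in \<open>k\<close>.\<close>

lemma char_trunc_limit:
  assumes B: "0 \<le> B"
  shows "(\<lambda>n. \<integral>\<omega>. iexp (u / sqrt (real n) * (\<Sum>k<n. wt B (L k \<omega>) * Xi k \<omega>)) \<partial>M)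
     \<longlonglongrightarrow> complex_of_real (exp (- (u\<^sup>2) * (\<integral>\<omega>. (trunc B (L 0 \<omega>))\<^sup>2 \<partial>M)))"
proof -
  define v where "v = (\<integral>\<omega>. (trunc B (L 0 \<omega>))\<^sup>2 \<partial>M)"
  define X where "X k \<omega> = wt B (L k \<omega>) * Xi k \<omega>" for k \<omega>
  define V where "V k \<omega> = (\<Sum>m<k. (trunc B (L m \<omega>))\<^sup>2)" for k \<omega>
  define S where "S k \<omega> = (\<Sum>m<k. X m \<omega>)" for k \<omega>
  \<comment> \<open>Bounds the compensator: after k \<le> n steps the accumulated variance is at
    most n * B^2, and it is multiplied by u^2 / n.\<close>
  define E where "E = exp (u\<^sup>2 * B\<^sup>2)"
  have wt_meas: "(\<lambda>\<omega>. wt B (L k \<omega>)) \<in> borel_measurable (F k)" for k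
    by (rule measurable_compose[OF L_meas_F wt_measurable])
  have tr_meas: "(\<lambda>\<omega>. (trunc B (L k \<omega>))\<^sup>2) \<in> borel_measurable (F k)" for k
    by (intro borel_measurable_power measurable_compose[OF L_meas_F trunc_measurable])
  have X_meas: "X k \<in> borel_measurable (F (Suc k))" for k
    unfolding X_def by (intro borel_measurable_times measurable_F_mono[OF _ wt_meas] Xi_meas_F) auto
  have S_meas: "S k \<in> borel_measurable (F k)" for k
    unfolding S_def by (intro borel_measurable_sum measurable_F_mono[OF _ X_meas]) auto
  have V_meas: "V k \<in> borel_measurable (F k)" for k
    unfolding V_def by (intro borel_measurable_sum measurable_F_mono[OF _ tr_meas]) auto
  note [measurable] = measurable_F_M[OF S_meas] measurable_F_M[OF V_meas]
  have tr_le: "(trunc B l)\<^sup>2 \<le> B\<^sup>2" for l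
    using trunc_le_bound[OF B, of l] trunc_nonneg[of B l] by (simp add: power_mono)
  have V_le: "0 \<le> V k \<omega>" "V k \<omega> \<le> real k * B\<^sup>2" for k \<omega>
    unfolding V_def using sum_mono[of "{..<k}" "\<lambda>m. (trunc B (L m \<omega>))\<^sup>2" "\<lambda>_. B\<^sup>2"] tr_le
    by (auto intro: sum_nonneg)
  \<comment> \<open>With t = u / sqrt n, a step multiplies the conditional mean of the oscillating
    factor by about exp (- t^2 * trunc^2); the real factor grows by exactly the inverse.\<close>
  define Z where "Z n k \<omega> = complex_of_real (exp (u\<^sup>2 / real n * V k \<omega>)) * iexp (u / sqrt (real n) * S k \<omega>)"
    for n k \<omega>
  have Z_meas [measurable]: "Z n k \<in> borel_measurable (F k)" for n k
    unfolding Z_def using S_meas V_meas by measurable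
  have expV: "exp (u\<^sup>2 / real n * V k \<omega>) \<le> E" if "k \<le> n" "0 < n" for n k \<omega>
  proof -
    have "V k \<omega> \<le> real n * B\<^sup>2"
      using V_le(2)[of k \<omega>] that by (meson mult_right_mono of_nat_le_iff order_trans zero_le_power2)
    then have "u\<^sup>2 / real n * V k \<omega> \<le> u\<^sup>2 / real n * (real n * B\<^sup>2)"
      by (intro mult_left_mono) auto
    also have "\<dots> = u\<^sup>2 * B\<^sup>2" using that by simp
    finally show ?thesis by (simp add: E_def)
  qed
  have Z_int: "integrable M (Z n k)" if "k \<le> n" "0 < n" for n k
    using expV[OF that] measurable_F_M[OF Z_meas]
    by (intro integrable_const_bound[where B=E]) (auto simp: Z_def norm_mult)
  \<comment> \<open>One-step error: the cubic Taylor remainder plus the cost of replacing 1 - a by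
    exp (- a), both times the bound E. It is of order n^(-3/2), so n steps are harmless.\<close>
  define rate where "rate n = E * (cube_bound B * \<bar>u / sqrt (real n)\<bar> ^ 3 + ((u / sqrt (real n))\<^sup>2 * B\<^sup>2)\<^sup>2)" for n
  have step: "cmod ((\<integral>\<omega>. Z n (Suc k) \<omega> \<partial>M) - (\<integral>\<omega>. Z n k \<omega> \<partial>M)) \<le> rate n" if k: "k < n" for n k
  proof -
    define t where "t = u / sqrt (real n)"
    have n: "0 < n" using k by simp
    have t2: "t\<^sup>2 = u\<^sup>2 / real n" by (simp add: t_def power_divide)
    define a where "a \<omega> = t\<^sup>2 * (trunc B (L k \<omega>))\<^sup>2" for \<omega>
    define h where "h j \<omega> = iexp (t * (wt B (L k \<omega>) * disp (L k \<omega>) j))" for j \<omega>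
    \<comment> \<open>The compensator of step k depends on \<open>L k\<close> only, so it already
      belongs to the past; \<open>h\<close> is the single factor that still has to be averaged over
      \<open>Y k\<close>.\<close>
    define ZA where "ZA \<omega> = Z n k \<omega> * complex_of_real (exp (a \<omega>))" for \<omega>
    define \<Psi> where "\<Psi> \<omega> = (\<integral>j. h j \<omega> \<partial>pois (L k \<omega>))" for \<omega>
    have aF: "a \<in> borel_measurable (F k)" unfolding a_def by (intro borel_measurable_times borel_measurable_const tr_meas)
    have iF: "(\<lambda>\<omega>. h j \<omega>) \<in> borel_measurable (F k)" for j
      unfolding h_def using wt_meas[of k] disp_meas_F[of k j] by measurable
    have HF: "(\<lambda>\<omega>. ZA \<omega> * h j \<omega>) \<in> borel_measurable (F k)" for j
      unfolding ZA_def using aF iF[of j] by measurable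
    have \<Psi>F: "\<Psi> \<in> borel_measurable (F k)"
      unfolding \<Psi>_def by (rule kernel_integral_measurable[OF iF])
    have Z_Suc: "Z n (Suc k) \<omega> = ZA \<omega> * h (Y k \<omega>) \<omega>" for \<omega>
      by (simp add: ZA_def h_def Z_def V_def S_def X_def Xi_def a_def t_def power_divide distrib_left exp_add mult_ac)
    have ZE: "cmod (ZA \<omega>) \<le> E" for \<omega>
    proof -
      have "cmod (ZA \<omega>) = exp (u\<^sup>2 / real n * V (Suc k) \<omega>)"
        by (simp add: ZA_def Z_def norm_mult a_def t2 V_def distrib_left exp_add)
      then show ?thesis using expV[of "Suc k" n \<omega>] k by simp
    qed
    have i: "integrable M (\<lambda>\<omega>. ZA \<omega> * h (Y k \<omega>) \<omega>)"
      unfolding Z_Suc[symmetric] using Z_int[of "Suc k" n] k by simp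
    have "(\<integral>\<omega>. Z n (Suc k) \<omega> \<partial>M) = (\<integral>\<omega>. (\<integral>j. ZA \<omega> * h j \<omega> \<partial>pois (L k \<omega>)) \<partial>M)"
      unfolding Z_Suc
      by (rule kernel_integral(1)[where H="\<lambda>j \<omega>. ZA \<omega> * h j \<omega>", OF HF i])
    also have "\<dots> = (\<integral>\<omega>. ZA \<omega> * \<Psi> \<omega> \<partial>M)"
      by (simp add: \<Psi>_def)
    finally have EZ: "(\<integral>\<omega>. Z n (Suc k) \<omega> \<partial>M) = (\<integral>\<omega>. ZA \<omega> * \<Psi> \<omega> \<partial>M)" .
    have i2: "integrable M (\<lambda>\<omega>. ZA \<omega> * \<Psi> \<omega>)"
      using kernel_integral(2)[where H="\<lambda>j \<omega>. ZA \<omega> * h j \<omega>", OF HF i]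
      by (simp add: \<Psi>_def)
    have i3: "integrable M (Z n k)" using Z_int k by simp
    have ZA_diff: "ZA \<omega> * (\<Psi> \<omega> - complex_of_real (exp (- a \<omega>))) = ZA \<omega> * \<Psi> \<omega> - Z n k \<omega>" for \<omega>
      by (simp add: ZA_def right_diff_distrib mult.assoc of_real_mult[symmetric] exp_add[symmetric] del: of_real_mult)
    have "(\<integral>\<omega>. Z n (Suc k) \<omega> \<partial>M) - (\<integral>\<omega>. Z n k \<omega> \<partial>M)
        = (\<integral>\<omega>. ZA \<omega> * (\<Psi> \<omega> - complex_of_real (exp (- a \<omega>))) \<partial>M)"
      unfolding EZ ZA_diff Bochner_Integration.integral_diff[OF i2 i3, symmetric] ..
    also have "cmod \<dots> \<le> (\<integral>\<omega>. rate n \<partial>M)"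
    proof (rule norm_integral_le_integral)
      show "integrable M (\<lambda>\<omega>. ZA \<omega> * (\<Psi> \<omega> - complex_of_real (exp (- a \<omega>))))"
        unfolding ZA_diff using i2 i3 by simp
      fix \<omega> assume \<omega>: "\<omega> \<in> space M"
      have a0: "0 \<le> a \<omega>" by (simp add: a_def)
      have "cmod (\<Psi> \<omega> - complex_of_real (exp (- a \<omega>)))
         \<le> cmod (\<Psi> \<omega> - complex_of_real (1 - a \<omega>)) + cmod (complex_of_real (1 - a \<omega>) - complex_of_real (exp (- a \<omega>)))"
        using norm_triangle_ineq[of "\<Psi> \<omega> - complex_of_real (1 - a \<omega>)" "complex_of_real (1 - a \<omega>) - complex_of_real (exp (- a \<omega>))"]
        by simp
      also have "cmod (complex_of_real (1 - a \<omega>) - complex_of_real (exp (- a \<omega>))) = \<bar>(1 - a \<omega>) - exp (- a \<omega>)\<bar>"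
        by (metis norm_of_real of_real_diff)
      also have "\<dots> \<le> (a \<omega>)\<^sup>2" by (rule exp_neg_quadratic[OF a0])
      also have "(a \<omega>)\<^sup>2 \<le> (t\<^sup>2 * B\<^sup>2)\<^sup>2"
        unfolding a_def by (intro power_mono mult_left_mono tr_le) auto
      also have "cmod (\<Psi> \<omega> - complex_of_real (1 - a \<omega>)) \<le> cube_bound B * \<bar>t\<bar> ^ 3"
        unfolding \<Psi>_def h_def a_def by (rule cond_char_bound[OF B L_nonneg[OF \<omega>]])
      finally have "cmod (\<Psi> \<omega> - complex_of_real (exp (- a \<omega>))) \<le> cube_bound B * \<bar>t\<bar> ^ 3 + (t\<^sup>2 * B\<^sup>2)\<^sup>2"
        by simp
      then have "cmod (ZA \<omega> * (\<Psi> \<omega> - complex_of_real (exp (- a \<omega>))))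
          \<le> E * (cube_bound B * \<bar>t\<bar> ^ 3 + (t\<^sup>2 * B\<^sup>2)\<^sup>2)"
        unfolding norm_mult[of "ZA \<omega>"] by (intro mult_mono ZE) (auto simp: E_def)
      then show "cmod (ZA \<omega> * (\<Psi> \<omega> - complex_of_real (exp (- a \<omega>)))) \<le> rate n"
        by (simp add: rate_def t_def)
    qed simp
    finally show ?thesis by (simp add: prob_space)
  qed
  have near1: "cmod ((\<integral>\<omega>. Z n n \<omega> \<partial>M) - 1) \<le> real n * rate n" for n
  proof -
    have "k \<le> n \<Longrightarrow> cmod ((\<integral>\<omega>. Z n k \<omega> \<partial>M) - 1) \<le> real k * rate n" for k
    proof (induction k)
      case 0
      then show ?case by (simp add: Z_def V_def S_def prob_space)
    next
      case (Suc k)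
      then have "cmod ((\<integral>\<omega>. Z n (Suc k) \<omega> \<partial>M) - (\<integral>\<omega>. Z n k \<omega> \<partial>M)) \<le> rate n"
        and "cmod ((\<integral>\<omega>. Z n k \<omega> \<partial>M) - 1) \<le> real k * rate n" using step by auto
      then show ?case
        using norm_triangle_ineq[of "(\<integral>\<omega>. Z n (Suc k) \<omega> \<partial>M) - (\<integral>\<omega>. Z n k \<omega> \<partial>M)" "(\<integral>\<omega>. Z n k \<omega> \<partial>M) - 1"]
        by (simp add: algebra_simps)
    qed
    from this[of n] show ?thesis by simp
  qed
  have nrate: "real n * rate n = E * (cube_bound B * \<bar>u\<bar> ^ 3 * (1 / sqrt (real n)) + u ^ 4 * B ^ 4 * (1 / real n))" if "0 < n" for n
  proof -
    define r where "r = sqrt (real n)"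
    have r: "0 < r" "real n = r * r" using that by (auto simp: r_def)
    show ?thesis unfolding rate_def r_def[symmetric] r(2)
      using r(1) by (simp add: power_divide power_numeral_reduce field_simps)
  qed
  have lim1: "(\<lambda>n. real n * rate n) \<longlonglongrightarrow> 0"
  proof -
    have s: "(\<lambda>n. 1 / sqrt (real n)) \<longlonglongrightarrow> 0"
      by (intro tendsto_divide_0[OF tendsto_const] filterlim_at_top_imp_at_infinity
          filterlim_compose[OF sqrt_at_top filterlim_real_sequentially])
    have "(\<lambda>n. E * (cube_bound B * \<bar>u\<bar> ^ 3 * (1 / sqrt (real n)) + u ^ 4 * B ^ 4 * (1 / real n)))
        \<longlonglongrightarrow> E * (cube_bound B * \<bar>u\<bar> ^ 3 * 0 + u ^ 4 * B ^ 4 * 0)"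
      by (intro tendsto_intros s lim_1_over_n)
    then have "(\<lambda>n. E * (cube_bound B * \<bar>u\<bar> ^ 3 * (1 / sqrt (real n)) + u ^ 4 * B ^ 4 * (1 / real n))) \<longlonglongrightarrow> 0"
      by simp
    then show ?thesis
      by (rule Lim_transform_eventually) (use nrate in \<open>auto intro!: eventually_sequentiallyI[of 1]\<close>)
  qed
  have EZ: "(\<lambda>n. \<integral>\<omega>. Z n n \<omega> \<partial>M) \<longlonglongrightarrow> 1"
    by (rule LIM_zero_cancel, rule Lim_null_comparison[OF _ lim1]) (use near1 in auto)
  define dV where "dV n = (\<integral>\<omega>. \<bar>V n \<omega> / real n - v\<bar> \<partial>M)" for n
  have lim2: "dV \<longlonglongrightarrow> 0"
    using lln[OF lipb_trunc_sq[OF B]] by (simp add: dV_def[abs_def] V_def v_def)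
  have v: "0 \<le> v" "v \<le> B\<^sup>2"
  proof -
    show "0 \<le> v" unfolding v_def by simp
    have "v \<le> (\<integral>\<omega>. B\<^sup>2 \<partial>M)"
      unfolding v_def using tr_le
      by (intro integral_mono integrable_const_bound[where B="B\<^sup>2"]) auto
    then show "v \<le> B\<^sup>2" by (simp add: prob_space)
  qed
  \<comment> \<open>The random compensator is exchanged for its limit exp (u^2 * v). The factor 1 -
    exp (x \<omega>) is small in mean because \<open>V n \<omega> / real n\<close> approaches v in
    mean and E bounds the exponential.\<close>
  have comp: "cmod ((\<integral>\<omega>. iexp (u / sqrt (real n) * S n \<omega>) \<partial>M) - complex_of_real (exp (- (u\<^sup>2) * v)) * (\<integral>\<omega>. Z n n \<omega> \<partial>M))
      \<le> u\<^sup>2 * E * dV n" if n: "0 < n" for n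
  proof -
    define x where "x \<omega> = u\<^sup>2 * (V n \<omega> / real n - v)" for \<omega>
    have i1: "integrable M (\<lambda>\<omega>. iexp (u / sqrt (real n) * S n \<omega>))"
      by (intro integrable_const_bound[where B=1]) auto
    have i2: "integrable M (Z n n)" using Z_int n by simp
    have Vn: "\<bar>V n \<omega> / real n - v\<bar> \<le> B\<^sup>2" for \<omega>
    proof -
      have "0 \<le> V n \<omega> / real n" "V n \<omega> / real n \<le> B\<^sup>2"
        using V_le[of n \<omega>] n by (auto simp: divide_le_eq mult.commute)
      then show ?thesis using v by linarith
    qed
    have iV: "integrable M (\<lambda>\<omega>. \<bar>V n \<omega> / real n - v\<bar>)"
      using Vn by (intro integrable_const_bound[where B="B\<^sup>2"]) auto
    have eq: "iexp (u / sqrt (real n) * S n \<omega>) - complex_of_real (exp (- (u\<^sup>2) * v)) * Z n n \<omega>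
        = complex_of_real (1 - exp (x \<omega>)) * iexp (u / sqrt (real n) * S n \<omega>)" for \<omega>
    proof -
      have "exp (- (u\<^sup>2) * v) * exp (u\<^sup>2 / real n * V n \<omega>) = exp (x \<omega>)"
        by (simp add: x_def exp_add[symmetric] algebra_simps)
      then have "complex_of_real (exp (- (u\<^sup>2) * v)) * complex_of_real (exp (u\<^sup>2 / real n * V n \<omega>)) = complex_of_real (exp (x \<omega>))"
        by (metis of_real_mult)
      then show ?thesis unfolding Z_def mult.assoc[symmetric] by (simp add: left_diff_distrib)
    qed
    have "cmod ((\<integral>\<omega>. iexp (u / sqrt (real n) * S n \<omega>) \<partial>M) - complex_of_real (exp (- (u\<^sup>2) * v)) * (\<integral>\<omega>. Z n n \<omega> \<partial>M))
       = cmod (\<integral>\<omega>. iexp (u / sqrt (real n) * S n \<omega>) - complex_of_real (exp (- (u\<^sup>2) * v)) * Z n n \<omega> \<partial>M)"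
      using i1 i2 by simp
    also have "\<dots> \<le> (\<integral>\<omega>. u\<^sup>2 * E * \<bar>V n \<omega> / real n - v\<bar> \<partial>M)"
    proof (rule norm_integral_le_integral)
      fix \<omega>
      have "\<bar>x \<omega>\<bar> = u\<^sup>2 * \<bar>V n \<omega> / real n - v\<bar>" by (simp add: x_def abs_mult)
      moreover have "\<dots> \<le> u\<^sup>2 * B\<^sup>2" using Vn by (intro mult_left_mono) auto
      ultimately have xE: "exp \<bar>x \<omega>\<bar> \<le> E" by (simp add: E_def)
      have "cmod (iexp (u / sqrt (real n) * S n \<omega>) - complex_of_real (exp (- (u\<^sup>2) * v)) * Z n n \<omega>) = \<bar>1 - exp (x \<omega>)\<bar>"
        unfolding eq norm_mult norm_of_real by simp
      also have "\<dots> \<le> \<bar>x \<omega>\<bar> * E"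
        using abs_one_minus_exp[of "x \<omega>"] mult_left_mono[OF xE, of "\<bar>x \<omega>\<bar>"] by simp
      also have "\<dots> = u\<^sup>2 * E * \<bar>V n \<omega> / real n - v\<bar>" by (simp add: x_def abs_mult)
      finally show "cmod (iexp (u / sqrt (real n) * S n \<omega>) - complex_of_real (exp (- (u\<^sup>2) * v)) * Z n n \<omega>)
        \<le> u\<^sup>2 * E * \<bar>V n \<omega> / real n - v\<bar>" .
    qed (use i1 i2 iV in auto)
    also have "\<dots> = u\<^sup>2 * E * dV n" by (simp add: dV_def)
    finally show ?thesis .
  qed
  have lim3: "(\<lambda>n. (\<integral>\<omega>. iexp (u / sqrt (real n) * S n \<omega>) \<partial>M) - complex_of_real (exp (- (u\<^sup>2) * v)) * (\<integral>\<omega>. Z n n \<omega> \<partial>M)) \<longlonglongrightarrow> 0"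
  proof (rule Lim_null_comparison)
    show "(\<lambda>n. u\<^sup>2 * E * dV n) \<longlonglongrightarrow> 0" by (rule tendsto_mult_right_zero[OF lim2])
    show "\<forall>\<^sub>F n in sequentially. cmod ((\<integral>\<omega>. iexp (u / sqrt (real n) * S n \<omega>) \<partial>M) - complex_of_real (exp (- (u\<^sup>2) * v)) * (\<integral>\<omega>. Z n n \<omega> \<partial>M)) \<le> u\<^sup>2 * E * dV n"
      using comp by (intro eventually_sequentiallyI[of 1]) auto
  qed
  have "(\<lambda>n. complex_of_real (exp (- (u\<^sup>2) * v)) * (\<integral>\<omega>. Z n n \<omega> \<partial>M)) \<longlonglongrightarrow> complex_of_real (exp (- (u\<^sup>2) * v)) * 1"
    by (intro tendsto_mult tendsto_const EZ)
  from tendsto_add[OF lim3 this] show ?thesis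
    by (simp add: S_def X_def v_def)
qed

end

section \<open>Stability of characteristic function limits, and the normal law\<close>

context prob_space
begin

lemma expectation_abs_le_sqrt:
  fixes X :: "'a \<Rightarrow> real"
  assumes [measurable]: "X \<in> borel_measurable M" and X2: "integrable M (\<lambda>\<omega>. (X \<omega>)\<^sup>2)"
  shows "(\<integral>\<omega>. \<bar>X \<omega>\<bar> \<partial>M) \<le> sqrt (\<integral>\<omega>. (X \<omega>)\<^sup>2 \<partial>M)"
proof -
  have i: "integrable M (\<lambda>\<omega>. \<bar>X \<omega>\<bar>)"
    using square_integrable_imp_integrable[OF _ X2] by simp
  have "(\<integral>\<omega>. \<bar>X \<omega>\<bar> \<partial>M)\<^sup>2 \<le> (\<integral>\<omega>. \<bar>X \<omega>\<bar>\<^sup>2 \<partial>M)"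
    using variance_eq[OF i] X2 variance_positive[of "\<lambda>\<omega>. \<bar>X \<omega>\<bar>"] by simp
  then show ?thesis by (intro real_le_rsqrt) simp
qed

text \<open>Slutsky's argument for characteristic functions: where T and T' are within e the
  integrand moves by at most \<bar>u\<bar> * e, and on the remaining event, of vanishing
  probability, by at most 2.\<close>

lemma char_limit_perturb:
  fixes T T' :: "nat \<Rightarrow> 'a \<Rightarrow> real"
  assumes [measurable]: "\<And>n. T n \<in> borel_measurable M" "\<And>n. T' n \<in> borel_measurable M"
    and lim: "(\<lambda>n. \<integral>\<omega>. iexp (u * T n \<omega>) \<partial>M) \<longlonglongrightarrow> a"
    and close: "\<And>e. 0 < e \<Longrightarrow> (\<lambda>n. prob {\<omega> \<in> space M. e < \<bar>T' n \<omega> - T n \<omega>\<bar>}) \<longlonglongrightarrow> 0"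
  shows "(\<lambda>n. \<integral>\<omega>. iexp (u * T' n \<omega>) \<partial>M) \<longlonglongrightarrow> a"
proof -
  have int: "integrable M (\<lambda>\<omega>. iexp (u * X \<omega>))" if [measurable]: "X \<in> borel_measurable M" for X :: "'a \<Rightarrow> real"
    by (intro integrable_const_bound[where B=1]) auto
  have "(\<lambda>n. (\<integral>\<omega>. iexp (u * T' n \<omega>) \<partial>M) - (\<integral>\<omega>. iexp (u * T n \<omega>) \<partial>M)) \<longlonglongrightarrow> 0"
  proof (rule LIMSEQ_I)
    fix r :: real assume r: "0 < r"
    \<comment> \<open>Makes \<bar>u\<bar> * e at most r / 2, with the 1 covering u = 0. The
      exceptional event, of probability below r / 4, contributes less than the other r / 2.\<close>
    define e where "e = r / (2 * (\<bar>u\<bar> + 1))"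
    have e: "0 < e" unfolding e_def using r by (intro divide_pos_pos) auto
    have ue: "\<bar>u\<bar> * e \<le> r / 2"
    proof -
      have "\<bar>u\<bar> * e \<le> (\<bar>u\<bar> + 1) * e" using e by (intro mult_right_mono) auto
      also have "\<dots> = r / 2"
      proof -
        have "c * (r / (2 * c)) = r / 2" if "0 < c" for c :: real using that by simp
        from this[of "\<bar>u\<bar> + 1"] show ?thesis unfolding e_def by simp
      qed
      finally show ?thesis .
    qed
    obtain n0 where n0: "\<And>n. n \<ge> n0 \<Longrightarrow> prob {\<omega> \<in> space M. e < \<bar>T' n \<omega> - T n \<omega>\<bar>} < r / 4"
      using LIMSEQ_D[OF close[OF e], of "r / 4"] r by auto
    have "norm ((\<integral>\<omega>. iexp (u * T' n \<omega>) \<partial>M) - (\<integral>\<omega>. iexp (u * T n \<omega>) \<partial>M) - 0) < r" if "n \<ge> n0" for n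
    proof -
      let ?A = "{\<omega> \<in> space M. e < \<bar>T' n \<omega> - T n \<omega>\<bar>}"
      have A [measurable]: "?A \<in> sets M" by measurable
      have "norm ((\<integral>\<omega>. iexp (u * T' n \<omega>) \<partial>M) - (\<integral>\<omega>. iexp (u * T n \<omega>) \<partial>M))
          = norm (\<integral>\<omega>. iexp (u * T' n \<omega>) - iexp (u * T n \<omega>) \<partial>M)"
        using int by simp
      also have "\<dots> \<le> (\<integral>\<omega>. \<bar>u\<bar> * e + 2 * indicator ?A \<omega> \<partial>M)"
      proof (rule norm_integral_le_integral)
        show "integrable M (\<lambda>\<omega>. iexp (u * T' n \<omega>) - iexp (u * T n \<omega>))" using int by simp
        show "integrable M (\<lambda>\<omega>. \<bar>u\<bar> * e + 2 * indicator ?A \<omega> :: real)"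
          by (intro Bochner_Integration.integrable_add integrable_const integrable_mult_right
              integrable_real_indicator A) (simp_all add: emeasure_eq_measure)
        fix \<omega> assume \<omega>: "\<omega> \<in> space M"
        show "norm (iexp (u * T' n \<omega>) - iexp (u * T n \<omega>)) \<le> \<bar>u\<bar> * e + 2 * indicator ?A \<omega>"
        proof (cases "\<omega> \<in> ?A")
          case True
          have "norm (iexp (u * T' n \<omega>) - iexp (u * T n \<omega>)) \<le> norm (iexp (u * T' n \<omega>)) + norm (iexp (u * T n \<omega>))"
            by (rule norm_triangle_ineq4)
          also have "\<dots> = 2" by (simp only: norm_exp_i_times one_add_one)
          finally show ?thesis using True e by (simp add: add_increasing)
        next
          case False
          have "norm (iexp (u * T' n \<omega>) - iexp (u * T n \<omega>)) \<le> \<bar>u * T' n \<omega> - u * T n \<omega>\<bar>"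
            by (rule cmod_iexp_diff)
          also have "\<dots> = \<bar>u\<bar> * \<bar>T' n \<omega> - T n \<omega>\<bar>"
            by (simp add: right_diff_distrib[symmetric] abs_mult)
          also have "\<dots> \<le> \<bar>u\<bar> * e" using False \<omega> by (intro mult_left_mono) auto
          finally show ?thesis using False by simp
        qed
      qed
      also have "\<dots> = \<bar>u\<bar> * e + 2 * prob ?A"
        by (subst Bochner_Integration.integral_add)
          (auto simp: prob_space emeasure_eq_measure intro!: integrable_real_indicator)
      also have "\<dots> < r" using n0[OF that] ue r by linarith
      finally show ?thesis by simp
    qed
    then show "\<exists>n0. \<forall>n\<ge>n0. norm ((\<integral>\<omega>. iexp (u * T' n \<omega>) \<partial>M) - (\<integral>\<omega>. iexp (u * T n \<omega>) \<partial>M) - 0) < r"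
      by blast
  qed
  from tendsto_add[OF this lim] show ?thesis by simp
qed

end

text \<open>For v = 0 the law is a point mass at 0 with characteristic function 1; otherwise the
  substitution x = sqrt v * y reduces it to the standard normal law.\<close>

lemma
  assumes v: "0 \<le> v"
  shows real_distribution_normal_measure: "real_distribution (normal_measure 0 v)"
    and char_normal_measure: "char (normal_measure 0 v) u = complex_of_real (exp (- (u\<^sup>2) * v / 2))"
proof -
  show "real_distribution (normal_measure 0 v)"
  proof (cases "v = 0")
    case True
    then show ?thesis
      by (auto simp: normal_measure_def real_distribution_def real_distribution_axioms_def intro!: prob_space_return)
  next
    case False
    then show ?thesis using v prob_space_normal_density[of "sqrt v" 0]
      by (auto simp: normal_measure_def real_distribution_def real_distribution_axioms_def)
  qed
  show "char (normal_measure 0 v) u = complex_of_real (exp (- (u\<^sup>2) * v / 2))"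
  proof (cases "v = 0")
    case True
    then show ?thesis by (simp add: normal_measure_def char_def integral_return)
  next
    case False
    define s where "s = sqrt v"
    have s: "0 < s" "s\<^sup>2 = v" using False v by (auto simp: s_def)
    have dens: "s * normal_density 0 s (s * x) = std_normal_density x" for x
      using s(1) by (simp add: normal_density_def real_sqrt_mult power_mult_distrib field_simps)
    have "char (normal_measure 0 v) u = (\<integral>x. normal_density 0 s x *\<^sub>R iexp (u * x) \<partial>lborel)"
      using False unfolding normal_measure_def char_def s_def[symmetric]
      by (simp add: integral_density del: of_real_mult)
    also have "\<dots> = \<bar>s\<bar> *\<^sub>R (\<integral>x. normal_density 0 s (0 + s * x) *\<^sub>R iexp (u * (0 + s * x)) \<partial>lborel)"
      using s(1) by (intro lborel_integral_real_affine) auto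
    also have "\<dots> = (\<integral>x. std_normal_density x *\<^sub>R iexp ((u * s) * x) \<partial>lborel)"
      unfolding integral_scaleR_right[symmetric]
      using s(1) by (intro Bochner_Integration.integral_cong refl) (simp add: dens[symmetric] mult_ac)
    also have "\<dots> = char std_normal_distribution (u * s)"
      unfolding char_def by (simp add: integral_density del: of_real_mult)
    also have "\<dots> = complex_of_real (exp (- ((u * s)\<^sup>2) / 2))"
      by (simp add: char_std_normal_distribution)
    finally show ?thesis by (simp add: power_mult_distrib s)
  qed
qed

section \<open>Removing the truncation\<close>

context poisson_chain
begin

lemma Xi_sq:
  fixes c :: "real \<Rightarrow> real"
  assumes [measurable]: "c \<in> borel_measurable borel" and c: "\<And>l. 0 \<le> l \<Longrightarrow> \<bar>c l\<bar> \<le> 1"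
  shows "integrable M (\<lambda>\<omega>. (c (L k \<omega>) * Xi k \<omega>)\<^sup>2)"
    and "(\<integral>\<omega>. (c (L k \<omega>) * Xi k \<omega>)\<^sup>2 \<partial>M) = 2 * (\<integral>\<omega>. (c (L 0 \<omega>) * L 0 \<omega>)\<^sup>2 \<partial>M)"
proof -
  have cF: "(\<lambda>\<omega>. c (L k \<omega>)) \<in> borel_measurable (F k)"
    by (rule measurable_compose[OF L_meas_F assms(1)])
  have HF: "(\<lambda>\<omega>. (c (L k \<omega>) * disp (L k \<omega>) j)\<^sup>2) \<in> borel_measurable (F k)" for j
    by (intro borel_measurable_power borel_measurable_times cF disp_meas_F)
  have eq: "(\<integral>j. (c (L k \<omega>) * disp (L k \<omega>) j)\<^sup>2 \<partial>pois (L k \<omega>)) = 2 * (c (L k \<omega>) * L k \<omega>)\<^sup>2"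
    if "\<omega> \<in> space M" for \<omega>
    using disp_moments[OF L_nonneg[OF that]] by (simp add: power_mult_distrib)
  have cL_int: "integrable M (\<lambda>\<omega>. (c (L k \<omega>) * L k \<omega>)\<^sup>2)"
  proof (rule Bochner_Integration.integrable_bound[OF integrable_L_sq[of k]])
    show "AE \<omega> in M. norm ((c (L k \<omega>) * L k \<omega>)\<^sup>2) \<le> norm ((L k \<omega>)\<^sup>2)"
    proof (rule AE_I2)
      fix \<omega> assume "\<omega> \<in> space M"
      from c[OF L_nonneg[OF this, of k]] show "norm ((c (L k \<omega>) * L k \<omega>)\<^sup>2) \<le> norm ((L k \<omega>)\<^sup>2)"
        by (simp add: power_mult_distrib mult_left_le_one_le abs_square_le_1)
    qed
  qed measurable
  show int: "integrable M (\<lambda>\<omega>. (c (L k \<omega>) * Xi k \<omega>)\<^sup>2)"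
    unfolding Xi_def
  proof (rule kernel_integrable[OF HF])
    show "integrable (pois (L k \<omega>)) (\<lambda>j. (c (L k \<omega>) * disp (L k \<omega>) j)\<^sup>2)" if "\<omega> \<in> space M" for \<omega>
      using disp_moments[OF L_nonneg[OF that]] by (simp add: power_mult_distrib)
    have "integrable M (\<lambda>\<omega>. \<integral>j. \<bar>(c (L k \<omega>) * disp (L k \<omega>) j)\<^sup>2\<bar> \<partial>pois (L k \<omega>))
      \<longleftrightarrow> integrable M (\<lambda>\<omega>. 2 * (c (L k \<omega>) * L k \<omega>)\<^sup>2)"
      by (intro Bochner_Integration.integrable_cong refl) (simp add: eq)
    then show "integrable M (\<lambda>\<omega>. \<integral>j. \<bar>(c (L k \<omega>) * disp (L k \<omega>) j)\<^sup>2\<bar> \<partial>pois (L k \<omega>))"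
      using cL_int by simp
  qed
  have "(\<integral>\<omega>. (c (L k \<omega>) * Xi k \<omega>)\<^sup>2 \<partial>M) = (\<integral>\<omega>. (\<integral>j. (c (L k \<omega>) * disp (L k \<omega>) j)\<^sup>2 \<partial>pois (L k \<omega>)) \<partial>M)"
    using int unfolding Xi_def by (rule kernel_integral(1)[OF HF])
  also have "\<dots> = (\<integral>\<omega>. 2 * (c (L k \<omega>) * L k \<omega>)\<^sup>2 \<partial>M)"
    by (intro Bochner_Integration.integral_cong refl eq)
  also have "\<dots> = 2 * (\<integral>\<omega>. (c (L 0 \<omega>) * L 0 \<omega>)\<^sup>2 \<partial>M)"
    using expectation_L_stat[of "\<lambda>l. (c l * l)\<^sup>2" k] by simp
  finally show "(\<integral>\<omega>. (c (L k \<omega>) * Xi k \<omega>)\<^sup>2 \<partial>M) = 2 * (\<integral>\<omega>. (c (L 0 \<omega>) * L 0 \<omega>)\<^sup>2 \<partial>M)" .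
qed

text \<open>Given the past, the next weighted summand has mean 0, so cross terms vanish and
  variances add exactly. With c = 1 - wt B this measures the discarded part uniformly in n after
  division by sqrt n.\<close>

lemma weighted_sum_sq:
  fixes c :: "real \<Rightarrow> real"
  assumes c_meas [measurable]: "c \<in> borel_measurable borel" and c: "\<And>l. 0 \<le> l \<Longrightarrow> \<bar>c l\<bar> \<le> 1"
  shows "integrable M (\<lambda>\<omega>. (\<Sum>k<n. c (L k \<omega>) * Xi k \<omega>)\<^sup>2)
    \<and> (\<integral>\<omega>. (\<Sum>k<n. c (L k \<omega>) * Xi k \<omega>)\<^sup>2 \<partial>M) = real n * (2 * (\<integral>\<omega>. (c (L 0 \<omega>) * L 0 \<omega>)\<^sup>2 \<partial>M))"
proof (induction n)
  case (Suc n)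
  define S where "S \<omega> = (\<Sum>k<n. c (L k \<omega>) * Xi k \<omega>)" for \<omega>
  define X where "X \<omega> = c (L n \<omega>) * Xi n \<omega>" for \<omega>
  have [measurable]: "X \<in> borel_measurable M" "S \<in> borel_measurable M"
    unfolding X_def S_def by measurable
  have cF: "k \<le> m \<Longrightarrow> (\<lambda>\<omega>. c (L k \<omega>)) \<in> borel_measurable (F m)" for k m
    by (rule measurable_compose[OF L_meas_F_le c_meas])
  have SF: "S \<in> borel_measurable (F n)"
    unfolding S_def by (intro borel_measurable_sum borel_measurable_times cF Xi_meas_F) auto
  have X2: "integrable M (\<lambda>\<omega>. (X \<omega>)\<^sup>2)" unfolding X_def by (rule Xi_sq(1)[OF c_meas c])
  have S2: "integrable M (\<lambda>\<omega>. (S \<omega>)\<^sup>2)" unfolding S_def using Suc.IH by simp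
  have SX: "integrable M (\<lambda>\<omega>. S \<omega> * X \<omega>)"
    by (rule integrable_mult_of_squares[OF _ _ S2 X2]) auto
  have "(\<integral>\<omega>. S \<omega> * X \<omega> \<partial>M) = (\<integral>\<omega>. (\<integral>j. S \<omega> * (c (L n \<omega>) * disp (L n \<omega>) j) \<partial>pois (L n \<omega>)) \<partial>M)"
    unfolding X_def Xi_def
    by (rule kernel_integral(1)[where H="\<lambda>j \<omega>. S \<omega> * (c (L n \<omega>) * disp (L n \<omega>) j)"])
      (use SX in \<open>auto intro!: borel_measurable_times SF cF disp_meas_F simp: X_def Xi_def\<close>)
  also have "\<dots> = (\<integral>\<omega>. 0 \<partial>M)"
    by (intro Bochner_Integration.integral_cong refl) (simp add: disp_moments L_nonneg)
  finally have SX0: "(\<integral>\<omega>. S \<omega> * X \<omega> \<partial>M) = 0" by simp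
  have s: "(\<Sum>k<Suc n. c (L k \<omega>) * Xi k \<omega>)\<^sup>2 = (S \<omega>)\<^sup>2 + 2 * (S \<omega> * X \<omega>) + (X \<omega>)\<^sup>2" for \<omega>
    by (simp add: S_def X_def power2_eq_square algebra_simps)
  have "(\<integral>\<omega>. (X \<omega>)\<^sup>2 \<partial>M) = 2 * (\<integral>\<omega>. (c (L 0 \<omega>) * L 0 \<omega>)\<^sup>2 \<partial>M)"
    unfolding X_def by (rule Xi_sq(2)[OF c_meas c])
  moreover have "(\<integral>\<omega>. (S \<omega>)\<^sup>2 \<partial>M) = real n * (2 * (\<integral>\<omega>. (c (L 0 \<omega>) * L 0 \<omega>)\<^sup>2 \<partial>M))"
    unfolding S_def using Suc.IH by simp
  ultimately show ?case
    unfolding s using X2 S2 SX SX0 by (simp add: distrib_right)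
qed simp

text \<open>The limits in n and in B may be exchanged because the truncation error \<bar>u\<bar> *
  sqrt (2 * r B) is free of n. It tends to 0 by dominated convergence, with the square of
  \<open>L 0\<close> as majorant.\<close>

lemma char_limit:
  "(\<lambda>n. \<integral>\<omega>. iexp (u * (1 / sqrt (real n) * (\<Sum>k<n. Xi k \<omega>))) \<partial>M)
     \<longlonglongrightarrow> complex_of_real (exp (- (u\<^sup>2) * (\<integral>\<omega>. (L 0 \<omega>)\<^sup>2 \<partial>M)))"
proof -
  define v where "v = (\<integral>\<omega>. (L 0 \<omega>)\<^sup>2 \<partial>M)"
  define vB where "vB B = (\<integral>\<omega>. (trunc B (L 0 \<omega>))\<^sup>2 \<partial>M)" for B
  define r where "r B = (\<integral>\<omega>. ((1 - wt B (L 0 \<omega>)) * L 0 \<omega>)\<^sup>2 \<partial>M)" for B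
  define q where "q n = (\<integral>\<omega>. iexp (u * (1 / sqrt (real n) * (\<Sum>k<n. Xi k \<omega>))) \<partial>M)" for n
  define qB where "qB B n = (\<integral>\<omega>. iexp (u / sqrt (real n) * (\<Sum>k<n. wt B (L k \<omega>) * Xi k \<omega>)) \<partial>M)" for B n
  have limB: "qB B \<longlonglongrightarrow> complex_of_real (exp (- (u\<^sup>2) * vB B))" if "0 \<le> B" for B
    using char_trunc_limit[OF that, of u] by (simp add: qB_def[abs_def] vB_def)
  have ptw: "(\<lambda>m. trunc (real m) (L 0 \<omega>)) \<longlonglongrightarrow> L 0 \<omega>" if "\<omega> \<in> space M" for \<omega>
  proof (rule tendsto_eventually)
    obtain m0 :: nat where "L 0 \<omega> \<le> real m0" using real_arch_simple by blast
    then show "\<forall>\<^sub>F m in sequentially. trunc (real m) (L 0 \<omega>) = L 0 \<omega>"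
      using L_nonneg[OF that, of 0] by (intro eventually_sequentiallyI[of m0] trunc_eq) auto
  qed
  have lim_v: "(\<lambda>m. vB (real m)) \<longlonglongrightarrow> v"
    unfolding vB_def v_def
  proof (rule integral_dominated_convergence[OF _ _ integrable_L_sq[of 0]])
    show "AE \<omega> in M. (\<lambda>m. (trunc (real m) (L 0 \<omega>))\<^sup>2) \<longlonglongrightarrow> (L 0 \<omega>)\<^sup>2"
      by (intro AE_I2 tendsto_power ptw)
    show "AE \<omega> in M. norm ((trunc (real m) (L 0 \<omega>))\<^sup>2) \<le> (L 0 \<omega>)\<^sup>2" for m
      using trunc_le[OF L_nonneg] trunc_nonneg by (intro AE_I2) (auto intro!: power_mono)
  qed measurable
  have lim_r: "(\<lambda>m. r (real m)) \<longlonglongrightarrow> 0"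
  proof -
    have r_eq: "r B = (\<integral>\<omega>. (L 0 \<omega> - trunc B (L 0 \<omega>))\<^sup>2 \<partial>M)" for B
      unfolding r_def using wt_mult[OF L_nonneg]
      by (intro Bochner_Integration.integral_cong refl) (simp add: left_diff_distrib)
    have "(\<lambda>m. r (real m)) \<longlonglongrightarrow> (\<integral>\<omega>. 0 \<partial>M)"
      unfolding r_eq
    proof (rule integral_dominated_convergence[OF _ _ integrable_L_sq[of 0]])
      show "AE \<omega> in M. (\<lambda>m. (L 0 \<omega> - trunc (real m) (L 0 \<omega>))\<^sup>2) \<longlonglongrightarrow> 0"
      proof (rule AE_I2)
        fix \<omega> assume "\<omega> \<in> space M"
        from tendsto_power[OF tendsto_diff[OF tendsto_const ptw[OF this]], of "L 0 \<omega>" 2]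
        show "(\<lambda>m. (L 0 \<omega> - trunc (real m) (L 0 \<omega>))\<^sup>2) \<longlonglongrightarrow> 0" by simp
      qed
      show "AE \<omega> in M. norm ((L 0 \<omega> - trunc (real m) (L 0 \<omega>))\<^sup>2) \<le> (L 0 \<omega>)\<^sup>2" for m
        using trunc_le[OF L_nonneg] trunc_nonneg by (intro AE_I2) (auto intro!: power_mono)
    qed measurable
    then show ?thesis by simp
  qed
  have diff: "cmod (q n - qB B n) \<le> \<bar>u\<bar> * sqrt (2 * r B)" if n: "0 < n" for n B
  proof -
    define D where "D \<omega> = (\<Sum>k<n. (1 - wt B (L k \<omega>)) * Xi k \<omega>)" for \<omega>
    have [measurable]: "D \<in> borel_measurable M" unfolding D_def by measurable
    have D: "integrable M (\<lambda>\<omega>. (D \<omega>)\<^sup>2)" "(\<integral>\<omega>. (D \<omega>)\<^sup>2 \<partial>M) = real n * (2 * r B)"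
    proof -
      have "\<bar>1 - wt B l\<bar> \<le> 1" if "0 \<le> l" for l using wt_bounds[OF that, of B] by simp
      with weighted_sum_sq[of "\<lambda>l. 1 - wt B l" n]
      show "integrable M (\<lambda>\<omega>. (D \<omega>)\<^sup>2)" "(\<integral>\<omega>. (D \<omega>)\<^sup>2 \<partial>M) = real n * (2 * r B)"
        unfolding D_def r_def by auto
    qed
    have D1: "integrable M D" by (rule square_integrable_imp_integrable[OF _ D(1)]) measurable
    have int: "integrable M (\<lambda>\<omega>. iexp (X \<omega>))" if [measurable]: "X \<in> borel_measurable M" for X :: "'w \<Rightarrow> real"
      by (intro integrable_const_bound[where B=1]) auto
    have i1: "integrable M (\<lambda>\<omega>. iexp (u * (1 / sqrt (real n) * (\<Sum>k<n. Xi k \<omega>))))"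
      and i2: "integrable M (\<lambda>\<omega>. iexp (u / sqrt (real n) * (\<Sum>k<n. wt B (L k \<omega>) * Xi k \<omega>)))"
      by (intro int; measurable)+
    have "cmod (q n - qB B n) = cmod (\<integral>\<omega>. iexp (u * (1 / sqrt (real n) * (\<Sum>k<n. Xi k \<omega>)))
        - iexp (u / sqrt (real n) * (\<Sum>k<n. wt B (L k \<omega>) * Xi k \<omega>)) \<partial>M)"
      unfolding q_def qB_def Bochner_Integration.integral_diff[OF i1 i2] ..
    also have "\<dots> \<le> (\<integral>\<omega>. \<bar>u\<bar> / sqrt (real n) * \<bar>D \<omega>\<bar> \<partial>M)"
    proof (rule norm_integral_le_integral)
      fix \<omega>
      have "cmod (iexp (u * (1 / sqrt (real n) * (\<Sum>k<n. Xi k \<omega>)))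
          - iexp (u / sqrt (real n) * (\<Sum>k<n. wt B (L k \<omega>) * Xi k \<omega>)))
        \<le> \<bar>u * (1 / sqrt (real n) * (\<Sum>k<n. Xi k \<omega>)) - u / sqrt (real n) * (\<Sum>k<n. wt B (L k \<omega>) * Xi k \<omega>)\<bar>"
        by (rule cmod_iexp_diff)
      also have "\<dots> = \<bar>u / sqrt (real n) * D \<omega>\<bar>"
        by (simp add: D_def sum_subtractf left_diff_distrib diff_divide_distrib right_diff_distrib)
      also have "\<dots> = \<bar>u\<bar> / sqrt (real n) * \<bar>D \<omega>\<bar>" by (simp add: abs_mult)
      finally show "cmod (iexp (u * (1 / sqrt (real n) * (\<Sum>k<n. Xi k \<omega>)))
          - iexp (u / sqrt (real n) * (\<Sum>k<n. wt B (L k \<omega>) * Xi k \<omega>))) \<le> \<bar>u\<bar> / sqrt (real n) * \<bar>D \<omega>\<bar>" .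
    qed (use i1 i2 D1 in auto)
    also have "\<dots> = \<bar>u\<bar> / sqrt (real n) * (\<integral>\<omega>. \<bar>D \<omega>\<bar> \<partial>M)" by simp
    also have "\<dots> \<le> \<bar>u\<bar> / sqrt (real n) * sqrt (real n * (2 * r B))"
      unfolding D(2)[symmetric] by (intro mult_left_mono expectation_abs_le_sqrt D) auto
    also have "\<dots> = \<bar>u\<bar> * sqrt (2 * r B)"
      using n by (simp add: real_sqrt_mult)
    finally show ?thesis .
  qed
  have limE: "(\<lambda>m. complex_of_real (exp (- (u\<^sup>2) * vB (real m)))) \<longlonglongrightarrow> complex_of_real (exp (- (u\<^sup>2) * v))"
    by (intro tendsto_intros lim_v)
  have limR: "(\<lambda>m. \<bar>u\<bar> * sqrt (2 * r (real m))) \<longlonglongrightarrow> 0"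
  proof -
    have "(\<lambda>m. \<bar>u\<bar> * sqrt (2 * r (real m))) \<longlonglongrightarrow> \<bar>u\<bar> * sqrt (2 * 0)"
      by (intro tendsto_intros lim_r)
    then show ?thesis by simp
  qed
  have "q \<longlonglongrightarrow> complex_of_real (exp (- (u\<^sup>2) * v))"
  proof (rule LIMSEQ_I)
    fix e :: real assume e: "0 < e"
    obtain m1 where m1: "\<And>m. m \<ge> m1 \<Longrightarrow> cmod (complex_of_real (exp (- (u\<^sup>2) * vB (real m))) - complex_of_real (exp (- (u\<^sup>2) * v))) < e / 3"
      using LIMSEQ_D[OF limE, of "e / 3"] e by auto
    obtain m2 where m2: "\<And>m. m \<ge> m2 \<Longrightarrow> norm (\<bar>u\<bar> * sqrt (2 * r (real m)) - 0) < e / 3"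
      using LIMSEQ_D[OF limR, of "e / 3"] e by auto
    \<comment> \<open>The level is fixed before n: one B serves both the truncation error and the
      distance of the truncated variance from v.\<close>
    define B where "B = real (max m1 m2)"
    obtain n0 where n0: "\<And>n. n \<ge> n0 \<Longrightarrow> cmod (qB B n - complex_of_real (exp (- (u\<^sup>2) * vB B))) < e / 3"
      using LIMSEQ_D[OF limB[of B], of "e / 3"] e by (auto simp: B_def)
    have b1: "cmod (complex_of_real (exp (- (u\<^sup>2) * vB B)) - complex_of_real (exp (- (u\<^sup>2) * v))) < e / 3"
      unfolding B_def by (rule m1) simp
    have b2: "\<bar>u\<bar> * sqrt (2 * r B) < e / 3"
      using m2[of "max m1 m2"] by (simp only: B_def[symmetric]) auto
    show "\<exists>n0. \<forall>n\<ge>n0. cmod (q n - complex_of_real (exp (- (u\<^sup>2) * v))) < e"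
    proof (intro exI allI impI)
      fix n assume "max 1 n0 \<le> n"
      then have n: "0 < n" "n0 \<le> n" by auto
      have "cmod (q n - complex_of_real (exp (- (u\<^sup>2) * v)))
        \<le> cmod (q n - qB B n) + cmod (qB B n - complex_of_real (exp (- (u\<^sup>2) * vB B)))
          + cmod (complex_of_real (exp (- (u\<^sup>2) * vB B)) - complex_of_real (exp (- (u\<^sup>2) * v)))"
        by (rule norm_diff_triangle_le[OF norm_diff_triangle_le[OF order_refl order_refl] order_refl])
      then show "cmod (q n - complex_of_real (exp (- (u\<^sup>2) * v))) < e"
        using diff[OF n(1), of B] b2 n0[OF n(2)] b1 by linarith
    qed
  qed
  then show ?thesis by (simp add: q_def[abs_def] v_def)
qed

end

subsection \<open>Perturbed recursions\<close>

definition clip :: "real \<Rightarrow> real \<Rightarrow> real" where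
  "clip b x = max (- b) (min b x)"

lemma abs_clip_le: "0 \<le> b \<Longrightarrow> \<bar>clip b x\<bar> \<le> b"
  by (auto simp: clip_def)

text \<open>Projection onto an interval does not move a point away from a target inside the
  interval, so clipping never worsens an approximation of such a target.\<close>

lemma clip_diff_le: "\<bar>y\<bar> \<le> b \<Longrightarrow> \<bar>clip b x - y\<bar> \<le> \<bar>x - y\<bar>"
  by (auto simp: clip_def)

lemma clip_measurable [measurable]: "clip b \<in> borel_measurable borel"
  unfolding clip_def by measurable

text \<open>\<open>pert\<close> tracks the difference of two recursions driven by \<open>h\<close> and \<open>g\<close>, but is reset
  whenever the state is large and clipped to \<open>[-b, b]\<close>; this makes it bounded
  and nonzero only where the intensity is bounded, as needed for an exponential inequality.\<close>

primrec pert :: "(real \<Rightarrow> nat \<Rightarrow> real) \<Rightarrow> (real \<Rightarrow> nat \<Rightarrow> real) \<Rightarrow> real \<Rightarrow> real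
    \<Rightarrow> (nat \<Rightarrow> real) \<Rightarrow> (nat \<Rightarrow> nat) \<Rightarrow> nat \<Rightarrow> real" where
  "pert g h b B l y 0 = 0"
| "pert g h b B l y (Suc k) = (if l k + real (y k) + 1 \<le> B
     then clip b (h (l k + pert g h b B l y k) (y k) - g (l k) (y k)) else 0)"

text \<open>Records the states that trigger a reset in \<open>pert\<close>, discounted by the
  contraction; it pays for the difference thrown away there.\<close>

primrec tail_acc :: "real \<Rightarrow> real \<Rightarrow> (nat \<Rightarrow> real) \<Rightarrow> nat \<Rightarrow> real" where
  "tail_acc \<kappa> B w 0 = 0"
| "tail_acc \<kappa> B w (Suc k) = \<kappa> * tail_acc \<kappa> B w k + (if B < w k then w k else 0)"

lemma abs_pert_le: "0 \<le> b \<Longrightarrow> \<bar>pert g h b B l y k\<bar> \<le> b"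
  by (cases k) (auto simp: abs_clip_le)

text \<open>Contraction discounts every error made earlier. There are three sources: the starting
  values, the distance from h to f at each step, and the resets, which leave a discounted sum of
  exceedances of B.\<close>

lemma pert_approx:
  fixes f g h :: "real \<Rightarrow> nat \<Rightarrow> real"
  assumes \<kappa>: "0 \<le> \<kappa>" "\<kappa> < 1" and a: "0 \<le> a" and B: "0 \<le> B" and \<eta>: "0 \<le> \<eta>"
    and b: "b = a * (B / (1 - \<kappa>))" "b \<le> 1"
    and f_lip: "\<And>x x' i. \<bar>f x i - f x' i\<bar> \<le> \<kappa> * \<bar>x - x'\<bar>"
    and f_near: "\<And>x i. 0 \<le> x \<Longrightarrow> \<bar>f x i - g x i\<bar> \<le> a * (x + real i + 1)"
    and h_near: "\<And>x i. x \<le> B + 1 \<Longrightarrow> real i \<le> B \<Longrightarrow> \<bar>h x i - f x i\<bar> \<le> 2 * a * \<eta>"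
    and l: "\<And>k. 0 \<le> l k" "\<And>k. l (Suc k) = g (l k) (y k)"
    and lh: "\<And>k. lh (Suc k) = f (lh k) (y k)"
  shows "\<bar>lh k - l k - pert g h b B l y k\<bar>
    \<le> \<kappa> ^ k * \<bar>lh 0 - l 0\<bar> + 2 * a * \<eta> / (1 - \<kappa>) + a / (1 - \<kappa>) * tail_acc \<kappa> B (\<lambda>k. l k + real (y k) + 1) k"
proof (induction k)
  case 0
  show ?case using \<kappa> a \<eta> by simp
next
  case (Suc k)
  define d where "d = pert g h b B l y k"
  define S where "S = tail_acc \<kappa> B (\<lambda>k. l k + real (y k) + 1) k"
  define w where "w = l k + real (y k) + 1"
  define e where "e = \<bar>lh k - l k - d\<bar>"
  define r where "r = 1 / (1 - \<kappa>)"
  have r: "0 < r" "\<kappa> * r + 1 = r" using \<kappa> by (auto simp: r_def field_simps)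
  have b0: "0 \<le> b" using b a B \<kappa> by simp
  have b_eq: "b = a * B * r" using b by (simp add: r_def)
  have db: "\<bar>d\<bar> \<le> b" unfolding d_def by (rule abs_pert_le[OF b0])
  have step: "\<bar>lh (Suc k) - l (Suc k) - pert g h b B l y (Suc k)\<bar> \<le> \<kappa> * e + 2 * a * \<eta> + a * r * (if B < w then w else 0)"
  proof (cases "w \<le> B")
    case True
    define x where "x = l k + d"
    \<comment> \<open>The hypothesis b \<le> 1 keeps the perturbed intensity inside the range on
      which h approximates f.\<close>
    have x: "x \<le> B + 1" and yB: "real (y k) \<le> B"
      using True db b(2) l(1)[of k] by (auto simp: x_def w_def)
    have "\<bar>f x (y k) - g (l k) (y k)\<bar> \<le> \<bar>f x (y k) - f (l k) (y k)\<bar> + \<bar>f (l k) (y k) - g (l k) (y k)\<bar>"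
      by linarith
    also have "\<dots> \<le> \<kappa> * \<bar>d\<bar> + a * w"
      using f_lip[of x "y k" "l k"] f_near[OF l(1), of k "y k"] by (simp add: x_def w_def)
    also have "\<dots> \<le> \<kappa> * b + a * B"
      using \<kappa> a True db by (intro add_mono mult_left_mono) auto
    \<comment> \<open>The bound b is the fixed point of the map taking b to \<kappa> * b + a * B, so
      the step driven by f itself stays within the clipping range.\<close>
    also have "\<dots> = a * B * (\<kappa> * r + 1)" by (simp add: b_eq algebra_simps)
    also have "\<dots> = b" by (simp only: r b_eq)
    finally have in_range: "\<bar>f x (y k) - g (l k) (y k)\<bar> \<le> b" .
    have p: "pert g h b B l y (Suc k) = clip b (h x (y k) - g (l k) (y k))"
      using True by (simp add: w_def x_def d_def)
    have "\<bar>pert g h b B l y (Suc k) - (f x (y k) - g (l k) (y k))\<bar> \<le> \<bar>h x (y k) - f x (y k)\<bar>"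
      unfolding p using clip_diff_le[OF in_range, of "h x (y k) - g (l k) (y k)"] by simp
    also have "\<dots> \<le> 2 * a * \<eta>" by (rule h_near[OF x yB])
    finally have 1: "\<bar>pert g h b B l y (Suc k) - (f x (y k) - g (l k) (y k))\<bar> \<le> 2 * a * \<eta>" .
    have "\<bar>f (lh k) (y k) - f x (y k)\<bar> \<le> \<kappa> * \<bar>lh k - x\<bar>" by (rule f_lip)
    also have "\<bar>lh k - x\<bar> = e" by (simp add: e_def x_def algebra_simps)
    finally have 2: "\<bar>f (lh k) (y k) - f x (y k)\<bar> \<le> \<kappa> * e" .
    show ?thesis using 1 2 True unfolding l(2) lh by simp
  next
    case False
    have p: "pert g h b B l y (Suc k) = 0" using False by (simp add: w_def)
    have "\<bar>lh (Suc k) - l (Suc k)\<bar> \<le> \<bar>f (lh k) (y k) - f (l k) (y k)\<bar> + \<bar>f (l k) (y k) - g (l k) (y k)\<bar>"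
      unfolding l(2) lh by linarith
    also have "\<dots> \<le> \<kappa> * \<bar>lh k - l k\<bar> + a * w"
      using f_lip[of "lh k" "y k" "l k"] f_near[OF l(1), of k "y k"] by (simp add: w_def)
    also have "\<dots> \<le> \<kappa> * (e + b) + a * w"
      using \<kappa> a db by (intro add_mono mult_left_mono) (auto simp: e_def)
    also have "\<dots> = \<kappa> * e + a * (\<kappa> * r * B + w)" by (simp add: b_eq algebra_simps)
    \<comment> \<open>A reset discards a perturbation of size at most b = a * B * r; since B < w,
      this loss too is charged to the large state w.\<close>
    also have "a * (\<kappa> * r * B + w) \<le> a * (\<kappa> * r * w + w)"
      using False \<kappa> r(1) a by (intro mult_left_mono add_mono) auto
    also have "\<dots> = a * w * (\<kappa> * r + 1)" by (simp add: algebra_simps)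
    also have "\<dots> = a * r * w" by (simp add: r(2))
    finally have "\<bar>lh (Suc k) - l (Suc k)\<bar> \<le> \<kappa> * e + a * r * w" by simp
    moreover have "0 \<le> 2 * a * \<eta>" using a \<eta> by simp
    ultimately have "\<bar>lh (Suc k) - l (Suc k)\<bar> \<le> \<kappa> * e + 2 * a * \<eta> + a * r * w" by linarith
    then show ?thesis using False by (simp add: p del: pert.simps)
  qed
  have e_le: "\<kappa> * e \<le> \<kappa> * (\<kappa> ^ k * \<bar>lh 0 - l 0\<bar> + 2 * a * \<eta> * r + a * r * S)"
    using Suc.IH \<kappa>(1) by (intro mult_left_mono) (simp_all add: e_def d_def S_def r_def)
  have "\<bar>lh (Suc k) - l (Suc k) - pert g h b B l y (Suc k)\<bar>
      \<le> \<kappa> * (\<kappa> ^ k * \<bar>lh 0 - l 0\<bar> + 2 * a * \<eta> * r + a * r * S) + 2 * a * \<eta> + a * r * (if B < w then w else 0)"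
    using step e_le by linarith
  also have "\<dots> = \<kappa> ^ Suc k * \<bar>lh 0 - l 0\<bar> + 2 * a * \<eta> * (\<kappa> * r + 1) + a * r * (\<kappa> * S + (if B < w then w else 0))"
    by (simp add: algebra_simps)
  also have "\<dots> = \<kappa> ^ Suc k * \<bar>lh 0 - l 0\<bar> + 2 * a * \<eta> * r + a * r * tail_acc \<kappa> B (\<lambda>k. l k + real (y k) + 1) (Suc k)"
    by (simp only: r(2)) (simp add: S_def w_def)
  finally show ?case by (simp add: r_def)
qed

text \<open>A finite net, in the supremum norm on \<open>(-\<infinity>, B + 1] \<times> {0..B}\<close>, of the functions that
  are \<open>\<kappa>\<close>-Lipschitz in the first argument and lie in a band of relative width \<open>a\<close> around \<open>g\<close>.
  Its logarithmic size is of order \<open>1/a\<close>.\<close>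

definition net_fun :: "(real \<Rightarrow> nat \<Rightarrow> real) \<Rightarrow> real \<Rightarrow> (nat \<times> nat \<Rightarrow> int) \<Rightarrow> real \<Rightarrow> nat \<Rightarrow> real" where
  "net_fun g \<delta> m x i = g (\<delta> * real (nat \<lfloor>x / \<delta>\<rfloor>)) i + \<delta> * of_int (m (nat \<lfloor>x / \<delta>\<rfloor>, i))"

definition net_index :: "real \<Rightarrow> real \<Rightarrow> real \<Rightarrow> (nat \<times> nat \<Rightarrow> int) set" where
  "net_index \<delta> \<eta> B = ({..nat \<lfloor>(B + 1) / \<delta>\<rfloor>} \<times> {..nat \<lfloor>B\<rfloor>}) \<rightarrow>\<^sub>E {- \<lceil>(2 * B + 2) / \<eta>\<rceil> - 1 .. \<lceil>(2 * B + 2) / \<eta>\<rceil> + 1}"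

lemma finite_net_index: "finite (net_index \<delta> \<eta> B)"
  unfolding net_index_def by (intro finite_PiE) auto

text \<open>The number of values per cell depends on B and \<eta> only, and the number of cells is
  linear in 1 / \<delta>. For \<delta> proportional to 1 / sqrt n the exponent is thus of order sqrt
  n.\<close>

lemma card_net_index_le:
  assumes "0 < \<delta>" "0 < \<eta>" "0 \<le> B"
  shows "real (card (net_index \<delta> \<eta> B))
    \<le> exp (ln (2 * ((2 * B + 2) / \<eta> + 1) + 3) * ((B + 1) * ((B + 1) / \<delta> + 1)))"
proof -
  define c where "c = \<lceil>(2 * B + 2) / \<eta>\<rceil>"
  define V where "V = 2 * ((2 * B + 2) / \<eta> + 1) + 3"
  define I where "I = nat \<lfloor>(B + 1) / \<delta>\<rfloor>"
  define J where "J = nat \<lfloor>B\<rfloor>"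
  have "0 \<le> (2 * B + 2) / \<eta>" using assms by simp
  then have c: "0 \<le> c" "real_of_int c \<le> (2 * B + 2) / \<eta> + 1"
    unfolding c_def by (linarith, linarith)
  have V: "1 \<le> V" unfolding V_def using assms by simp
  have card: "card (net_index \<delta> \<eta> B) = nat (2 * c + 3) ^ (Suc I * Suc J)"
    unfolding net_index_def c_def[symmetric] I_def[symmetric] J_def[symmetric]
    by (subst card_PiE) (auto simp: card_cartesian_product algebra_simps)
  have IJ: "real (Suc I * Suc J) \<le> (B + 1) * ((B + 1) / \<delta> + 1)"
  proof -
    have "real (Suc J) \<le> B + 1" "real (Suc I) \<le> (B + 1) / \<delta> + 1"
      using assms by (auto simp: I_def J_def of_nat_nat)
    then have "real (Suc J) * real (Suc I) \<le> (B + 1) * ((B + 1) / \<delta> + 1)"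
      using assms by (intro mult_mono) auto
    then show ?thesis by (simp only: of_nat_mult mult.commute)
  qed
  have "real (nat (2 * c + 3)) \<le> V"
  proof -
    have eq: "real (nat (2 * c + 3)) = 2 * real_of_int c + 3" using c(1) by simp
    show ?thesis unfolding V_def eq by (intro add_mono mult_left_mono c(2)) auto
  qed
  then have "real (card (net_index \<delta> \<eta> B)) \<le> V ^ (Suc I * Suc J)"
    unfolding card of_nat_power by (intro power_mono) auto
  also have "\<dots> = exp (ln V * real (Suc I * Suc J))"
    using V by (simp add: exp_of_nat2_mult del: of_nat_Suc of_nat_mult mult_Suc mult_Suc_right)
  also have "\<dots> \<le> exp (ln V * ((B + 1) * ((B + 1) / \<delta> + 1)))"
    using V IJ by (simp add: mult_left_mono del: of_nat_Suc of_nat_mult mult_Suc mult_Suc_right)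
  finally show ?thesis by (simp add: V_def)
qed

text \<open>The difference f - g at the left end of a cell is rounded to a multiple of the mesh a *
  \<eta>. Rounding costs one mesh and moving x to the grid point at most another. As the band around
  g has width proportional to a, the integers needed are bounded by (2 * B + 2) / \<eta>,
  independently of a.\<close>

lemma net_covers:
  fixes f g :: "real \<Rightarrow> nat \<Rightarrow> real"
  assumes a: "0 < a" and \<eta>: "0 < \<eta>" and B: "0 \<le> B" and \<kappa>: "0 \<le> \<kappa>" "\<kappa> < 1"
    and f_lip: "\<And>x x' i. \<bar>f x i - f x' i\<bar> \<le> \<kappa> * \<bar>x - x'\<bar>"
    and f_neg: "\<And>x i. x \<le> 0 \<Longrightarrow> f x i = f 0 i"
    and f_near: "\<And>x i. 0 \<le> x \<Longrightarrow> \<bar>f x i - g x i\<bar> \<le> a * (x + real i + 1)"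
  shows "\<exists>m\<in>net_index (a * \<eta>) \<eta> B. \<forall>x i. x \<le> B + 1 \<longrightarrow> real i \<le> B \<longrightarrow>
    \<bar>net_fun g (a * \<eta>) m x i - f x i\<bar> \<le> 2 * a * \<eta>"
proof -
  define \<delta> where "\<delta> = a * \<eta>"
  have \<delta>: "0 < \<delta>" using a \<eta> by (simp add: \<delta>_def)
  define p where "p q = (f (\<delta> * real (fst q)) (snd q) - g (\<delta> * real (fst q)) (snd q)) / \<delta>" for q :: "nat \<times> nat"
  define R where "R = {..nat \<lfloor>(B + 1) / \<delta>\<rfloor>} \<times> {..nat \<lfloor>B\<rfloor>}"
  define m where "m = restrict (\<lambda>q. \<lfloor>p q\<rfloor>) R"
  have p_bound: "\<bar>p q\<bar> \<le> (2 * B + 2) / \<eta>" if "q \<in> R" for q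
  proof -
    obtain i j where q: "q = (i, j)" by (cases q)
    have "real i \<le> (B + 1) / \<delta>" "real j \<le> B"
      using that B \<delta> unfolding q R_def by (auto simp: le_nat_iff le_floor_iff)
    then have ij: "\<delta> * real i \<le> B + 1" "real j \<le> B" using \<delta> by (auto simp: field_simps)
    have "\<bar>f (\<delta> * real i) j - g (\<delta> * real i) j\<bar> \<le> a * (\<delta> * real i + real j + 1)"
      using \<delta> by (intro f_near) auto
    also have "\<dots> \<le> a * (2 * B + 2)" using ij a by (intro mult_left_mono) auto
    finally have "\<bar>p q\<bar> \<le> a * (2 * B + 2) / \<delta>"
      using \<delta> by (simp add: p_def q abs_divide divide_right_mono)
    also have "\<dots> = (2 * B + 2) / \<eta>" using a by (simp add: \<delta>_def)
    finally show ?thesis .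
  qed
  have "m \<in> net_index \<delta> \<eta> B"
    unfolding net_index_def R_def[symmetric] m_def
  proof (rule restrict_PiE_iff[THEN iffD2], rule ballI)
    fix q assume "q \<in> R"
    from p_bound[OF this] have "p q \<le> (2 * B + 2) / \<eta>" "- ((2 * B + 2) / \<eta>) \<le> p q" by (auto simp: abs_le_iff)
    then show "\<lfloor>p q\<rfloor> \<in> {- \<lceil>(2 * B + 2) / \<eta>\<rceil> - 1 .. \<lceil>(2 * B + 2) / \<eta>\<rceil> + 1}"
      by (simp add: atLeastAtMost_iff) linarith
  qed
  moreover have "\<bar>net_fun g \<delta> m x i - f x i\<bar> \<le> 2 * \<delta>" if x: "x \<le> B + 1" and i: "real i \<le> B" for x i
  proof -
    define k where "k = nat \<lfloor>x / \<delta>\<rfloor>"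
    have "(k, i) \<in> R"
      unfolding R_def k_def using x i \<delta>
      by (auto intro!: nat_mono floor_mono divide_right_mono simp: le_nat_floor)
    then have m: "m (k, i) = \<lfloor>p (k, i)\<rfloor>" by (simp add: m_def)
    have "\<bar>p (k, i) - of_int \<lfloor>p (k, i)\<rfloor>\<bar> \<le> 1" by linarith
    then have "\<delta> * \<bar>p (k, i) - of_int \<lfloor>p (k, i)\<rfloor>\<bar> \<le> \<delta> * 1" using \<delta> by (intro mult_left_mono) auto
    moreover have "\<delta> * \<bar>p (k, i) - of_int \<lfloor>p (k, i)\<rfloor>\<bar>
        = \<bar>f (\<delta> * real k) i - g (\<delta> * real k) i - \<delta> * of_int \<lfloor>p (k, i)\<rfloor>\<bar>"
    proof -
      have "\<delta> * \<bar>p (k, i) - of_int \<lfloor>p (k, i)\<rfloor>\<bar> = \<bar>\<delta> * (p (k, i) - of_int \<lfloor>p (k, i)\<rfloor>)\<bar>"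
        using \<delta> by (simp add: abs_mult)
      also have "\<delta> * (p (k, i) - of_int \<lfloor>p (k, i)\<rfloor>) = f (\<delta> * real k) i - g (\<delta> * real k) i - \<delta> * of_int \<lfloor>p (k, i)\<rfloor>"
      proof -
        have "\<delta> * (X / \<delta> - z) = X - \<delta> * z" for X z using \<delta> by (simp add: field_simps)
        then show ?thesis by (simp only: p_def fst_conv snd_conv)
      qed
      finally show ?thesis .
    qed
    ultimately have 1: "\<bar>f (\<delta> * real k) i - net_fun g \<delta> m x i\<bar> \<le> \<delta>"
      by (simp add: net_fun_def k_def[symmetric] m algebra_simps)
    \<comment> \<open>Negative x fall into cell 0 because \<open>nat\<close> cuts off negative
      integers. There f is constant, so x may be replaced by \<open>max 0 x\<close>
      throughout.\<close>
    have xk: "\<bar>max 0 x - \<delta> * real k\<bar> \<le> \<delta>"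
    proof (cases "0 \<le> x")
      case True
      then have "real k = of_int \<lfloor>x / \<delta>\<rfloor>" using \<delta> by (simp add: k_def)
      moreover have "\<bar>x / \<delta> - of_int \<lfloor>x / \<delta>\<rfloor>\<bar> \<le> 1" by linarith
      ultimately have "\<delta> * \<bar>x / \<delta> - real k\<bar> \<le> \<delta> * 1" using \<delta> by (intro mult_left_mono) auto
      moreover have "\<delta> * \<bar>x / \<delta> - real k\<bar> = \<bar>\<delta> * (x / \<delta> - real k)\<bar>" using \<delta> by (simp add: abs_mult)
      moreover have "\<delta> * (x / \<delta> - real k) = x - \<delta> * real k" using \<delta> by (simp add: right_diff_distrib)
      ultimately show ?thesis using True by simp
    next
      case False
      then have "k = 0" using \<delta> by (simp add: k_def divide_less_0_iff floor_le_zero less_imp_le)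
      then show ?thesis using False \<delta> by simp
    qed
    have "f x i = f (max 0 x) i" using f_neg[of x i] by (cases "0 \<le> x") auto
    then have "\<bar>f x i - f (\<delta> * real k) i\<bar> \<le> \<kappa> * \<bar>max 0 x - \<delta> * real k\<bar>" using f_lip by simp
    also have "\<dots> \<le> 1 * \<delta>" using \<kappa> xk by (intro mult_mono) auto
    finally show ?thesis using 1 by linarith
  qed
  ultimately show ?thesis unfolding \<delta>_def by (intro bexI[of _ m]) (auto simp: mult.assoc)
qed

text \<open>Completing the square gives p * sqrt n \<le> (c / 2) * n + p^2 / (2 * c), so half of the
  linear exponent survives.\<close>

lemma subexp_times_exp_tendsto_0:
  fixes c :: real
  assumes c: "0 < c"
  shows "(\<lambda>n. exp (p * sqrt (real n) + q) * (2 * exp (- c * real n))) \<longlonglongrightarrow> 0"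
proof (rule tendsto_sandwich[OF _ _ tendsto_const])
  define K where "K = 2 * exp (q + p\<^sup>2 / (2 * c))"
  have "(\<lambda>n. K * exp (- (c / 2)) ^ n) \<longlonglongrightarrow> K * 0"
    using c by (intro tendsto_intros LIMSEQ_power_zero) simp
  then show "(\<lambda>n. K * exp (- (c / 2)) ^ n) \<longlonglongrightarrow> 0" by simp
  have "exp (p * sqrt (real n) + q) * (2 * exp (- c * real n)) \<le> K * exp (- (c / 2)) ^ n" for n
  proof -
    have "0 \<le> (c * sqrt (real n) - p)\<^sup>2 / (2 * c)" using c by simp
    also have "\<dots> = (c / 2) * real n + p\<^sup>2 / (2 * c) - p * sqrt (real n)"
    proof -
      have "(c * sqrt (real n) - p)\<^sup>2 = c * (c * real n) + p\<^sup>2 - 2 * c * (p * sqrt (real n))"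
        by (simp add: power2_diff power_mult_distrib) (simp add: power2_eq_square)
      then show ?thesis using c by (simp add: add_divide_distrib diff_divide_distrib)
    qed
    finally have "p * sqrt (real n) + q + - c * real n \<le> (q + p\<^sup>2 / (2 * c)) + real n * (- (c / 2))"
      by (simp add: algebra_simps)
    then have le: "exp (p * sqrt (real n) + q) * exp (- c * real n) \<le> exp (q + p\<^sup>2 / (2 * c)) * exp (real n * (- (c / 2)))"
      by (simp only: exp_add[symmetric] exp_le_cancel_iff)
    have "exp (p * sqrt (real n) + q) * (2 * exp (- c * real n)) = 2 * (exp (p * sqrt (real n) + q) * exp (- c * real n))"
      by (simp only: mult.left_commute)
    also have "\<dots> \<le> 2 * (exp (q + p\<^sup>2 / (2 * c)) * exp (real n * (- (c / 2))))"
      by (intro mult_left_mono le) simp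
    also have "\<dots> = K * exp (- (c / 2)) ^ n"
      by (simp only: K_def exp_of_nat_mult mult.assoc)
    finally show ?thesis .
  qed
  then show "\<forall>\<^sub>F n in sequentially. exp (p * sqrt (real n) + q) * (2 * exp (- c * real n)) \<le> K * exp (- (c / 2)) ^ n"
    by simp
qed simp

section \<open>Exponential inequality for the reset perturbation\<close>

context poisson_chain
begin

definition eps :: "nat \<Rightarrow> 'w \<Rightarrow> real" where
  "eps k \<omega> = real (Y k \<omega>) - L k \<omega>"

definition wgt :: "nat \<Rightarrow> 'w \<Rightarrow> real" where
  "wgt k \<omega> = L k \<omega> + real (Y k \<omega>) + 1"

lemma eps_measurable [measurable]: "eps k \<in> borel_measurable M"
  unfolding eps_def by measurable

lemma wgt_measurable [measurable]: "wgt k \<in> borel_measurable M"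
  unfolding wgt_def by measurable

lemma eps_meas_F: "k < n \<Longrightarrow> eps k \<in> borel_measurable (F n)"
  unfolding eps_def
  by (intro borel_measurable_diff L_meas_F_le measurable_compose[OF Y_meas_F_le]) auto

abbreviation pertp :: "(real \<Rightarrow> nat \<Rightarrow> real) \<Rightarrow> real \<Rightarrow> real \<Rightarrow> nat \<Rightarrow> 'w \<Rightarrow> real" where
  "pertp h b B k \<omega> \<equiv> pert g h b B (\<lambda>k. L k \<omega>) (\<lambda>k. Y k \<omega>) k"

text \<open>Predictability: the value at \<open>Suc k\<close> is computed from time k. For a fixed h
  this makes \<open>eps k\<close> times the perturbation a martingale difference, which fails for
  the recursion driven by the estimator itself.\<close>

lemma pertp_meas_F:
  assumes h: "\<And>i. (\<lambda>x. h x i) \<in> borel_measurable borel"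
  shows "pertp h b B k \<in> borel_measurable (F k)"
proof (induction k)
  case (Suc k)
  have IH: "pertp h b B k \<in> borel_measurable (F (Suc k))"
    by (rule measurable_F_mono[OF _ Suc.IH]) simp
  have l: "L k \<in> borel_measurable (F (Suc k))" by (rule L_meas_F_le) simp
  have hm: "(\<lambda>\<omega>. h (L k \<omega> + pertp h b B k \<omega>) i) \<in> borel_measurable (F (Suc k))" for i
    by (rule measurable_compose[OF borel_measurable_add[OF l IH] h])
  have gm: "(\<lambda>\<omega>. g (L k \<omega>) i) \<in> borel_measurable (F (Suc k))" for i
    by (rule measurable_compose[OF l g_measurable])
  have "(\<lambda>\<omega>. if L k \<omega> + real i + 1 \<le> B then clip b (h (L k \<omega> + pertp h b B k \<omega>) i - g (L k \<omega>) i) else 0)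
      \<in> borel_measurable (F (Suc k))" for i
  proof (intro measurable_If)
    show "(\<lambda>\<omega>. clip b (h (L k \<omega> + pertp h b B k \<omega>) i - g (L k \<omega>) i)) \<in> borel_measurable (F (Suc k))"
      by (rule measurable_compose[OF borel_measurable_diff[OF hm gm] clip_measurable])
    show "{\<omega> \<in> space (F (Suc k)). L k \<omega> + real i + 1 \<le> B} \<in> sets (F (Suc k))"
      by (intro borel_measurable_le borel_measurable_add l borel_measurable_const)
  qed simp
  from measurable_compose_countable[OF this Y_meas_F] show ?case by simp
qed simp

lemma pertp_measurable:
  "(\<And>i. (\<lambda>x. h x i) \<in> borel_measurable borel) \<Longrightarrow> pertp h b B k \<in> borel_measurable M"
  by (rule measurable_F_M[OF pertp_meas_F])

lemma net_fun_measurable: "(\<lambda>x. net_fun g \<delta> m x i) \<in> borel_measurable borel"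
proof -
  define \<phi> where "\<phi> k = g (\<delta> * real k) i + \<delta> * of_int (m (k, i))" for k
  have "(\<lambda>x::real. \<phi> (nat \<lfloor>x / \<delta>\<rfloor>)) \<in> borel_measurable borel" by measurable
  then show ?thesis unfolding net_fun_def \<phi>_def .
qed

lemma AE_rec: "AE \<omega> in M. \<forall>k. L (Suc k) \<omega> = g (L k \<omega>) (Y k \<omega>)"
  using rec by (simp add: AE_all_countable)

text \<open>A nonzero value means that the previous state passed the test against B, and linear
  growth of g then bounds the current rate. This is the purpose of the reset.\<close>

lemma AE_pertp_support:
  assumes B: "0 \<le> B"
  shows "AE \<omega> in M. pertp h b B n \<omega> \<noteq> 0 \<longrightarrow> L n \<omega> \<le> g 0 0 + B"
  using AE_rec AE_space
proof eventually_elim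
  case (elim \<omega>)
  show ?case
  proof (cases n)
    case (Suc k)
    show ?thesis
    proof
      assume "pertp h b B n \<omega> \<noteq> 0"
      then have w: "L k \<omega> + real (Y k \<omega>) + 1 \<le> B" by (auto simp: Suc split: if_splits)
      have l: "0 \<le> L k \<omega>" using elim L_nonneg by simp
      have "L n \<omega> \<le> g 0 0 + \<kappa>1 * L k \<omega> + \<kappa>2 * real (Y k \<omega>)"
        using elim g_le[OF l] by (simp add: Suc)
      also have "\<dots> \<le> g 0 0 + 1 * L k \<omega> + 1 * real (Y k \<omega>)"
        using kappa_nonneg kappa_sum l by (intro add_mono mult_right_mono) auto
      finally show "L n \<omega> \<le> g 0 0 + B" using w by simp
    qed
  qed simp
qed

text \<open>The last factor is averaged first. Where the perturbation is 0 this factor is 1;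
  elsewhere the rate is at most g 0 0 + B and the exponent parameter at most 1 in modulus, so the
  centred Poisson bound applies. With nonnegative integrals, finiteness is a result of the
  induction.\<close>

lemma exp_moment_pertp:
  assumes h: "\<And>i. (\<lambda>x. h x i) \<in> borel_measurable borel"
    and b: "0 \<le> b" and s: "\<bar>s\<bar> * b \<le> 1" and B: "0 \<le> B"
  shows "(\<integral>\<^sup>+\<omega>. ennreal (exp (s * (\<Sum>k<n. eps k \<omega> * pertp h b B k \<omega>))) \<partial>M)
    \<le> ennreal (exp (real n * ((g 0 0 + B) * (s * b)\<^sup>2)))"
proof (induction n)
  case (Suc n)
  define Z where "Z \<omega> = exp (s * (\<Sum>k<n. eps k \<omega> * pertp h b B k \<omega>))" for \<omega>
  define a where "a \<omega> = s * pertp h b B n \<omega>" for \<omega>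
  define E where "E = exp ((g 0 0 + B) * (s * b)\<^sup>2)"
  have aF: "a \<in> borel_measurable (F n)"
    unfolding a_def by (intro borel_measurable_times borel_measurable_const pertp_meas_F h)
  have SF: "(\<lambda>\<omega>. \<Sum>k<n. eps k \<omega> * pertp h b B k \<omega>) \<in> borel_measurable (F n)"
    by (intro borel_measurable_sum borel_measurable_times eps_meas_F measurable_F_mono[OF _ pertp_meas_F[OF h]]) auto
  have ZF: "Z \<in> borel_measurable (F n)"
    unfolding Z_def
    by (rule measurable_compose[OF borel_measurable_times[OF borel_measurable_const SF] borel_measurable_exp])
  have eF: "(\<lambda>\<omega>. exp (a \<omega> * (real j - L n \<omega>))) \<in> borel_measurable (F n)" for j
    by (rule measurable_compose[OF borel_measurable_times[OF aF
            borel_measurable_diff[OF borel_measurable_const L_meas_F]] borel_measurable_exp])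
  have HF: "(\<lambda>\<omega>. ennreal (Z \<omega>) * ennreal (exp (a \<omega> * (real j - L n \<omega>)))) \<in> borel_measurable (F n)" for j
    by (rule borel_measurable_times_ennreal[OF measurable_compose[OF ZF measurable_ennreal]
          measurable_compose[OF eF measurable_ennreal]])
  have [measurable]: "Z \<in> borel_measurable M" "a \<in> borel_measurable M"
    by (rule measurable_F_M[OF ZF], rule measurable_F_M[OF aF])
  have "(\<integral>\<^sup>+\<omega>. ennreal (exp (s * (\<Sum>k<Suc n. eps k \<omega> * pertp h b B k \<omega>))) \<partial>M)
      = (\<integral>\<^sup>+\<omega>. ennreal (Z \<omega>) * ennreal (exp (a \<omega> * (real (Y n \<omega>) - L n \<omega>))) \<partial>M)"
    by (intro nn_integral_cong)
      (simp add: Z_def a_def eps_def ennreal_mult[symmetric] exp_add[symmetric] algebra_simps del: pert.simps)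
  also have "\<dots> = (\<integral>\<^sup>+\<omega>. (\<integral>\<^sup>+j. ennreal (Z \<omega>) * ennreal (exp (a \<omega> * (real j - L n \<omega>))) \<partial>pois (L n \<omega>)) \<partial>M)"
    by (rule kernel_nn_integral[OF HF])
  also have "\<dots> \<le> (\<integral>\<^sup>+\<omega>. ennreal (Z \<omega>) * ennreal E \<partial>M)"
  proof (rule nn_integral_mono_AE)
    show "AE \<omega> in M. (\<integral>\<^sup>+j. ennreal (Z \<omega>) * ennreal (exp (a \<omega> * (real j - L n \<omega>))) \<partial>pois (L n \<omega>)) \<le> ennreal (Z \<omega>) * ennreal E"
      using AE_pertp_support[OF B, of h b n] AE_space
    proof eventually_elim
      case (elim \<omega>)
      then have l: "0 \<le> L n \<omega>" using L_nonneg by simp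
      have "\<bar>a \<omega>\<bar> \<le> \<bar>s\<bar> * b"
        unfolding a_def abs_mult by (intro mult_left_mono abs_pert_le b) auto
      then have a1: "\<bar>a \<omega>\<bar> \<le> 1" and a2: "(a \<omega>)\<^sup>2 \<le> (s * b)\<^sup>2"
        using s b by (auto simp: abs_le_square_iff[symmetric] abs_mult)
      have "L n \<omega> * (a \<omega>)\<^sup>2 \<le> (g 0 0 + B) * (s * b)\<^sup>2"
      proof (cases "pertp h b B n \<omega> = 0")
        case True
        then show ?thesis using g_nonneg[of 0 0] B by (simp add: a_def)
      next
        case False
        then show ?thesis using elim a2 l B g_nonneg[of 0 0] by (intro mult_mono) auto
      qed
      then have "exp (L n \<omega> * (a \<omega>)\<^sup>2) \<le> E" by (simp add: E_def)
      then have le: "(\<integral>j. exp (a \<omega> * (real j - L n \<omega>)) \<partial>pois (L n \<omega>)) \<le> E"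
        using integral_pois_exp_centered_le(1)[OF l a1] by linarith
      have "(\<integral>\<^sup>+j. ennreal (Z \<omega>) * ennreal (exp (a \<omega> * (real j - L n \<omega>))) \<partial>pois (L n \<omega>))
          = ennreal (Z \<omega>) * (\<integral>\<^sup>+j. ennreal (exp (a \<omega> * (real j - L n \<omega>))) \<partial>pois (L n \<omega>))"
        by (intro nn_integral_cmult) auto
      also have "(\<integral>\<^sup>+j. ennreal (exp (a \<omega> * (real j - L n \<omega>))) \<partial>pois (L n \<omega>))
          = ennreal (\<integral>j. exp (a \<omega> * (real j - L n \<omega>)) \<partial>pois (L n \<omega>))"
        by (intro nn_integral_eq_integral integral_pois_exp_centered_le(2)[OF l a1]) auto
      finally show ?case using le by (simp add: mult_left_mono ennreal_leI)
    qed
  qed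
  also have "\<dots> = ennreal E * (\<integral>\<^sup>+\<omega>. ennreal (Z \<omega>) \<partial>M)"
    by (subst nn_integral_multc) (auto simp: mult.commute)
  also have "\<dots> \<le> ennreal E * ennreal (exp (real n * ((g 0 0 + B) * (s * b)\<^sup>2)))"
    unfolding Z_def by (intro mult_left_mono Suc.IH) auto
  also have "\<dots> = ennreal (exp (real (Suc n) * ((g 0 0 + B) * (s * b)\<^sup>2)))"
    by (simp add: E_def ennreal_mult[symmetric] exp_add[symmetric] algebra_simps)
  finally show ?case .
qed (simp add: emeasure_space_1)

text \<open>Chernoff's bound, with both signs r treated alike. The parameter s stays free, to be
  chosen proportional to sqrt n.\<close>

lemma exp_tail_pertp:
  assumes h: "\<And>i. (\<lambda>x. h x i) \<in> borel_measurable borel"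
    and b: "0 \<le> b" and s: "0 \<le> s" "s * b \<le> 1" and B: "0 \<le> B"
  shows "prob {\<omega>\<in>space M. x < \<bar>\<Sum>k<n. eps k \<omega> * pertp h b B k \<omega>\<bar>}
    \<le> 2 * exp (real n * ((g 0 0 + B) * (s * b)\<^sup>2) - s * x)"
proof -
  define S where "S \<omega> = (\<Sum>k<n. eps k \<omega> * pertp h b B k \<omega>)" for \<omega>
  define V where "V = real n * ((g 0 0 + B) * (s * b)\<^sup>2)"
  have [measurable]: "pertp h b B k \<in> borel_measurable M" for k by (rule pertp_measurable[OF h])
  have S_meas [measurable]: "S \<in> borel_measurable M" unfolding S_def by measurable
  have half: "prob {\<omega>\<in>space M. x < r * S \<omega>} \<le> exp (V - s * x)" if r: "r = 1 \<or> r = -1" for r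
  proof -
    have V_eq: "real n * ((g 0 0 + B) * ((s * r) * b)\<^sup>2) = V"
      using r by (auto simp: V_def)
    have "emeasure M {\<omega>\<in>space M. x < r * S \<omega>} = (\<integral>\<^sup>+\<omega>. indicator {\<omega>\<in>space M. x < r * S \<omega>} \<omega> \<partial>M)"
      by simp
    also have "\<dots> \<le> (\<integral>\<^sup>+\<omega>. ennreal (exp (- s * x)) * ennreal (exp ((s * r) * S \<omega>)) \<partial>M)"
    proof (rule nn_integral_mono)
      fix \<omega>
      have "1 \<le> exp (- s * x) * exp (s * r * S \<omega>)" if "x < r * S \<omega>"
      proof -
        have "s * x \<le> s * (r * S \<omega>)" using s that by (intro mult_left_mono) auto
        then show ?thesis by (simp add: exp_add[symmetric] mult.assoc)
      qed
      then show "indicator {\<omega>\<in>space M. x < r * S \<omega>} \<omega> \<le> ennreal (exp (- s * x)) * ennreal (exp ((s * r) * S \<omega>))"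
        by (auto simp: indicator_def ennreal_mult[symmetric])
    qed
    also have "\<dots> = ennreal (exp (- s * x)) * (\<integral>\<^sup>+\<omega>. ennreal (exp ((s * r) * S \<omega>)) \<partial>M)"
      by (intro nn_integral_cmult) auto
    also have "\<dots> \<le> ennreal (exp (- s * x)) * ennreal (exp V)"
      unfolding S_def V_eq[symmetric] using r s b
      by (intro mult_left_mono exp_moment_pertp h B) (auto simp: abs_mult)
    also have "\<dots> = ennreal (exp (V - s * x))"
      by (simp add: ennreal_mult[symmetric] exp_add[symmetric])
    finally show ?thesis by (simp add: emeasure_eq_measure)
  qed
  have "prob {\<omega>\<in>space M. x < \<bar>S \<omega>\<bar>} \<le> prob ({\<omega>\<in>space M. x < 1 * S \<omega>} \<union> {\<omega>\<in>space M. x < (-1) * S \<omega>})"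
    by (intro finite_measure_mono) auto
  also have "\<dots> \<le> prob {\<omega>\<in>space M. x < 1 * S \<omega>} + prob {\<omega>\<in>space M. x < (-1) * S \<omega>}"
    by (intro measure_Un_le) auto
  also have "\<dots> \<le> 2 * exp (V - s * x)"
    using half[of 1] half[of "-1"] by linarith
  finally show ?thesis by (simp add: S_def V_def)
qed

text \<open>The number of net functions grows like \<open>exp (c sqrt n)\<close>, while each deviation
  probability decays like \<open>exp (- c n)\<close>.\<close>

lemma net_deviation_tendsto_0:
  assumes A: "0 < A" and \<eta>: "0 < \<eta>" and B: "0 \<le> B" and \<zeta>: "0 < \<zeta>"
  defines "\<delta> \<equiv> (\<lambda>n. A / sqrt (real n) * \<eta>)"
    and "b \<equiv> (\<lambda>n. A / sqrt (real n) * (B / (1 - \<kappa>1)))"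
  shows "(\<lambda>n. prob {\<omega>\<in>space M. \<exists>m\<in>net_index (\<delta> n) \<eta> B.
      \<zeta> * sqrt (real n) < \<bar>\<Sum>k<n. eps k \<omega> * pertp (net_fun g (\<delta> n) m) (b n) B k \<omega>\<bar>}) \<longlonglongrightarrow> 0"
proof -
  define \<beta> where "\<beta> = B / (1 - \<kappa>1)"
  have \<beta>: "0 \<le> \<beta>" unfolding \<beta>_def using B kappa_nonneg kappa_sum by simp
  define \<Lambda> where "\<Lambda> = g 0 0 + B"
  have \<Lambda>: "0 \<le> \<Lambda>" unfolding \<Lambda>_def using g_nonneg[of 0 0] B by simp
  define q where "q = A * \<beta>"
  have q: "0 \<le> q" unfolding q_def using A \<beta> by simp
  \<comment> \<open>The exponential parameter will be \<sigma> * sqrt n. The first entry ensures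
    \<sigma> * q \<le> 1, as the exponential bound demands; the second lets the quadratic term use
    up at most half of the linear gain \<sigma> * \<zeta> * n.\<close>
  define \<sigma> where "\<sigma> = min (1 / (q + 1)) (\<zeta> / (2 * (\<Lambda> * q\<^sup>2 + 1)))"
  have den: "0 < \<Lambda> * q\<^sup>2 + 1" using \<Lambda> by (intro add_nonneg_pos mult_nonneg_nonneg) auto
  have \<sigma>: "0 < \<sigma>" unfolding \<sigma>_def using q \<zeta> den by simp
  have "\<sigma> * q \<le> 1 / (q + 1) * q" using q by (intro mult_right_mono) (auto simp: \<sigma>_def)
  also have "\<dots> \<le> 1" using q by (simp add: divide_le_eq)
  finally have \<sigma>q: "\<sigma> * q \<le> 1" .
  have "\<sigma> * (\<Lambda> * q\<^sup>2) \<le> \<sigma> * (\<Lambda> * q\<^sup>2 + 1)" using \<sigma> by (intro mult_left_mono) auto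
  also have "\<dots> \<le> \<zeta> / (2 * (\<Lambda> * q\<^sup>2 + 1)) * (\<Lambda> * q\<^sup>2 + 1)" using den by (intro mult_right_mono) (auto simp: \<sigma>_def)
  also have "\<dots> = \<zeta> / 2"
  proof -
    have "\<zeta> / (2 * c) * c = \<zeta> / 2" if "0 < c" for c :: real using that by simp
    from this[OF den] show ?thesis .
  qed
  finally have \<sigma>\<Lambda>: "\<sigma> * (\<Lambda> * q\<^sup>2) \<le> \<zeta> / 2" .
  define c where "c = \<sigma> * \<zeta> / 2"
  have c: "0 < c" unfolding c_def using \<sigma> \<zeta> by simp
  define v where "v = ln (2 * ((2 * B + 2) / \<eta> + 1) + 3)"
  \<comment> \<open>The exponent of the covering number, split by powers of sqrt n: the mesh is A *
    \<eta> / sqrt n, so the number of cells brings the factor sqrt n.\<close>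
  define p1 where "p1 = v * ((B + 1) * ((B + 1) / (A * \<eta>)))"
  define p2 where "p2 = v * (B + 1)"
  let ?E = "\<lambda>n m. {\<omega>\<in>space M. \<zeta> * sqrt (real n) < \<bar>\<Sum>k<n. eps k \<omega> * pertp (net_fun g (\<delta> n) m) (b n) B k \<omega>\<bar>}"
  have bound: "prob {\<omega>\<in>space M. \<exists>m\<in>net_index (\<delta> n) \<eta> B.
      \<zeta> * sqrt (real n) < \<bar>\<Sum>k<n. eps k \<omega> * pertp (net_fun g (\<delta> n) m) (b n) B k \<omega>\<bar>}
      \<le> exp (p1 * sqrt (real n) + p2) * (2 * exp (- c * real n))" if n: "0 < n" for n
  proof -
    define r where "r = sqrt (real n)"
    have r: "0 < r" "r * r = real n" using n by (auto simp: r_def)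
    have b0: "0 \<le> b n" unfolding b_def \<beta>_def[symmetric] using A \<beta> by simp
    have \<delta>0: "0 < \<delta> n" unfolding \<delta>_def using A \<eta> n by simp
    \<comment> \<open>The clipping bound decays like 1 / sqrt n, so its product with the exponential
      parameter does not depend on n.\<close>
    have sb: "(\<sigma> * r) * b n = \<sigma> * q"
      unfolding b_def \<beta>_def[symmetric] q_def r_def[symmetric] using r(1) by simp
    have single: "prob (?E n m) \<le> 2 * exp (- c * real n)" for m
    proof -
      have "prob (?E n m) \<le> 2 * exp (real n * (\<Lambda> * ((\<sigma> * r) * b n)\<^sup>2) - (\<sigma> * r) * (\<zeta> * sqrt (real n)))"
        unfolding \<Lambda>_def using \<sigma> r b0 \<sigma>q B sb
        by (intro exp_tail_pertp net_fun_measurable) auto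
      also have "\<dots> \<le> 2 * exp (- c * real n)"
      proof -
        have rn: "(\<sigma> * r) * (\<zeta> * sqrt (real n)) = (r * r) * \<sigma> * \<zeta>"
          by (simp add: r_def)
        have "real n * (\<Lambda> * ((\<sigma> * r) * b n)\<^sup>2) - (\<sigma> * r) * (\<zeta> * sqrt (real n))
            = real n * \<sigma> * (\<sigma> * (\<Lambda> * q\<^sup>2)) - real n * \<sigma> * \<zeta>"
          unfolding sb rn r(2) by (simp add: power_mult_distrib power2_eq_square)
        also have "\<dots> \<le> real n * \<sigma> * (\<zeta> / 2) - real n * \<sigma> * \<zeta>"
          using \<sigma> by (intro diff_right_mono mult_left_mono \<sigma>\<Lambda>) auto
        also have "\<dots> = - c * real n" by (simp add: c_def)
        finally show ?thesis by simp
      qed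
      finally show ?thesis .
    qed
    have meas: "?E n m \<in> sets M" for m
    proof -
      have [measurable]: "pertp (net_fun g (\<delta> n) m) (b n) B k \<in> borel_measurable M" for k
        by (rule pertp_measurable[OF net_fun_measurable])
      show ?thesis by measurable
    qed
    have union: "{\<omega>\<in>space M. \<exists>m\<in>net_index (\<delta> n) \<eta> B.
      \<zeta> * sqrt (real n) < \<bar>\<Sum>k<n. eps k \<omega> * pertp (net_fun g (\<delta> n) m) (b n) B k \<omega>\<bar>}
      = (\<Union>m\<in>net_index (\<delta> n) \<eta> B. ?E n m)" by auto
    have "prob {\<omega>\<in>space M. \<exists>m\<in>net_index (\<delta> n) \<eta> B.
      \<zeta> * sqrt (real n) < \<bar>\<Sum>k<n. eps k \<omega> * pertp (net_fun g (\<delta> n) m) (b n) B k \<omega>\<bar>}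
      \<le> (\<Sum>m\<in>net_index (\<delta> n) \<eta> B. prob (?E n m))"
      unfolding union using meas by (intro finite_measure_subadditive_finite finite_net_index) auto
    also have "\<dots> \<le> (\<Sum>m\<in>net_index (\<delta> n) \<eta> B. 2 * exp (- c * real n))"
      by (intro sum_mono single)
    also have "\<dots> = real (card (net_index (\<delta> n) \<eta> B)) * (2 * exp (- c * real n))" by simp
    also have "\<dots> \<le> exp (v * ((B + 1) * ((B + 1) / \<delta> n + 1))) * (2 * exp (- c * real n))"
      unfolding v_def by (intro mult_right_mono card_net_index_le \<delta>0 \<eta> B) auto
    also have "v * ((B + 1) * ((B + 1) / \<delta> n + 1)) = p1 * sqrt (real n) + p2"
      by (simp add: p1_def p2_def \<delta>_def algebra_simps)
    finally show ?thesis .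
  qed
  show ?thesis
  proof (rule tendsto_sandwich[OF _ _ tendsto_const subexp_times_exp_tendsto_0[OF c, of p1 p2]])
    show "\<forall>\<^sub>F n in sequentially. prob {\<omega>\<in>space M. \<exists>m\<in>net_index (\<delta> n) \<eta> B.
      \<zeta> * sqrt (real n) < \<bar>\<Sum>k<n. eps k \<omega> * pertp (net_fun g (\<delta> n) m) (b n) B k \<omega>\<bar>}
      \<le> exp (p1 * sqrt (real n) + p2) * (2 * exp (- c * real n))"
      using bound by (intro eventually_sequentiallyI[of 1]) auto
  qed simp
qed

section \<open>Second moments of the innovations and of the tails\<close>

lemma eps_second_moment:
  shows "integrable M (\<lambda>\<omega>. (eps k \<omega>)\<^sup>2)" and "(\<integral>\<omega>. (eps k \<omega>)\<^sup>2 \<partial>M) = (\<integral>\<omega>. L 0 \<omega> \<partial>M)"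
proof -
  have HF: "(\<lambda>\<omega>. (real j - L k \<omega>)\<^sup>2) \<in> borel_measurable (F k)" for j
    by (intro borel_measurable_power borel_measurable_diff borel_measurable_const L_meas_F)
  have eq: "(\<integral>j. (real j - L k \<omega>)\<^sup>2 \<partial>pois (L k \<omega>)) = L k \<omega>" if "\<omega> \<in> space M" for \<omega>
    by (rule integral_pois_centered(1)[OF L_nonneg[OF that]])
  have "integrable M (\<lambda>\<omega>. \<integral>j. \<bar>(real j - L k \<omega>)\<^sup>2\<bar> \<partial>pois (L k \<omega>)) \<longleftrightarrow> integrable M (L k)"
    by (intro Bochner_Integration.integrable_cong refl) (simp add: eq)
  then show i: "integrable M (\<lambda>\<omega>. (eps k \<omega>)\<^sup>2)"
    unfolding eps_def using integrable_L integral_pois_centered(2)[OF L_nonneg]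
    by (intro kernel_integrable[OF HF]) auto
  have "(\<integral>\<omega>. (eps k \<omega>)\<^sup>2 \<partial>M) = (\<integral>\<omega>. (\<integral>j. (real j - L k \<omega>)\<^sup>2 \<partial>pois (L k \<omega>)) \<partial>M)"
    using i unfolding eps_def by (rule kernel_integral(1)[OF HF])
  also have "\<dots> = (\<integral>\<omega>. L k \<omega> \<partial>M)" by (intro Bochner_Integration.integral_cong refl eq)
  also have "\<dots> = (\<integral>\<omega>. L 0 \<omega> \<partial>M)" using expectation_L_stat[of "\<lambda>l. l" k] by simp
  finally show "(\<integral>\<omega>. (eps k \<omega>)\<^sup>2 \<partial>M) = (\<integral>\<omega>. L 0 \<omega> \<partial>M)" .
qed

lemma integrable_wgt_sq: "integrable M (\<lambda>\<omega>. (wgt k \<omega>)\<^sup>2)"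
proof -
  have s: "(wgt k \<omega>)\<^sup>2 = (L k \<omega>)\<^sup>2 + (real (Y k \<omega>))\<^sup>2 + 2 * (L k \<omega> * real (Y k \<omega>)) + 2 * L k \<omega> + 2 * real (Y k \<omega>) + 1" for \<omega>
    by (simp add: wgt_def power2_eq_square algebra_simps)
  have "integrable M (\<lambda>\<omega>. L k \<omega> * real (Y k \<omega>))"
    using integrable_L_sq integrable_Y_sq by (intro integrable_mult_of_squares) auto
  then show ?thesis unfolding s using integrable_L_sq integrable_Y_sq integrable_L integrable_Y by simp
qed

definition wtail :: "real \<Rightarrow> nat \<Rightarrow> 'w \<Rightarrow> real" where
  "wtail B k \<omega> = (if B < wgt k \<omega> then wgt k \<omega> else 0)"

lemma wtail_measurable [measurable]: "wtail B k \<in> borel_measurable M"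
  unfolding wtail_def by measurable

lemma wtail_sq_le: "(wtail B k \<omega>)\<^sup>2 \<le> (wgt k \<omega>)\<^sup>2"
  by (simp add: wtail_def)

lemma integrable_wtail_sq: "integrable M (\<lambda>\<omega>. (wtail B k \<omega>)\<^sup>2)"
  by (rule Bochner_Integration.integrable_bound[OF integrable_wgt_sq[of k]]) (auto simp: wtail_sq_le)

text \<open>Stationarity is available for \<open>L\<close> only, so \<open>Y k\<close> is first
  averaged out. The resulting function is written as a series, which makes it measurable on the
  whole line, including negative arguments.\<close>

lemma expectation_wtail_sq_stat: "(\<integral>\<omega>. (wtail B k \<omega>)\<^sup>2 \<partial>M) = (\<integral>\<omega>. (wtail B 0 \<omega>)\<^sup>2 \<partial>M)"
proof -
  define q where "q l j = (if B < l + real j + 1 then l + real j + 1 else 0)\<^sup>2" for l j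
  have q_meas [measurable]: "(\<lambda>l. q l j) \<in> borel_measurable borel" for j unfolding q_def by measurable
  define \<phi> where "\<phi> l = (\<Sum>j. poisson_prob l j * q l j)" for l
  have [measurable]: "\<phi> \<in> borel_measurable borel" unfolding \<phi>_def by measurable
  have \<phi>: "(\<integral>j. q l j \<partial>pois l) = \<phi> l" if l: "0 \<le> l" for l
  proof -
    have "integrable (pois l) (\<lambda>j. (l + 1 + real j)\<^sup>2)"
      using integrable_pois_power[OF l, of 2] integrable_pois_of_nat[OF l]
      unfolding power2_sum by simp
    then have "integrable (pois l) (q l)"
      by (rule Bochner_Integration.integrable_bound) (auto simp: q_def algebra_simps)
    from sums_integral_pois[OF l this] show ?thesis by (simp add: \<phi>_def sums_iff)
  qed
  have step: "(\<integral>\<omega>. (wtail B k \<omega>)\<^sup>2 \<partial>M) = (\<integral>\<omega>. \<phi> (L k \<omega>) \<partial>M)" for k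
  proof -
    have eq: "(wtail B k \<omega>)\<^sup>2 = q (L k \<omega>) (Y k \<omega>)" for \<omega>
      by (simp add: wtail_def wgt_def q_def)
    have "(\<integral>\<omega>. q (L k \<omega>) (Y k \<omega>) \<partial>M) = (\<integral>\<omega>. (\<integral>j. q (L k \<omega>) j \<partial>pois (L k \<omega>)) \<partial>M)"
      using integrable_wtail_sq[of B k] unfolding eq
      by (intro kernel_integral(1)[where H="\<lambda>j \<omega>. q (L k \<omega>) j"] measurable_compose[OF L_meas_F q_meas]) auto
    also have "\<dots> = (\<integral>\<omega>. \<phi> (L k \<omega>) \<partial>M)"
      by (intro Bochner_Integration.integral_cong refl \<phi> L_nonneg)
    finally show ?thesis by (simp add: eq)
  qed
  show ?thesis unfolding step by (rule expectation_L_stat) measurable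
qed

lemma wtail_tendsto_0: "(\<lambda>m. \<integral>\<omega>. (wtail (real m) 0 \<omega>)\<^sup>2 \<partial>M) \<longlonglongrightarrow> 0"
proof -
  have "(\<lambda>m. \<integral>\<omega>. (wtail (real m) 0 \<omega>)\<^sup>2 \<partial>M) \<longlonglongrightarrow> (\<integral>\<omega>. 0 \<partial>M)"
  proof (rule integral_dominated_convergence[OF _ _ integrable_wgt_sq[of 0]])
    show "AE \<omega> in M. (\<lambda>m. (wtail (real m) 0 \<omega>)\<^sup>2) \<longlonglongrightarrow> 0"
    proof (intro AE_I2 tendsto_eventually)
      fix \<omega>
      obtain m0 :: nat where "wgt 0 \<omega> \<le> real m0" using real_arch_simple by blast
      then show "\<forall>\<^sub>F m in sequentially. (wtail (real m) 0 \<omega>)\<^sup>2 = 0"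
        by (intro eventually_sequentiallyI[of m0]) (auto simp: wtail_def)
    qed
  qed (auto simp: wtail_sq_le)
  then show ?thesis by simp
qed

abbreviation tacc :: "real \<Rightarrow> nat \<Rightarrow> 'w \<Rightarrow> real" where
  "tacc B k \<omega> \<equiv> tail_acc \<kappa>1 B (\<lambda>k. L k \<omega> + real (Y k \<omega>) + 1) k"

lemma tacc_Suc: "tacc B (Suc k) \<omega> = \<kappa>1 * tacc B k \<omega> + wtail B k \<omega>"
  by (simp add: wtail_def wgt_def)

lemma tacc_measurable [measurable]: "tacc B k \<in> borel_measurable M"
proof (induction k)
  case (Suc k)
  then show ?case unfolding tacc_Suc by measurable
qed simp

text \<open>By convexity of the square, \<kappa>1 * s + t is the average of s and t / (1 -
  \<kappa>1) with weights \<kappa>1 and 1 - \<kappa>1. The stated bound is the fixed point of the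
  resulting recursion for second moments, hence uniform in k.\<close>

lemma tacc_second_moment:
  "integrable M (\<lambda>\<omega>. (tacc B k \<omega>)\<^sup>2) \<and>
   (\<integral>\<omega>. (tacc B k \<omega>)\<^sup>2 \<partial>M) \<le> (\<integral>\<omega>. (wtail B 0 \<omega>)\<^sup>2 \<partial>M) / (1 - \<kappa>1)\<^sup>2"
proof (induction k)
  case (Suc k)
  define w where "w = (\<integral>\<omega>. (wtail B 0 \<omega>)\<^sup>2 \<partial>M)"
  have \<kappa>: "0 \<le> \<kappa>1" "\<kappa>1 < 1" using kappa_nonneg kappa_sum by auto
  have sq: "(\<kappa>1 * s + t)\<^sup>2 \<le> \<kappa>1 * s\<^sup>2 + t\<^sup>2 / (1 - \<kappa>1)" for s t
  proof -
    have "0 \<le> \<kappa>1 * ((1 - \<kappa>1) * s - t)\<^sup>2 / (1 - \<kappa>1)" using \<kappa> by simp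
    also have "\<dots> = \<kappa>1 * s\<^sup>2 + t\<^sup>2 / (1 - \<kappa>1) - (\<kappa>1 * s + t)\<^sup>2"
      using \<kappa> by (simp add: field_simps power2_eq_square)
    finally show ?thesis by simp
  qed
  have i: "integrable M (\<lambda>\<omega>. \<kappa>1 * (tacc B k \<omega>)\<^sup>2 + (wtail B k \<omega>)\<^sup>2 / (1 - \<kappa>1))"
    using Suc.IH integrable_wtail_sq[of B k] by simp
  have i': "integrable M (\<lambda>\<omega>. (tacc B (Suc k) \<omega>)\<^sup>2)"
  proof (rule Bochner_Integration.integrable_bound[OF i])
    show "AE \<omega> in M. norm ((tacc B (Suc k) \<omega>)\<^sup>2) \<le> norm (\<kappa>1 * (tacc B k \<omega>)\<^sup>2 + (wtail B k \<omega>)\<^sup>2 / (1 - \<kappa>1))"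
    proof (rule AE_I2)
      fix \<omega>
      have "(tacc B (Suc k) \<omega>)\<^sup>2 \<le> \<kappa>1 * (tacc B k \<omega>)\<^sup>2 + (wtail B k \<omega>)\<^sup>2 / (1 - \<kappa>1)"
        unfolding tacc_Suc by (rule sq)
      from order_trans[OF this abs_ge_self]
      show "norm ((tacc B (Suc k) \<omega>)\<^sup>2) \<le> norm (\<kappa>1 * (tacc B k \<omega>)\<^sup>2 + (wtail B k \<omega>)\<^sup>2 / (1 - \<kappa>1))"
        by (simp only: real_norm_def abs_power2)
    qed
  qed measurable
  have "(\<integral>\<omega>. (tacc B (Suc k) \<omega>)\<^sup>2 \<partial>M) \<le> (\<integral>\<omega>. \<kappa>1 * (tacc B k \<omega>)\<^sup>2 + (wtail B k \<omega>)\<^sup>2 / (1 - \<kappa>1) \<partial>M)"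
    using i i' unfolding tacc_Suc by (intro integral_mono sq) auto
  also have "\<dots> = \<kappa>1 * (\<integral>\<omega>. (tacc B k \<omega>)\<^sup>2 \<partial>M) + w / (1 - \<kappa>1)"
    using Suc.IH integrable_wtail_sq[of B k] expectation_wtail_sq_stat[of B k] by (simp add: w_def)
  also have "\<dots> \<le> \<kappa>1 * (w / (1 - \<kappa>1)\<^sup>2) + w / (1 - \<kappa>1)"
    using Suc.IH \<kappa> by (intro add_right_mono mult_left_mono) (auto simp: w_def)
  also have "\<dots> = w / (1 - \<kappa>1)\<^sup>2"
  proof -
    have "w / (1 - \<kappa>1) = (1 - \<kappa>1) * (w / (1 - \<kappa>1)\<^sup>2)"
      using \<kappa> by (simp add: power2_eq_square)
    moreover have "\<kappa>1 * x + (1 - \<kappa>1) * x = x" for x by (simp add: algebra_simps)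
    ultimately show ?thesis by metis
  qed
  finally show ?case using i' by (simp add: w_def del: tail_acc.simps)
qed simp

end

context prob_space
begin

lemma tight:
  fixes X :: "'a \<Rightarrow> real"
  assumes [measurable]: "X \<in> borel_measurable M" and e: "0 < e"
  shows "\<exists>c\<ge>0. prob {\<omega>\<in>space M. c < \<bar>X \<omega>\<bar>} < e"
proof -
  let ?A = "\<lambda>m::nat. {\<omega>\<in>space M. real m < \<bar>X \<omega>\<bar>}"
  have "(\<lambda>m. prob (?A m)) \<longlonglongrightarrow> prob (\<Inter>m. ?A m)"
    by (rule finite_Lim_measure_decseq) (auto simp: decseq_def)
  moreover have "(\<Inter>m. ?A m) = {}"
  proof -
    have "\<exists>m. \<not> real m < \<bar>X \<omega>\<bar>" for \<omega> using real_arch_simple[of "\<bar>X \<omega>\<bar>"] by (auto simp: not_less)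
    then show ?thesis by auto
  qed
  ultimately have "(\<lambda>m. prob (?A m)) \<longlonglongrightarrow> 0" by simp
  from LIMSEQ_D[OF this e] obtain m where "prob (?A m) < e" by auto
  then show ?thesis by (intro exI[of _ "real m"]) auto
qed

lemma markov_real:
  fixes Q :: "'a \<Rightarrow> real"
  assumes Q: "integrable M Q" "\<And>\<omega>. \<omega> \<in> space M \<Longrightarrow> 0 \<le> Q \<omega>" and z: "0 < z"
  shows "prob {\<omega>\<in>space M. z < Q \<omega>} \<le> (\<integral>\<omega>. Q \<omega> \<partial>M) / z"
proof -
  have "prob {\<omega>\<in>space M. z < Q \<omega>} \<le> prob {\<omega>\<in>space M. z \<le> Q \<omega>}"
    using borel_measurable_integrable[OF Q(1)] by (intro finite_measure_mono) auto
  also have "\<dots> \<le> (\<integral>\<omega>. Q \<omega> \<partial>M) / z"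
    using Q z by (intro integral_Markov_inequality_measure[where A="{}"]) auto
  finally show ?thesis .
qed

end

section \<open>The remainder between the two statistics\<close>

context poisson_chain
begin

text \<open>What is left of a summand once the linear term in the predictable perturbation is
  removed: the products of \<open>eps k\<close> with the three errors of \<open>pert_approx\<close>,
  then twice the squared clipping bound, then the squares of the three errors with factor 6 = 2 * 3.
  The free \<gamma> balances innovation against tail.\<close>

definition rem_term :: "real \<Rightarrow> real \<Rightarrow> real \<Rightarrow> real \<Rightarrow> real \<Rightarrow> nat \<Rightarrow> 'w \<Rightarrow> real" where
  "rem_term a \<eta> \<gamma> B c k \<omega> = (let \<rho> = 1 / (1 - \<kappa>1) in
     2 * (\<kappa>1 ^ k * c * (1 + (eps k \<omega>)\<^sup>2) + 2 * a * \<eta> * \<rho> * (1 + (eps k \<omega>)\<^sup>2)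
        + a * \<rho> * (\<gamma> * (eps k \<omega>)\<^sup>2 + (tacc B k \<omega>)\<^sup>2 / \<gamma>))
     + 2 * a\<^sup>2 * (B * \<rho>)\<^sup>2
     + 6 * (\<kappa>1 ^ k * c\<^sup>2 + 4 * a\<^sup>2 * \<eta>\<^sup>2 * \<rho>\<^sup>2 + a\<^sup>2 * \<rho>\<^sup>2 * (tacc B k \<omega>)\<^sup>2))"

lemma rem_term_nonneg:
  "0 \<le> a \<Longrightarrow> 0 \<le> \<eta> \<Longrightarrow> 0 < \<gamma> \<Longrightarrow> 0 \<le> c \<Longrightarrow> 0 \<le> rem_term a \<eta> \<gamma> B c k \<omega>"
  using kappa_nonneg kappa_sum by (simp add: rem_term_def Let_def)

lemma abs_le_one_plus_sq: "\<bar>x\<bar> \<le> 1 + x\<^sup>2" for x :: real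
proof -
  have "0 \<le> (\<bar>x\<bar> - 1)\<^sup>2" by simp
  then have "2 * \<bar>x\<bar> \<le> 1 + x\<^sup>2" by (simp add: power2_diff)
  then show ?thesis by (simp add: abs_if split: if_splits)
qed

lemma weighted_young:
  fixes x y \<gamma> :: real
  assumes "0 < \<gamma>" shows "\<bar>x\<bar> * y \<le> \<gamma> * x\<^sup>2 + y\<^sup>2 / \<gamma>"
proof -
  have "0 \<le> (\<gamma> * \<bar>x\<bar> - y)\<^sup>2 / \<gamma>" using assms by simp
  also have "\<dots> = \<gamma> * x\<^sup>2 + y\<^sup>2 / \<gamma> - 2 * (\<bar>x\<bar> * y)"
    using assms by (simp add: power2_diff power_mult_distrib field_simps power2_eq_square)
  finally have "2 * (\<bar>x\<bar> * y) \<le> \<gamma> * x\<^sup>2 + y\<^sup>2 / \<gamma>" by simp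
  moreover have "0 \<le> \<gamma> * x\<^sup>2 + y\<^sup>2 / \<gamma>" using assms by simp
  ultimately show ?thesis by linarith
qed

text \<open>The expression on the left is - 2 * x * (\<Delta> - d) + \<Delta>^2 with x the
  innovation. Only the approximation error of d meets x linearly, so a bound on \<bar>x\<bar> is
  affordable there.\<close>

lemma rem_pointwise:
  fixes d \<Delta> :: real
  assumes a: "0 \<le> a" and \<eta>: "0 \<le> \<eta>" and \<gamma>: "0 < \<gamma>" and B: "0 \<le> B" and D: "0 \<le> D" "D \<le> c"
    and d: "\<bar>d\<bar> \<le> a * (B / (1 - \<kappa>1))"
    and e: "\<bar>\<Delta> - d\<bar> \<le> \<kappa>1 ^ k * D + 2 * a * \<eta> / (1 - \<kappa>1) + a / (1 - \<kappa>1) * tacc B k \<omega>"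
  shows "\<bar>((eps k \<omega> - \<Delta>)\<^sup>2 - (eps k \<omega>)\<^sup>2) + 2 * (eps k \<omega> * d)\<bar> \<le> rem_term a \<eta> \<gamma> B c k \<omega>"
proof -
  define x where "x = eps k \<omega>"
  define s where "s = tacc B k \<omega>"
  define \<rho> where "\<rho> = 1 / (1 - \<kappa>1)"
  have \<kappa>: "0 \<le> \<kappa>1" "\<kappa>1 < 1" using kappa_nonneg kappa_sum by auto
  have \<rho>: "0 < \<rho>" using \<kappa> by (simp add: \<rho>_def)
  define e1 where "e1 = \<kappa>1 ^ k * c"
  define e2 where "e2 = 2 * a * \<eta> * \<rho>"
  define e3 where "e3 = a * \<rho> * s"
  have "\<kappa>1 ^ k * D \<le> e1" unfolding e1_def using \<kappa> D by (intro mult_left_mono) auto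
  then have eE: "\<bar>\<Delta> - d\<bar> \<le> e1 + e2 + e3" using e by (simp add: e2_def e3_def \<rho>_def s_def)
  have "\<bar>((x - \<Delta>)\<^sup>2 - x\<^sup>2) + 2 * (x * d)\<bar> = \<bar>- 2 * (x * (\<Delta> - d)) + \<Delta>\<^sup>2\<bar>"
    by (simp add: power2_eq_square algebra_simps)
  also have "\<dots> \<le> 2 * (\<bar>x\<bar> * \<bar>\<Delta> - d\<bar>) + \<Delta>\<^sup>2"
    by (rule order_trans[OF abs_triangle_ineq]) (simp add: abs_mult)
  also have "\<dots> \<le> 2 * (\<bar>x\<bar> * (e1 + e2 + e3)) + (2 * a\<^sup>2 * (B * \<rho>)\<^sup>2 + 6 * (\<kappa>1 ^ k * c\<^sup>2 + 4 * a\<^sup>2 * \<eta>\<^sup>2 * \<rho>\<^sup>2 + a\<^sup>2 * \<rho>\<^sup>2 * s\<^sup>2))"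
  proof (intro add_mono mult_left_mono eE)
    \<comment> \<open>Equivalent to \<Delta>^2 \<le> 2 * d^2 + 2 * (\<Delta> - d)^2; the error
      square is then spread over its three sources with factor 3.\<close>
    have "0 \<le> (\<Delta> - 2 * d)\<^sup>2" by simp
    then have "\<Delta>\<^sup>2 \<le> 2 * d\<^sup>2 + 2 * (\<Delta> - d)\<^sup>2" by (simp add: power2_eq_square algebra_simps)
    moreover have "d\<^sup>2 \<le> (a * (B * \<rho>))\<^sup>2"
      using order_trans[OF d abs_ge_self] by (intro abs_le_square_iff[THEN iffD1]) (simp add: \<rho>_def)
    moreover have "(\<Delta> - d)\<^sup>2 \<le> (e1 + e2 + e3)\<^sup>2"
      using eE by (intro abs_le_square_iff[THEN iffD1]) simp
    moreover have "(e1 + e2 + e3)\<^sup>2 \<le> 3 * (e1\<^sup>2 + e2\<^sup>2 + e3\<^sup>2)"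
    proof -
      have "0 \<le> (e1 - e2)\<^sup>2 + (e1 - e3)\<^sup>2 + (e2 - e3)\<^sup>2" by simp
      then show ?thesis by (simp add: power2_eq_square algebra_simps)
    qed
    moreover have "e1\<^sup>2 \<le> \<kappa>1 ^ k * c\<^sup>2"
    proof -
      have "(\<kappa>1 ^ k) * (\<kappa>1 ^ k) \<le> \<kappa>1 ^ k * 1"
        using \<kappa> by (intro mult_left_mono power_le_one) auto
      then show ?thesis unfolding e1_def power_mult_distrib
        by (intro mult_right_mono) (auto simp: power2_eq_square)
    qed
    moreover have "t \<le> 2 * v + 6 * (u1 + w2 + w3)"
      if "t \<le> 2 * t1 + 2 * t2" "t1 \<le> v" "t2 \<le> t3" "t3 \<le> 3 * (w1 + w2 + w3)" "w1 \<le> u1"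
      for t t1 t2 t3 u1 v w1 w2 w3 :: real
      using that unfolding distrib_left by linarith
    ultimately have "\<Delta>\<^sup>2 \<le> 2 * (a * (B * \<rho>))\<^sup>2 + 6 * (\<kappa>1 ^ k * c\<^sup>2 + e2\<^sup>2 + e3\<^sup>2)" by blast
    then show "\<Delta>\<^sup>2 \<le> 2 * a\<^sup>2 * (B * \<rho>)\<^sup>2 + 6 * (\<kappa>1 ^ k * c\<^sup>2 + 4 * a\<^sup>2 * \<eta>\<^sup>2 * \<rho>\<^sup>2 + a\<^sup>2 * \<rho>\<^sup>2 * s\<^sup>2)"
      by (simp add: e2_def e3_def power_mult_distrib)
  qed auto
  \<comment> \<open>The first two errors are deterministic, so \<bar>x\<bar> \<le> 1 + x^2 is
    enough. The third contains the random tail sum; Young's inequality makes the innovation part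
    small through \<gamma> and the tail part small through B.\<close>
  also have "\<bar>x\<bar> * (e1 + e2 + e3) \<le> e1 * (1 + x\<^sup>2) + e2 * (1 + x\<^sup>2) + a * \<rho> * (\<gamma> * x\<^sup>2 + s\<^sup>2 / \<gamma>)"
  proof -
    have "0 \<le> e1" "0 \<le> e2" unfolding e1_def e2_def using a \<eta> \<rho> \<kappa> D by auto
    then have "e1 * \<bar>x\<bar> \<le> e1 * (1 + x\<^sup>2)" "e2 * \<bar>x\<bar> \<le> e2 * (1 + x\<^sup>2)"
      by (auto intro!: mult_left_mono abs_le_one_plus_sq)
    moreover have "a * \<rho> * (\<bar>x\<bar> * s) \<le> a * \<rho> * (\<gamma> * x\<^sup>2 + s\<^sup>2 / \<gamma>)"
      using a \<rho> by (intro mult_left_mono weighted_young \<gamma>) auto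
    ultimately show ?thesis by (simp add: e3_def algebra_simps)
  qed
  finally show ?thesis
    by (simp add: rem_term_def Let_def x_def s_def \<rho>_def e1_def e2_def)
qed

lemma rem_term_integrable: "integrable M (rem_term a \<eta> \<gamma> B c k)"
  unfolding rem_term_def Let_def using eps_second_moment(1)[of k] tacc_second_moment[of B k]
  by simp

lemma rem_term_expectation:
  fixes B :: real
  assumes a: "0 \<le> a" and \<gamma>: "0 < \<gamma>"
  defines "\<rho> \<equiv> 1 / (1 - \<kappa>1)"
  defines "e \<equiv> (\<integral>\<omega>. L 0 \<omega> \<partial>M)" and "T \<equiv> (\<integral>\<omega>. (wtail B 0 \<omega>)\<^sup>2 \<partial>M) * \<rho>\<^sup>2"
  shows "(\<integral>\<omega>. rem_term a \<eta> \<gamma> B c k \<omega> \<partial>M) \<le>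
     \<kappa>1 ^ k * (2 * c * (1 + e) + 6 * c\<^sup>2) + a * (4 * \<eta> * \<rho> * (1 + e) + 2 * \<rho> * (\<gamma> * e + T / \<gamma>))
       + a\<^sup>2 * (2 * (B * \<rho>)\<^sup>2 + 24 * \<eta>\<^sup>2 * \<rho>\<^sup>2 + 6 * \<rho>\<^sup>2 * T)"
proof -
  define t where "t = (\<integral>\<omega>. (tacc B k \<omega>)\<^sup>2 \<partial>M)"
  have \<rho>: "0 < \<rho>" unfolding \<rho>_def using kappa_nonneg kappa_sum by simp
  have t: "t \<le> T"
    using tacc_second_moment[of B k] by (simp add: t_def T_def \<rho>_def power_divide)
  have "(\<integral>\<omega>. rem_term a \<eta> \<gamma> B c k \<omega> \<partial>M) =
     2 * (\<kappa>1 ^ k * c * (1 + e) + 2 * a * \<eta> * \<rho> * (1 + e) + a * \<rho> * (\<gamma> * e + t / \<gamma>))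
     + 2 * a\<^sup>2 * (B * \<rho>)\<^sup>2
     + 6 * (\<kappa>1 ^ k * c\<^sup>2 + 4 * a\<^sup>2 * \<eta>\<^sup>2 * \<rho>\<^sup>2 + a\<^sup>2 * \<rho>\<^sup>2 * t)"
    unfolding rem_term_def Let_def \<rho>_def[symmetric]
    using eps_second_moment[of k] tacc_second_moment[of B k]
    by (simp add: prob_space e_def t_def)
  also have "\<dots> \<le> 2 * (\<kappa>1 ^ k * c * (1 + e) + 2 * a * \<eta> * \<rho> * (1 + e) + a * \<rho> * (\<gamma> * e + T / \<gamma>))
     + 2 * a\<^sup>2 * (B * \<rho>)\<^sup>2
     + 6 * (\<kappa>1 ^ k * c\<^sup>2 + 4 * a\<^sup>2 * \<eta>\<^sup>2 * \<rho>\<^sup>2 + a\<^sup>2 * \<rho>\<^sup>2 * T)"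
    using t a \<rho> \<gamma> by (intro add_mono mult_left_mono divide_right_mono order_refl) auto
  also have "\<dots> = \<kappa>1 ^ k * (2 * c * (1 + e) + 6 * c\<^sup>2) + a * (4 * \<eta> * \<rho> * (1 + e) + 2 * \<rho> * (\<gamma> * e + T / \<gamma>))
       + a\<^sup>2 * (2 * (B * \<rho>)\<^sup>2 + 24 * \<eta>\<^sup>2 * \<rho>\<^sup>2 + 6 * \<rho>\<^sup>2 * T)"
    by (simp only: distrib_left distrib_right mult_ac add_ac)
  finally show ?thesis .
qed

text \<open>With a = A / sqrt n, the terms linear in a survive summation and division by sqrt n;
  they must be made small through \<eta>, \<gamma> and B. The starting error is summable over k and
  the squares are of order a^2, so both leave O(1 / sqrt n).\<close>

lemma rem_sum_expectation:
  fixes B :: real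
  assumes A: "0 \<le> A" and \<eta>: "0 \<le> \<eta>" and \<gamma>: "0 < \<gamma>" and c: "0 \<le> c" and n: "0 < n"
  defines "\<rho> \<equiv> 1 / (1 - \<kappa>1)"
  defines "e \<equiv> (\<integral>\<omega>. L 0 \<omega> \<partial>M)" and "T \<equiv> (\<integral>\<omega>. (wtail B 0 \<omega>)\<^sup>2 \<partial>M) * \<rho>\<^sup>2"
  shows "(\<integral>\<omega>. 1 / sqrt (real n) * (\<Sum>k<n. rem_term (A / sqrt (real n)) \<eta> \<gamma> B c k \<omega>) \<partial>M) \<le>
     A * (4 * \<eta> * \<rho> * (1 + e) + 2 * \<rho> * (\<gamma> * e + T / \<gamma>))
     + ((2 * c * (1 + e) + 6 * c\<^sup>2) * \<rho> + A\<^sup>2 * (2 * (B * \<rho>)\<^sup>2 + 24 * \<eta>\<^sup>2 * \<rho>\<^sup>2 + 6 * \<rho>\<^sup>2 * T)) / sqrt (real n)"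
proof -
  define r where "r = sqrt (real n)"
  have r: "0 < r" "real n = r * r" using n by (auto simp: r_def)
  define a where "a = A / r"
  have a: "0 \<le> a" using A r by (simp add: a_def)
  have \<kappa>: "0 \<le> \<kappa>1" "\<kappa>1 < 1" using kappa_nonneg kappa_sum by auto
  define u1 where "u1 = 2 * c * (1 + e) + 6 * c\<^sup>2"
  define u2 where "u2 = 4 * \<eta> * \<rho> * (1 + e) + 2 * \<rho> * (\<gamma> * e + T / \<gamma>)"
  define u3 where "u3 = 2 * (B * \<rho>)\<^sup>2 + 24 * \<eta>\<^sup>2 * \<rho>\<^sup>2 + 6 * \<rho>\<^sup>2 * T"
  have e: "0 \<le> e" unfolding e_def by (intro integral_nonneg_AE AE_I2 L_nonneg)
  have u1: "0 \<le> u1" unfolding u1_def using c e by simp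
  have "(\<Sum>k<n. \<integral>\<omega>. rem_term a \<eta> \<gamma> B c k \<omega> \<partial>M) \<le> (\<Sum>k<n. \<kappa>1 ^ k * u1 + a * u2 + a\<^sup>2 * u3)"
    unfolding u1_def u2_def u3_def e_def T_def \<rho>_def by (intro sum_mono rem_term_expectation a \<gamma>)
  also have "\<dots> = (\<Sum>k<n. \<kappa>1 ^ k) * u1 + real n * (a * u2 + a\<^sup>2 * u3)"
    by (simp add: sum.distrib sum_distrib_right distrib_left)
  also have "\<dots> \<le> \<rho> * u1 + real n * (a * u2 + a\<^sup>2 * u3)"
  proof (intro add_right_mono mult_right_mono u1)
    show "(\<Sum>k<n. \<kappa>1 ^ k) \<le> \<rho>"
      using \<kappa> sum_gp_strict[of \<kappa>1 n] by (simp add: \<rho>_def divide_right_mono)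
  qed
  finally have le: "(\<Sum>k<n. \<integral>\<omega>. rem_term a \<eta> \<gamma> B c k \<omega> \<partial>M) \<le> \<rho> * u1 + real n * (a * u2 + a\<^sup>2 * u3)" .
  have "(\<integral>\<omega>. 1 / r * (\<Sum>k<n. rem_term a \<eta> \<gamma> B c k \<omega>) \<partial>M) = 1 / r * (\<Sum>k<n. \<integral>\<omega>. rem_term a \<eta> \<gamma> B c k \<omega> \<partial>M)"
    using rem_term_integrable by (simp add: Bochner_Integration.integral_sum)
  also have "\<dots> \<le> 1 / r * (\<rho> * u1 + real n * (a * u2 + a\<^sup>2 * u3))"
    using r by (intro mult_left_mono le) auto
  also have "\<dots> = A * u2 + (u1 * \<rho> + A\<^sup>2 * u3) / r"
    using r(1) unfolding r(2) a_def by (simp add: field_simps power2_eq_square)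
  finally show ?thesis by (simp add: r_def a_def u1_def u2_def u3_def)
qed

text \<open>A statement about one outcome: f may depend on \<omega>, and the net supplies an index m
  whose perturbation follows the recursion of f. As the bound on the innovation sums is assumed for
  all indices at once, the dependence of m on \<omega> does no harm.\<close>

lemma remainder_le:
  assumes \<omega>: "\<omega> \<in> space M" and rec': "\<And>k. L (Suc k) \<omega> = g (L k \<omega>) (Y k \<omega>)"
    and A: "0 < A" and \<eta>: "0 < \<eta>" and \<gamma>: "0 < \<gamma>" and B: "0 \<le> B" and n: "0 < n"
    and b: "A / sqrt (real n) * (B / (1 - \<kappa>1)) \<le> 1"
    and D: "\<bar>lh 0 - L 0 \<omega>\<bar> \<le> c"
    and lh: "\<And>k. lh (Suc k) = f (lh k) (Y k \<omega>)"
    and f_lip: "\<And>x x' i. \<bar>f x i - f x' i\<bar> \<le> \<kappa>1 * \<bar>x - x'\<bar>"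
    and f_neg: "\<And>x i. x \<le> 0 \<Longrightarrow> f x i = f 0 i"
    and f_near: "\<And>x i. 0 \<le> x \<Longrightarrow> \<bar>f x i - g x i\<bar> \<le> A / sqrt (real n) * (x + real i + 1)"
    and net: "\<And>m. m \<in> net_index (A / sqrt (real n) * \<eta>) \<eta> B \<Longrightarrow>
        \<bar>\<Sum>k<n. eps k \<omega> * pertp (net_fun g (A / sqrt (real n) * \<eta>) m) (A / sqrt (real n) * (B / (1 - \<kappa>1))) B k \<omega>\<bar>
          \<le> z * sqrt (real n)"
  shows "\<bar>1 / sqrt (real n) * (\<Sum>k<n. (real (Y k \<omega>) - lh k)\<^sup>2 - (real (Y k \<omega>) - L k \<omega>)\<^sup>2)\<bar>
    \<le> 2 * z + 1 / sqrt (real n) * (\<Sum>k<n. rem_term (A / sqrt (real n)) \<eta> \<gamma> B c k \<omega>)"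
proof -
  define r where "r = sqrt (real n)"
  have r: "0 < r" using n by (simp add: r_def)
  define a where "a = A / r"
  have a: "0 < a" using A r by (simp add: a_def)
  define b where "b = a * (B / (1 - \<kappa>1))"
  have \<kappa>: "0 \<le> \<kappa>1" "\<kappa>1 < 1" using kappa_nonneg kappa_sum by auto
  have b0: "0 \<le> b" unfolding b_def using a B \<kappa> by simp
  obtain m where m: "m \<in> net_index (a * \<eta>) \<eta> B"
    and near: "\<And>x i. x \<le> B + 1 \<Longrightarrow> real i \<le> B \<Longrightarrow> \<bar>net_fun g (a * \<eta>) m x i - f x i\<bar> \<le> 2 * a * \<eta>"
    using net_covers[where f=f and g=g, OF a \<eta> B \<kappa> f_lip f_neg f_near[folded r_def, folded a_def]] by blast
  define d where "d k = pertp (net_fun g (a * \<eta>) m) b B k \<omega>" for k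
  define \<Delta> where "\<Delta> k = lh k - L k \<omega>" for k
  have sum_d: "\<bar>\<Sum>k<n. eps k \<omega> * d k\<bar> \<le> z * r"
    using net[folded r_def, folded a_def, OF m] by (simp add: d_def b_def)
  have "\<bar>lh k - L k \<omega> - d k\<bar> \<le> \<kappa>1 ^ k * \<bar>lh 0 - L 0 \<omega>\<bar> + 2 * a * \<eta> / (1 - \<kappa>1) + a / (1 - \<kappa>1) * tacc B k \<omega>" for k
    unfolding d_def
    by (rule pert_approx[where f=f and a=a and g=g and h="net_fun g (a * \<eta>) m" and l="\<lambda>k. L k \<omega>"
          and y="\<lambda>k. Y k \<omega>" and lh=lh, OF \<kappa> less_imp_le[OF a] B less_imp_le[OF \<eta>] b_def _ f_lip
          f_near[folded r_def, folded a_def] near L_nonneg[OF \<omega>] rec' lh])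
      (use b in \<open>simp add: b_def a_def r_def\<close>)
  then have e: "\<bar>\<Delta> k - d k\<bar> \<le> \<kappa>1 ^ k * \<bar>lh 0 - L 0 \<omega>\<bar> + 2 * a * \<eta> / (1 - \<kappa>1) + a / (1 - \<kappa>1) * tacc B k \<omega>" for k
    by (simp add: \<Delta>_def)
  have d_le: "\<bar>d k\<bar> \<le> a * (B / (1 - \<kappa>1))" for k
    unfolding d_def b_def[symmetric] by (rule abs_pert_le[OF b0])
  define t where "t k = ((eps k \<omega> - \<Delta> k)\<^sup>2 - (eps k \<omega>)\<^sup>2) + 2 * (eps k \<omega> * d k)" for k
  have t: "\<bar>t k\<bar> \<le> rem_term a \<eta> \<gamma> B c k \<omega>" for k
    unfolding t_def
    by (rule rem_pointwise[OF less_imp_le[OF a] less_imp_le[OF \<eta>] \<gamma> B _ D d_le e]) simp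
  have "(\<Sum>k<n. (real (Y k \<omega>) - lh k)\<^sup>2 - (real (Y k \<omega>) - L k \<omega>)\<^sup>2) = (\<Sum>k<n. t k - 2 * (eps k \<omega> * d k))"
    by (intro sum.cong refl) (simp add: t_def eps_def \<Delta>_def)
  also have "\<dots> = (\<Sum>k<n. t k) - 2 * (\<Sum>k<n. eps k \<omega> * d k)"
    by (simp add: sum_subtractf sum_distrib_left)
  finally have eq: "(\<Sum>k<n. (real (Y k \<omega>) - lh k)\<^sup>2 - (real (Y k \<omega>) - L k \<omega>)\<^sup>2) = (\<Sum>k<n. t k) - 2 * (\<Sum>k<n. eps k \<omega> * d k)" .
  have "\<bar>\<Sum>k<n. t k\<bar> \<le> (\<Sum>k<n. rem_term a \<eta> \<gamma> B c k \<omega>)"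
    by (rule order_trans[OF sum_abs sum_mono[OF t]])
  then have "\<bar>(\<Sum>k<n. t k) - 2 * (\<Sum>k<n. eps k \<omega> * d k)\<bar> \<le> (\<Sum>k<n. rem_term a \<eta> \<gamma> B c k \<omega>) + 2 * (z * r)"
    using sum_d by linarith
  then have "1 / r * \<bar>(\<Sum>k<n. t k) - 2 * (\<Sum>k<n. eps k \<omega> * d k)\<bar> \<le> 1 / r * ((\<Sum>k<n. rem_term a \<eta> \<gamma> B c k \<omega>) + 2 * (z * r))"
    using r by (intro mult_left_mono) auto
  also have "\<dots> = 2 * z + 1 / r * (\<Sum>k<n. rem_term a \<eta> \<gamma> B c k \<omega>)"
    using r by (simp add: field_simps)
  finally show ?thesis
    unfolding eq using r by (simp add: abs_mult a_def r_def)
qed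

text \<open>The recursion \<open>f\<close> may depend on \<open>\<omega>\<close> in an arbitrary, anticipating way: uniformity over the
  finite net takes care of this.\<close>

lemma remainder_negligible:
  fixes G :: "nat \<Rightarrow> 'w set" and lh :: "nat \<Rightarrow> 'w \<Rightarrow> nat \<Rightarrow> real"
  assumes A: "0 < A" and \<zeta>: "0 < \<zeta>" and l1 [measurable]: "l1 \<in> borel_measurable M"
    and G: "\<And>n \<omega>. 0 < n \<Longrightarrow> \<omega> \<in> G n \<Longrightarrow> \<omega> \<in> space M \<and> lh n \<omega> 0 = l1 \<omega> \<and>
       (\<exists>f. (\<forall>k. lh n \<omega> (Suc k) = f (lh n \<omega> k) (Y k \<omega>)) \<and>
         (\<forall>x x' i. \<bar>f x i - f x' i\<bar> \<le> \<kappa>1 * \<bar>x - x'\<bar>) \<and> (\<forall>x i. x \<le> 0 \<longrightarrow> f x i = f 0 i) \<and>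
         (\<forall>x i. 0 \<le> x \<longrightarrow> \<bar>f x i - g x i\<bar> \<le> A / sqrt (real n) * (x + real i + 1)))"
  shows "(\<lambda>n. prob {\<omega> \<in> G n. \<zeta> < \<bar>1 / sqrt (real n) *
      (\<Sum>k<n. (real (Y k \<omega>) - lh n \<omega> k)\<^sup>2 - (real (Y k \<omega>) - L k \<omega>)\<^sup>2)\<bar>}) \<longlonglongrightarrow> 0"
    (is "(\<lambda>n. prob (?R n)) \<longlonglongrightarrow> 0")
proof (rule LIMSEQ_I)
  fix \<tau> :: real assume \<tau>: "0 < \<tau>"
  define \<rho> where "\<rho> = 1 / (1 - \<kappa>1)"
  have \<rho>: "0 < \<rho>" unfolding \<rho>_def using kappa_nonneg kappa_sum by simp
  define e where "e = (\<integral>\<omega>. L 0 \<omega> \<partial>M)"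
  have e: "0 \<le> e" unfolding e_def by (intro integral_nonneg_AE AE_I2 L_nonneg)
  \<comment> \<open>Three error terms of size \<theta>, divided by \<zeta> / 2 in Markov's
    inequality, give \<tau> / 8.\<close>
  define \<theta> where "\<theta> = \<zeta> * \<tau> / 48"
  have \<theta>: "0 < \<theta>" using \<zeta> \<tau> by (simp add: \<theta>_def)
  \<comment> \<open>The starting value need not have moments, so its distance from
    \<open>L 0\<close> is bounded only outside an event of small probability.\<close>
  obtain c where c: "0 \<le> c" "prob {\<omega>\<in>space M. c < \<bar>l1 \<omega> - L 0 \<omega>\<bar>} < \<tau> / 4"
    using tight[of "\<lambda>\<omega>. l1 \<omega> - L 0 \<omega>" "\<tau> / 4"] \<tau> by auto
  have small: "x * (\<theta> / (x + 1)) \<le> \<theta>" "0 < \<theta> / (x + 1)" if "0 \<le> x" for x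
  proof -
    show "0 < \<theta> / (x + 1)" using \<theta> that by simp
    have "x * \<theta> \<le> \<theta> * (x + 1)" using \<theta> by (simp add: algebra_simps)
    then show "x * (\<theta> / (x + 1)) \<le> \<theta>" using that by (simp add: divide_le_eq)
  qed
  \<comment> \<open>The order of choices matters: \<gamma> and \<eta> depend on A only through fixed
    moments, B has to beat 1 / \<gamma>, and n comes last. The 1 in the denominators keeps them
    positive when a coefficient vanishes.\<close>
  define \<gamma> where "\<gamma> = \<theta> / (2 * A * \<rho> * e + 1)"
  have \<gamma>: "2 * A * \<rho> * e * \<gamma> \<le> \<theta>" "0 < \<gamma>"
    unfolding \<gamma>_def using A \<rho> e by (intro small; simp)+
  define \<eta> where "\<eta> = \<theta> / (4 * A * \<rho> * (1 + e) + 1)"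
  have \<eta>: "4 * A * \<rho> * (1 + e) * \<eta> \<le> \<theta>" "0 < \<eta>"
    unfolding \<eta>_def using A \<rho> e by (intro small; simp)+
  obtain B where B: "0 \<le> B" "2 * A * \<rho> / \<gamma> * ((\<integral>\<omega>. (wtail B 0 \<omega>)\<^sup>2 \<partial>M) * \<rho>\<^sup>2) \<le> \<theta>"
  proof -
    have "(\<lambda>m. 2 * A * \<rho> / \<gamma> * ((\<integral>\<omega>. (wtail (real m) 0 \<omega>)\<^sup>2 \<partial>M) * \<rho>\<^sup>2)) \<longlonglongrightarrow> 2 * A * \<rho> / \<gamma> * (0 * \<rho>\<^sup>2)"
      by (intro tendsto_intros wtail_tendsto_0)
    then have "(\<lambda>m. 2 * A * \<rho> / \<gamma> * ((\<integral>\<omega>. (wtail (real m) 0 \<omega>)\<^sup>2 \<partial>M) * \<rho>\<^sup>2)) \<longlonglongrightarrow> 0" by simp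
    from LIMSEQ_D[OF this \<theta>] obtain m where "norm (2 * A * \<rho> / \<gamma> * ((\<integral>\<omega>. (wtail (real m) 0 \<omega>)\<^sup>2 \<partial>M) * \<rho>\<^sup>2) - 0) < \<theta>"
      by blast
    then have "2 * A * \<rho> / \<gamma> * ((\<integral>\<omega>. (wtail (real m) 0 \<omega>)\<^sup>2 \<partial>M) * \<rho>\<^sup>2) \<le> \<theta>"
      by (simp only: real_norm_def diff_0_right abs_less_iff less_imp_le)
    then show thesis by (rule that[OF of_nat_0_le_iff])
  qed
  define T where "T = (\<integral>\<omega>. (wtail B 0 \<omega>)\<^sup>2 \<partial>M) * \<rho>\<^sup>2"
  define q2 where "q2 = (2 * c * (1 + e) + 6 * c\<^sup>2) * \<rho> + A\<^sup>2 * (2 * (B * \<rho>)\<^sup>2 + 24 * \<eta>\<^sup>2 * \<rho>\<^sup>2 + 6 * \<rho>\<^sup>2 * T)"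
  have q1: "A * (4 * \<eta> * \<rho> * (1 + e) + 2 * \<rho> * (\<gamma> * e + T / \<gamma>)) \<le> 3 * \<theta>"
  proof -
    have "A * (4 * \<eta> * \<rho> * (1 + e) + 2 * \<rho> * (\<gamma> * e + T / \<gamma>))
        = 4 * A * \<rho> * (1 + e) * \<eta> + 2 * A * \<rho> * e * \<gamma> + 2 * A * \<rho> / \<gamma> * T"
      by (simp add: algebra_simps)
    then show ?thesis using \<gamma>(1) \<eta>(1) B(2)[folded T_def] by linarith
  qed
  define Q where "Q n \<omega> = 1 / sqrt (real n) * (\<Sum>k<n. rem_term (A / sqrt (real n)) \<eta> \<gamma> B c k \<omega>)" for n \<omega>
  define \<delta> where "\<delta> n = A / sqrt (real n) * \<eta>" for n
  define b where "b n = A / sqrt (real n) * (B / (1 - \<kappa>1))" for n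
  \<comment> \<open>The innovation sum enters the remainder with factor 2, so the level \<zeta> / 4
    uses half of \<zeta>; the other half is left to \<open>Q n\<close>.\<close>
  define N where "N n = {\<omega>\<in>space M. \<exists>m\<in>net_index (\<delta> n) \<eta> B.
      \<zeta> / 4 * sqrt (real n) < \<bar>\<Sum>k<n. eps k \<omega> * pertp (net_fun g (\<delta> n) m) (b n) B k \<omega>\<bar>}" for n
  have limN: "(\<lambda>n. prob (N n)) \<longlonglongrightarrow> 0"
    unfolding N_def \<delta>_def b_def using \<zeta> by (intro net_deviation_tendsto_0 A \<eta>(2) B(1)) simp
  have N_meas: "N n \<in> sets M" for n
  proof -
    have [measurable]: "pertp (net_fun g (\<delta> n) m) (b n) B k \<in> borel_measurable M" for m k
      by (rule pertp_measurable[OF net_fun_measurable])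
    have "N n = (\<Union>m\<in>net_index (\<delta> n) \<eta> B. {\<omega>\<in>space M.
      \<zeta> / 4 * sqrt (real n) < \<bar>\<Sum>k<n. eps k \<omega> * pertp (net_fun g (\<delta> n) m) (b n) B k \<omega>\<bar>})"
      by (auto simp: N_def)
    also have "\<dots> \<in> sets M" by (intro sets.finite_UN finite_net_index) measurable
    finally show ?thesis .
  qed
  have s0: "(\<lambda>n. 1 / sqrt (real n)) \<longlonglongrightarrow> 0"
    by (intro tendsto_divide_0[OF tendsto_const] filterlim_at_top_imp_at_infinity
        filterlim_compose[OF sqrt_at_top filterlim_real_sequentially])
  have lim_b: "b \<longlonglongrightarrow> 0"
  proof -
    have "(\<lambda>n. A * (B / (1 - \<kappa>1)) * (1 / sqrt (real n))) \<longlonglongrightarrow> A * (B / (1 - \<kappa>1)) * 0"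
      by (intro tendsto_intros s0)
    then show ?thesis by (simp add: b_def[abs_def] mult.commute)
  qed
  have lim_q: "(\<lambda>n. 2 * q2 / \<zeta> * (1 / sqrt (real n))) \<longlonglongrightarrow> 0"
    by (rule tendsto_mult_right_zero[OF s0])
  have "\<forall>\<^sub>F n in sequentially. 0 < n \<and> prob (N n) < \<tau> / 4 \<and> b n < 1 \<and> 2 * q2 / \<zeta> * (1 / sqrt (real n)) < \<tau> / 8"
    using \<tau> by (intro eventually_conj eventually_gt_at_top order_tendstoD(2)[OF limN] order_tendstoD(2)[OF lim_b]
        order_tendstoD(2)[OF lim_q]) auto
  then obtain n0 where n0: "\<And>n. n0 \<le> n \<Longrightarrow> 0 < n \<and> prob (N n) < \<tau> / 4 \<and> b n < 1 \<and> 2 * q2 / \<zeta> * (1 / sqrt (real n)) < \<tau> / 8"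
    unfolding eventually_sequentially by blast
  have "norm (prob (?R n) - 0) < \<tau>" if "n0 \<le> n" for n
  proof -
    from n0[OF that] have n: "0 < n" and pN: "prob (N n) < \<tau> / 4" and bn: "b n \<le> 1"
      and qn: "2 * q2 / \<zeta> * (1 / sqrt (real n)) < \<tau> / 8" by auto
    have Q_int: "integrable M (Q n)"
      unfolding Q_def using rem_term_integrable by simp
    have Q0: "0 \<le> Q n \<omega>" for \<omega>
      unfolding Q_def using A \<eta> \<gamma> c by (intro mult_nonneg_nonneg sum_nonneg rem_term_nonneg) auto
    have "prob {\<omega>\<in>space M. \<zeta> / 2 < Q n \<omega>} \<le> (\<integral>\<omega>. Q n \<omega> \<partial>M) / (\<zeta> / 2)"
      using Q_int Q0 \<zeta> by (intro markov_real) auto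
    also have "\<dots> \<le> (3 * \<theta> + q2 / sqrt (real n)) / (\<zeta> / 2)"
    proof (intro divide_right_mono)
      show "(\<integral>\<omega>. Q n \<omega> \<partial>M) \<le> 3 * \<theta> + q2 / sqrt (real n)"
        using rem_sum_expectation[of A \<eta> \<gamma> c n B] A \<eta> \<gamma> c n q1
        unfolding Q_def q2_def T_def \<rho>_def e_def by linarith
    qed (use \<zeta> in auto)
    also have "\<dots> = \<tau> / 8 + 2 * q2 / \<zeta> * (1 / sqrt (real n))"
      using \<zeta> by (simp add: \<theta>_def add_divide_distrib mult.commute)
    finally have pQ: "prob {\<omega>\<in>space M. \<zeta> / 2 < Q n \<omega>} < \<tau> / 4"
      using qn by linarith
    have Qm [measurable]: "Q n \<in> borel_measurable M" using Q_int by simp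
    obtain Z where Z: "Z \<in> null_sets M" "\<And>\<omega>. \<omega> \<in> space M - Z \<Longrightarrow> \<forall>k. L (Suc k) \<omega> = g (L k \<omega>) (Y k \<omega>)"
      using AE_rec by (auto elim!: AE_E3)
    \<comment> \<open>A null set and three events of probability below \<tau> / 4 cover the large
      remainders. Measurability is required of the covering set only, so \<open>lh\<close> may be
      arbitrary.\<close>
    have "?R n \<subseteq> ((Z \<union> N n) \<union> {\<omega>\<in>space M. c < \<bar>l1 \<omega> - L 0 \<omega>\<bar>}) \<union> {\<omega>\<in>space M. \<zeta> / 2 < Q n \<omega>}"
    proof (rule subsetI, rule ccontr)
      fix \<omega> assume R: "\<omega> \<in> ?R n"
        and not: "\<omega> \<notin> ((Z \<union> N n) \<union> {\<omega>\<in>space M. c < \<bar>l1 \<omega> - L 0 \<omega>\<bar>}) \<union> {\<omega>\<in>space M. \<zeta> / 2 < Q n \<omega>}"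
      from G[OF n, of \<omega>] R obtain f where \<omega>: "\<omega> \<in> space M" and l0: "lh n \<omega> 0 = l1 \<omega>"
        and lh: "\<And>k. lh n \<omega> (Suc k) = f (lh n \<omega> k) (Y k \<omega>)"
        and f1: "\<And>x x' i. \<bar>f x i - f x' i\<bar> \<le> \<kappa>1 * \<bar>x - x'\<bar>" and f2: "\<And>x i. x \<le> 0 \<Longrightarrow> f x i = f 0 i"
        and f3: "\<And>x i. 0 \<le> x \<Longrightarrow> \<bar>f x i - g x i\<bar> \<le> A / sqrt (real n) * (x + real i + 1)"
        by blast
      have rec': "L (Suc k) \<omega> = g (L k \<omega>) (Y k \<omega>)" for k using Z(2)[of \<omega>] \<omega> not by auto
      have D: "\<bar>lh n \<omega> 0 - L 0 \<omega>\<bar> \<le> c" using not \<omega> by (auto simp: l0)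
      have QQ: "Q n \<omega> \<le> \<zeta> / 2" using not \<omega> by auto
      have "\<bar>1 / sqrt (real n) * (\<Sum>k<n. (real (Y k \<omega>) - lh n \<omega> k)\<^sup>2 - (real (Y k \<omega>) - L k \<omega>)\<^sup>2)\<bar>
        \<le> 2 * (\<zeta> / 4) + Q n \<omega>"
        unfolding Q_def
      proof (rule remainder_le[OF \<omega> rec' A \<eta>(2) \<gamma>(2) B(1) n _ D lh f1 f2 f3])
        fix m assume "m \<in> net_index (A / sqrt (real n) * \<eta>) \<eta> B"
        then show "\<bar>\<Sum>k<n. eps k \<omega> * pertp (net_fun g (A / sqrt (real n) * \<eta>) m) (A / sqrt (real n) * (B / (1 - \<kappa>1))) B k \<omega>\<bar>
          \<le> \<zeta> / 4 * sqrt (real n)"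
          using not \<omega> unfolding N_def \<delta>_def b_def by (auto simp: not_less)
      qed (use bn in \<open>simp add: b_def\<close>)
      also have "\<dots> \<le> \<zeta>" using QQ by simp
      finally show False using R by simp
    qed
    then have "prob (?R n) \<le> prob (((Z \<union> N n) \<union> {\<omega>\<in>space M. c < \<bar>l1 \<omega> - L 0 \<omega>\<bar>}) \<union> {\<omega>\<in>space M. \<zeta> / 2 < Q n \<omega>})"
      using Z(1) N_meas by (intro finite_measure_mono) (auto simp: null_sets_def)
    also have "\<dots> \<le> ((prob Z + prob (N n)) + prob {\<omega>\<in>space M. c < \<bar>l1 \<omega> - L 0 \<omega>\<bar>}) + prob {\<omega>\<in>space M. \<zeta> / 2 < Q n \<omega>}"
      using Z(1) N_meas
      by (intro order_trans[OF measure_Un_le] add_mono order_refl) (auto simp: null_sets_def)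
    also have "prob Z = 0" using Z(1) by (simp add: null_sets_def measure_def)
    finally show ?thesis using pN pQ c(2) \<tau> by simp
  qed
  then show "\<exists>n0. \<forall>n\<ge>n0. norm (prob (?R n) - 0) < \<tau>" by blast
qed

end

section \<open>The sigma-algebra of the past\<close>

lemma
  shows space_past_sigma: "space (past_sigma M lam N t) = space M"
    and sets_past_sigma: "sets (past_sigma M lam N t) = sigma_sets (space M)
      ((\<Union>s\<in>{..t-1}. {lam s -` B \<inter> space M | B. B \<in> sets borel}) \<union>
       (\<Union>s\<in>{..t-1}. {N s -` B \<inter> space M | B. B \<subseteq> (UNIV :: nat set)}))"
proof -
  have "((\<Union>s\<in>{..t-1}. {lam s -` B \<inter> space M | B. B \<in> sets borel}) \<union>
       (\<Union>s\<in>{..t-1}. {N s -` B \<inter> space M | B. B \<subseteq> (UNIV :: nat set)})) \<subseteq> Pow (space M)" by auto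
  then show "space (past_sigma M lam N t) = space M"
    and "sets (past_sigma M lam N t) = sigma_sets (space M)
      ((\<Union>s\<in>{..t-1}. {lam s -` B \<inter> space M | B. B \<in> sets borel}) \<union>
       (\<Union>s\<in>{..t-1}. {N s -` B \<inter> space M | B. B \<subseteq> (UNIV :: nat set)}))"
    unfolding past_sigma_def by (auto simp: space_measure_of sets_measure_of)
qed

lemma subalgebra_past_sigma:
  assumes "\<And>t. lam t \<in> borel_measurable M" "\<And>t. N t \<in> measurable M (count_space UNIV)"
  shows "subalgebra M (past_sigma M lam N t)"
  unfolding subalgebra_def
proof
  show "sets (past_sigma M lam N t) \<subseteq> sets M"
    unfolding sets_past_sigma
    using measurable_sets[OF assms(1)] measurable_sets[OF assms(2)]
    by (intro sets.sigma_sets_subset) auto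
qed (rule space_past_sigma)

lemma sets_past_sigma_mono: "t \<le> t' \<Longrightarrow> sets (past_sigma M lam N t) \<subseteq> sets (past_sigma M lam N t')"
  unfolding sets_past_sigma by (intro sigma_sets_mono' Un_mono UN_mono) auto

lemma lam_measurable_past_sigma: "s < t \<Longrightarrow> lam s \<in> borel_measurable (past_sigma M lam N t)"
proof (rule measurableI)
  fix B :: "real set" assume "s < t" "B \<in> sets borel"
  then show "lam s -` B \<inter> space (past_sigma M lam N t) \<in> sets (past_sigma M lam N t)"
    unfolding space_past_sigma sets_past_sigma by (intro sigma_sets.Basic UnI1 UN_I[of s]) auto
qed simp

lemma N_measurable_past_sigma: "s < t \<Longrightarrow> N s \<in> measurable (past_sigma M lam N t) (count_space UNIV)"
proof (rule measurableI)
  fix B :: "nat set" assume "s < t"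
  then show "N s -` B \<inter> space (past_sigma M lam N t) \<in> sets (past_sigma M lam N t)"
    unfolding space_past_sigma sets_past_sigma by (intro sigma_sets.Basic UnI2 UN_I[of s]) auto
qed simp

section \<open>The limit distribution of the statistic\<close>

theorem theorem4p4:
  fixes M :: "'w measure"
    and \<Theta> :: "(real ^ 'd) set"
    and f :: "real ^ 'd \<Rightarrow> real \<Rightarrow> nat \<Rightarrow> real"
    and \<theta>0 :: "real ^ 'd"
    and \<delta> C \<kappa>1 \<kappa>2 :: real
    and lam :: "int \<Rightarrow> 'w \<Rightarrow> real"
    and N :: "int \<Rightarrow> 'w \<Rightarrow> nat"
    and \<theta>hat :: "nat \<Rightarrow> 'w \<Rightarrow> real ^ 'd"
    and lam1 :: "'w \<Rightarrow> real"
  assumes P: "prob_space M"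
    and f_nonneg: "\<And>\<theta> l y. \<theta> \<in> \<Theta> \<Longrightarrow> l \<ge> 0 \<Longrightarrow> f \<theta> l y \<ge> 0"
    and f_meas: "\<And>y. (\<lambda>(\<theta>, l). f \<theta> l y) \<in> borel_measurable borel"
    and \<theta>0_in: "\<theta>0 \<in> \<Theta>"
    and \<delta>_pos: "\<delta> > 0"
    and \<kappa>_nonneg: "\<kappa>1 \<ge> 0" "\<kappa>2 \<ge> 0" and \<kappa>_sum: "\<kappa>1 + \<kappa>2 < 1"
    and lip_theta: "\<And>\<theta>' l y. \<theta>' \<in> \<Theta> \<Longrightarrow> norm (\<theta>' - \<theta>0) \<le> \<delta> \<Longrightarrow> l \<ge> 0 \<Longrightarrow>
          \<bar>f \<theta>' l y - f \<theta>0 l y\<bar> \<le> C * norm (\<theta>' - \<theta>0) * (l + real y + 1)"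
    and contr: "\<And>\<theta>' l l' y y'. \<theta>' \<in> \<Theta> \<Longrightarrow> norm (\<theta>' - \<theta>0) \<le> \<delta> \<Longrightarrow> l \<ge> 0 \<Longrightarrow> l' \<ge> 0 \<Longrightarrow>
          \<bar>f \<theta>' l y - f \<theta>' l' y'\<bar> \<le> \<kappa>1 * \<bar>l - l'\<bar> + \<kappa>2 * \<bar>real y - real y'\<bar>"
    and lam_meas: "\<And>t. lam t \<in> borel_measurable M"
    and N_meas: "\<And>t. N t \<in> measurable M (count_space UNIV)"
    and lam_nonneg: "\<And>t \<omega>. \<omega> \<in> space M \<Longrightarrow> lam t \<omega> \<ge> 0"
    and stat: "strictly_stationary M lam N"
    and cond_poisson: "\<And>t k. AE \<omega> in M.
          real_cond_exp M (past_sigma M lam N t) (indicator {\<omega>\<in>space M. N t \<omega> = k}) \<omega>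
          = poisson_prob (lam t \<omega>) k"
    and recursion: "\<And>t. AE \<omega> in M. lam t \<omega> = f \<theta>0 (lam (t - 1) \<omega>) (N (t - 1) \<omega>)"
    and \<theta>hat_meas: "\<And>n. \<theta>hat n \<in> borel_measurable M"
    and \<theta>hat_in: "\<And>n \<omega>. \<omega> \<in> space M \<Longrightarrow> \<theta>hat n \<omega> \<in> \<Theta>"
    and \<theta>hat_rate: "bounded_in_prob M (\<lambda>n \<omega>. norm (\<theta>hat n \<omega> - \<theta>0)) (\<lambda>n. 1 / sqrt (real n))"
    and lam1_meas: "lam1 \<in> borel_measurable M"
    and lam1_nonneg: "\<And>\<omega>. \<omega> \<in> space M \<Longrightarrow> lam1 \<omega> \<ge> 0"
  shows "weak_conv_m
           (\<lambda>n. distr M borel (\<lambda>\<omega>. T_stat f (\<theta>hat n \<omega>) (lam1 \<omega>) (\<lambda>t. N t \<omega>) n))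
           (normal_measure 0 (2 * prob_space.expectation M (\<lambda>\<omega>. (lam 1 \<omega>)\<^sup>2)))"
proof -
  interpret prob_space M by (rule P)
  note [measurable] = lam_meas N_meas \<theta>hat_meas lam1_meas
  \<comment> \<open>Index k stands for time k + 1, as in \<open>lam_hat\<close>; \<open>F k\<close>
    is generated by all times up to k.\<close>
  define F where "F k = past_sigma M lam N (int k + 1)" for k
  \<comment> \<open>The recursion holds only almost surely; this version of \<open>lam (int k + 1)\<close> is measurable
    with respect to the past.\<close>
  define L where "L k \<omega> = f \<theta>0 (lam (int k) \<omega>) (N (int k) \<omega>)" for k \<omega>
  define Y where "Y k \<omega> = N (int k + 1) \<omega>" for k \<omega>
  \<comment> \<open>The cut at 0 extends the map to the whole line without increasing its Lipschitz
    constants.\<close>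
  define g where "g l y = f \<theta>0 (max 0 l) y" for l y
  have L_lam: "AE \<omega> in M. lam (int k + 1) \<omega> = L k \<omega>" for k
    using recursion[of "int k + 1"] by (simp add: L_def)
  have sub: "subalgebra M (past_sigma M lam N t)" for t
    by (rule subalgebra_past_sigma[OF lam_meas N_meas])
  have f0_meas [measurable]: "(\<lambda>l. f \<theta>0 l y) \<in> borel_measurable borel" for y
  proof -
    have "(\<lambda>l. (\<theta>0, l)) \<in> borel_measurable borel"
      by (intro borel_measurable_continuous_onI continuous_intros)
    from measurable_compose[OF this f_meas[of y]] show ?thesis by simp
  qed
  have L_F: "L k \<in> borel_measurable (F k)" for k
  proof -
    have l: "lam (int k) \<in> borel_measurable (F k)" and y: "N (int k) \<in> measurable (F k) (count_space UNIV)"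
      unfolding F_def by (intro lam_measurable_past_sigma N_measurable_past_sigma; simp)+
    show ?thesis
      unfolding L_def by (rule measurable_compose_countable[OF measurable_compose[OF l f0_meas] y])
  qed
  have L_meas [measurable]: "L k \<in> borel_measurable M" for k
    using L_F[of k] unfolding F_def by (rule measurable_from_subalg[OF sub])
  have L_nn: "0 \<le> L k \<omega>" if "\<omega> \<in> space M" for k \<omega>
    unfolding L_def by (rule f_nonneg[OF \<theta>0_in lam_nonneg[OF that]])
  interpret pc: poisson_chain M F L Y g \<kappa>1 \<kappa>2
  proof
    show "subalgebra M (F k)" for k unfolding F_def by (rule sub)
    show "sets (F k) \<subseteq> sets (F (Suc k))" for k unfolding F_def by (rule sets_past_sigma_mono) simp
    show "L k \<in> borel_measurable (F k)" for k by (rule L_F)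
    show "Y k \<in> measurable (F (Suc k)) (count_space UNIV)" for k
      unfolding F_def Y_def by (rule N_measurable_past_sigma) simp
    show "0 \<le> L k \<omega>" if "\<omega> \<in> space M" for k \<omega> by (rule L_nn[OF that])
    show "0 \<le> g l y" for l y unfolding g_def by (intro f_nonneg[OF \<theta>0_in]) simp
    show "0 \<le> \<kappa>1" "0 \<le> \<kappa>2" "\<kappa>1 + \<kappa>2 < 1" by (rule \<kappa>_nonneg \<kappa>_sum)+
    show "\<bar>g l y - g l' y'\<bar> \<le> \<kappa>1 * \<bar>l - l'\<bar> + \<kappa>2 * \<bar>real y - real y'\<bar>" for l l' y y'
    proof -
      have "\<bar>g l y - g l' y'\<bar> \<le> \<kappa>1 * \<bar>max 0 l - max 0 l'\<bar> + \<kappa>2 * \<bar>real y - real y'\<bar>"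
        unfolding g_def using \<delta>_pos by (intro contr[OF \<theta>0_in]) auto
      also have "\<dots> \<le> \<kappa>1 * \<bar>l - l'\<bar> + \<kappa>2 * \<bar>real y - real y'\<bar>"
        using \<kappa>_nonneg by (intro add_right_mono mult_left_mono) auto
      finally show ?thesis .
    qed
    show "AE \<omega> in M. L (Suc k) \<omega> = g (L k \<omega>) (Y k \<omega>)" for k
      using L_lam[of k] AE_space
    proof eventually_elim
      case (elim \<omega>)
      then show ?case using L_nn[of \<omega> k]
        by (simp add: L_def[of "Suc k"] g_def Y_def max_absorb2 add.commute[of 1])
    qed
    show "distr M borel (L k) = distr M borel (L 0)" for k
    proof -
      \<comment> \<open>\<open>L k\<close> is one fixed measurable function \<phi> of the pair at
        time k, so stationarity of a single coordinate, with the index set {0} shifted by k, is what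
        has to be transported.\<close>
      let ?S = "PiM {0::int} (\<lambda>_. borel \<Otimes>\<^sub>M count_space UNIV) :: (int \<Rightarrow> real \<times> nat) measure"
      define \<phi> where "\<phi> x = (case x (0::int) of (l, y) \<Rightarrow> f \<theta>0 l y)" for x :: "int \<Rightarrow> real \<times> nat"
      have "(\<lambda>z. f \<theta>0 (fst z) (snd z)) \<in> borel_measurable (borel \<Otimes>\<^sub>M count_space UNIV)"
        by (rule measurable_compose_countable[where g=snd and f="\<lambda>y z. f \<theta>0 (fst z) y"]) measurable
      then have \<phi>: "\<phi> \<in> borel_measurable ?S"
        unfolding \<phi>_def case_prod_beta' by (intro measurable_compose[OF measurable_component_singleton]) auto
      have shift: "(\<lambda>\<omega>. \<lambda>t\<in>{0::int}. (lam (t + h) \<omega>, N (t + h) \<omega>)) \<in> measurable M ?S" for h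
        by (intro measurable_restrict) measurable
      have rep: "distr M borel (\<lambda>\<omega>. f \<theta>0 (lam h \<omega>) (N h \<omega>))
          = distr (distr M ?S (\<lambda>\<omega>. \<lambda>t\<in>{0}. (lam (t + h) \<omega>, N (t + h) \<omega>))) borel \<phi>" for h
        by (subst distr_distr[OF \<phi> shift]) (simp add: comp_def \<phi>_def)
      have "distr M ?S (\<lambda>\<omega>. \<lambda>t\<in>{0}. (lam (t + h) \<omega>, N (t + h) \<omega>)) = distr M ?S (\<lambda>\<omega>. \<lambda>t\<in>{0}. (lam t \<omega>, N t \<omega>))" for h
        using stat unfolding strictly_stationary_def by blast
      then have "distr M ?S (\<lambda>\<omega>. \<lambda>t\<in>{0}. (lam (t + int k) \<omega>, N (t + int k) \<omega>))
          = distr M ?S (\<lambda>\<omega>. \<lambda>t\<in>{0}. (lam (t + int 0) \<omega>, N (t + int 0) \<omega>))" by metis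
      then show ?thesis unfolding L_def rep by simp
    qed
    show "emeasure M (A \<inter> Y k -` {j}) = (\<integral>\<^sup>+\<omega>. ennreal (poisson_prob (L k \<omega>) j) * indicator A \<omega> \<partial>M)"
      if A: "A \<in> sets (F k)" for A k j
    proof -
      interpret fs: finite_measure_subalgebra M "F k"
        by (intro finite_measure_subalgebra.intro finite_measure_subalgebra_axioms.intro finite_measure_axioms)
          (simp add: F_def sub)
      let ?E = "{\<omega>\<in>space M. N (int k + 1) \<omega> = j}"
      have E: "?E \<in> sets M" by measurable
      have AM [measurable]: "A \<in> sets M" using A sub[of "int k + 1"] by (auto simp: subalgebra_def F_def)
      have AE_eq: "AE \<omega> in M. real_cond_exp M (F k) (indicator ?E) \<omega> = poisson_prob (L k \<omega>) j"
        using cond_poisson[of "int k + 1" j] L_lam[of k] unfolding F_def by eventually_elim simp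
      have p: "0 \<le> poisson_prob (L k \<omega>) j" "poisson_prob (L k \<omega>) j \<le> 1" if "\<omega> \<in> space M" for \<omega>
        using pmf_le_1[of "pois (L k \<omega>)" j] by (simp_all add: poisson_prob_nonneg L_nn that pmf_pois)
      have pm [measurable]: "(\<lambda>\<omega>. poisson_prob (L k \<omega>) j) \<in> borel_measurable M"
        by (rule measurable_compose[OF L_meas poisson_prob_measurable])
      \<comment> \<open>Integrating the conditional probability over the event A of the past turns
        the almost sure hypothesis into the identity of measures required by
        \<open>kernel\<close>.\<close>
      have "measure M (A \<inter> ?E) = (\<integral>\<omega>\<in>A. indicator ?E \<omega> \<partial>M)"
        unfolding set_lebesgue_integral_def by (simp add: indicator_inter_arith[symmetric] E)
      also have "\<dots> = (\<integral>\<omega>\<in>A. real_cond_exp M (F k) (indicator ?E) \<omega> \<partial>M)"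
        using E A by (intro fs.real_cond_exp_intA) (auto simp: emeasure_eq_measure intro!: integrable_real_indicator)
      also have "\<dots> = (\<integral>\<omega>. poisson_prob (L k \<omega>) j * indicator A \<omega> \<partial>M)"
        unfolding set_lebesgue_integral_def
        using AE_eq by (intro integral_cong_AE) (auto simp: mult.commute)
      finally have m: "measure M (A \<inter> ?E) = (\<integral>\<omega>. poisson_prob (L k \<omega>) j * indicator A \<omega> \<partial>M)" .
      have AY: "A \<inter> Y k -` {j} = A \<inter> ?E"
        using sets.sets_into_space[OF AM] by (auto simp: Y_def)
      have "(\<integral>\<^sup>+\<omega>. ennreal (poisson_prob (L k \<omega>) j) * indicator A \<omega> \<partial>M)
          = (\<integral>\<^sup>+\<omega>. ennreal (poisson_prob (L k \<omega>) j * indicator A \<omega>) \<partial>M)"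
        by (intro nn_integral_cong) (auto simp: indicator_def)
      also have "\<dots> = ennreal (\<integral>\<omega>. poisson_prob (L k \<omega>) j * indicator A \<omega> \<partial>M)"
      proof (rule nn_integral_eq_integral)
        show "integrable M (\<lambda>\<omega>. poisson_prob (L k \<omega>) j * indicator A \<omega>)"
          using p by (intro integrable_const_bound[where B=1]) (auto simp: indicator_def)
        show "AE \<omega> in M. 0 \<le> poisson_prob (L k \<omega>) j * indicator A \<omega>"
          using p by (intro AE_I2) auto
      qed
      finally show ?thesis by (simp add: AY m[symmetric] emeasure_eq_measure)
    qed
  qed
  define v where "v = (\<integral>\<omega>. (L 0 \<omega>)\<^sup>2 \<partial>M)"
  have v: "(\<integral>\<omega>. (lam 1 \<omega>)\<^sup>2 \<partial>M) = v"
    unfolding v_def using L_lam[of 0] by (intro integral_cong_AE) auto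
  define lh where "lh n \<omega> k = lam_hat f (\<theta>hat n \<omega>) (lam1 \<omega>) (\<lambda>t. N t \<omega>) k" for n \<omega> k
  define T0 where "T0 n \<omega> = 1 / sqrt (real n) * (\<Sum>k<n. pc.Xi k \<omega>)" for n \<omega>
  define T where "T n \<omega> = T_stat f (\<theta>hat n \<omega>) (lam1 \<omega>) (\<lambda>t. N t \<omega>) n" for n \<omega>
  have lh_nonneg: "0 \<le> lh n \<omega> k" if "\<omega> \<in> space M" for n \<omega> k
    using that unfolding lh_def by (induction k) (simp_all add: lam1_nonneg f_nonneg \<theta>hat_in)
  have lh_meas [measurable]: "(\<lambda>\<omega>. lh n \<omega> k) \<in> borel_measurable M" for n k
  proof (induction k)
    case (Suc k)
    have pair: "(\<lambda>\<omega>. (\<theta>hat n \<omega>, lh n \<omega> k)) \<in> borel_measurable M"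
      by (intro borel_measurable_Pair \<theta>hat_meas Suc.IH)
    have "(\<lambda>\<omega>. f (\<theta>hat n \<omega>) (lh n \<omega> k) y) \<in> borel_measurable M" for y
      using measurable_compose[OF pair f_meas[of y]] by simp
    from measurable_compose_countable[OF this N_meas] show ?case by (simp add: lh_def)
  qed (simp add: lh_def)
  have T_meas [measurable]: "T n \<in> borel_measurable M" for n
    unfolding T_def T_stat_def lh_def[symmetric] by measurable
  have T0_meas [measurable]: "T0 n \<in> borel_measurable M" for n
    unfolding T0_def by measurable
  have diff: "T n \<omega> - T0 n \<omega> = 1 / sqrt (real n) * (\<Sum>k<n. (real (Y k \<omega>) - lh n \<omega> k)\<^sup>2 - (real (Y k \<omega>) - L k \<omega>)\<^sup>2)" for n \<omega>
    unfolding T_def T_stat_def T0_def right_diff_distrib[symmetric] sum_subtractf[symmetric]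
    by (simp add: pc.Xi_def disp_def lh_def Y_def)
  have close: "(\<lambda>n. prob {\<omega>\<in>space M. \<zeta> < \<bar>T n \<omega> - T0 n \<omega>\<bar>}) \<longlonglongrightarrow> 0" if \<zeta>: "0 < \<zeta>" for \<zeta>
  proof (rule LIMSEQ_I)
    fix \<tau> :: real assume \<tau>: "0 < \<tau>"
    obtain K n1 where K: "\<And>n. n1 \<le> n \<Longrightarrow> prob {\<omega>\<in>space M. \<bar>norm (\<theta>hat n \<omega> - \<theta>0) / (1 / sqrt (real n))\<bar> > K} < \<tau> / 2"
      using \<theta>hat_rate \<tau> unfolding bounded_in_prob_def by (meson half_gt_zero)
    \<comment> \<open>The level from boundedness in probability may be negative, as may C; absolute
      values and the added 1 make \<open>A\<close> strictly positive.\<close>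
    define K' where "K' = \<bar>K\<bar> + 1"
    define A where "A = (\<bar>C\<bar> + 1) * K'"
    have A: "0 < A" unfolding A_def K'_def by (intro mult_pos_pos) auto
    \<comment> \<open>On this event both Lipschitz hypotheses are available at the estimator, and
      its distance from \<theta>0 is at most K' / sqrt n.\<close>
    define G where "G n = {\<omega>\<in>space M. norm (\<theta>hat n \<omega> - \<theta>0) \<le> min \<delta> (K' / sqrt (real n))}" for n
    have [measurable]: "G n \<in> sets M" for n unfolding G_def by measurable
    have "(\<lambda>n. prob {\<omega> \<in> G n. \<zeta> < \<bar>1 / sqrt (real n) * (\<Sum>k<n. (real (Y k \<omega>) - lh n \<omega> k)\<^sup>2 - (real (Y k \<omega>) - L k \<omega>)\<^sup>2)\<bar>}) \<longlonglongrightarrow> 0"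
    proof (rule pc.remainder_negligible[OF A \<zeta> lam1_meas])
      fix n \<omega> assume n: "0 < n" and "\<omega> \<in> G n"
      then have \<omega>: "\<omega> \<in> space M" and near: "norm (\<theta>hat n \<omega> - \<theta>0) \<le> \<delta>" "norm (\<theta>hat n \<omega> - \<theta>0) \<le> K' / sqrt (real n)"
        by (auto simp: G_def)
      \<comment> \<open>The recursion frozen at this outcome. The estimated intensities are
        nonnegative, so the cut at 0 does not change them, and it makes h constant on the negative
        half line.\<close>
      define h where "h x i = f (\<theta>hat n \<omega>) (max 0 x) i" for x i
      have h1: "lh n \<omega> (Suc k) = h (lh n \<omega> k) (Y k \<omega>)" for k
        using lh_nonneg[OF \<omega>, of n k] by (simp add: lh_def h_def Y_def max_absorb2)
      have h2: "\<bar>h x i - h x' i\<bar> \<le> \<kappa>1 * \<bar>x - x'\<bar>" for x x' i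
      proof -
        have "\<bar>h x i - h x' i\<bar> \<le> \<kappa>1 * \<bar>max 0 x - max 0 x'\<bar> + \<kappa>2 * \<bar>real i - real i\<bar>"
          unfolding h_def by (intro contr[OF \<theta>hat_in[OF \<omega>] near(1)]) auto
        also have "\<dots> \<le> \<kappa>1 * \<bar>x - x'\<bar>" using \<kappa>_nonneg by (auto intro!: mult_left_mono)
        finally show ?thesis .
      qed
      have h3: "h x i = h 0 i" if "x \<le> 0" for x i using that by (simp add: h_def max_absorb1)
      have h4: "\<bar>h x i - g x i\<bar> \<le> A / sqrt (real n) * (x + real i + 1)" if x: "0 \<le> x" for x i
      proof -
        have "\<bar>h x i - g x i\<bar> \<le> C * norm (\<theta>hat n \<omega> - \<theta>0) * (x + real i + 1)"
          using lip_theta[OF \<theta>hat_in[OF \<omega>] near(1) x, of i] x by (simp add: h_def g_def max_absorb2)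
        also have "C * norm (\<theta>hat n \<omega> - \<theta>0) \<le> (\<bar>C\<bar> + 1) * (K' / sqrt (real n))"
          by (intro mult_mono near) auto
        also have "\<dots> = A / sqrt (real n)" by (simp add: A_def)
        finally show ?thesis using x by (simp add: mult_right_mono)
      qed
      show "\<omega> \<in> space M \<and> lh n \<omega> 0 = lam1 \<omega> \<and>
         (\<exists>f. (\<forall>k. lh n \<omega> (Suc k) = f (lh n \<omega> k) (Y k \<omega>)) \<and>
           (\<forall>x x' i. \<bar>f x i - f x' i\<bar> \<le> \<kappa>1 * \<bar>x - x'\<bar>) \<and> (\<forall>x i. x \<le> 0 \<longrightarrow> f x i = f 0 i) \<and>
           (\<forall>x i. 0 \<le> x \<longrightarrow> \<bar>f x i - g x i\<bar> \<le> A / sqrt (real n) * (x + real i + 1)))"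
      proof (intro conjI \<omega>)
        show "lh n \<omega> 0 = lam1 \<omega>" by (simp add: lh_def)
      qed (rule exI[of _ h], intro conjI allI impI h1 h2 h3 h4)
    qed
    from LIMSEQ_D[OF this, of "\<tau> / 2"] \<tau> obtain n2 where
      n2: "\<And>n. n2 \<le> n \<Longrightarrow> prob {\<omega> \<in> G n. \<zeta> < \<bar>T n \<omega> - T0 n \<omega>\<bar>} < \<tau> / 2"
      unfolding diff by auto
    \<comment> \<open>From here on K' / sqrt n \<le> \<delta>, so the rate bound alone places the
      estimator in the neighbourhood of \<theta>0.\<close>
    obtain n3 :: nat where n3: "(K' / \<delta>)\<^sup>2 < real n3" using reals_Archimedean2 by blast
    have "norm (prob {\<omega>\<in>space M. \<zeta> < \<bar>T n \<omega> - T0 n \<omega>\<bar>} - 0) < \<tau>" if n: "max (max n1 n2) (max n3 1) \<le> n" for n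
    proof -
      let ?H = "{\<omega>\<in>space M. \<bar>norm (\<theta>hat n \<omega> - \<theta>0) / (1 / sqrt (real n))\<bar> > K}"
      have "K' / \<delta> < sqrt (real n)"
        using n3 n by (intro real_less_rsqrt) linarith
      then have K\<delta>: "K' / sqrt (real n) \<le> \<delta>"
        using \<delta>_pos n by (simp add: field_simps)
      have "{\<omega>\<in>space M. \<zeta> < \<bar>T n \<omega> - T0 n \<omega>\<bar>} \<subseteq> {\<omega> \<in> G n. \<zeta> < \<bar>T n \<omega> - T0 n \<omega>\<bar>} \<union> ?H"
      proof
        fix \<omega> assume \<omega>: "\<omega> \<in> {\<omega>\<in>space M. \<zeta> < \<bar>T n \<omega> - T0 n \<omega>\<bar>}"
        show "\<omega> \<in> {\<omega> \<in> G n. \<zeta> < \<bar>T n \<omega> - T0 n \<omega>\<bar>} \<union> ?H"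
        proof (cases "\<omega> \<in> ?H")
          case False
          then have "norm (\<theta>hat n \<omega> - \<theta>0) * sqrt (real n) \<le> K'" using \<omega> by (auto simp: K'_def)
          then have "norm (\<theta>hat n \<omega> - \<theta>0) \<le> K' / sqrt (real n)" using n by (simp add: pos_le_divide_eq)
          then show ?thesis using \<omega> K\<delta> by (auto simp: G_def)
        qed simp
      qed
      then have "prob {\<omega>\<in>space M. \<zeta> < \<bar>T n \<omega> - T0 n \<omega>\<bar>} \<le> prob ({\<omega> \<in> G n. \<zeta> < \<bar>T n \<omega> - T0 n \<omega>\<bar>} \<union> ?H)"
        by (intro finite_measure_mono) (auto simp: G_def)
      also have "\<dots> \<le> prob {\<omega> \<in> G n. \<zeta> < \<bar>T n \<omega> - T0 n \<omega>\<bar>} + prob ?H"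
        by (intro measure_Un_le) (auto simp: G_def)
      also have "\<dots> < \<tau>" using n2[of n] K[of n] n by simp
      finally show ?thesis by simp
    qed
    then show "\<exists>n0. \<forall>n\<ge>n0. norm (prob {\<omega>\<in>space M. \<zeta> < \<bar>T n \<omega> - T0 n \<omega>\<bar>} - 0) < \<tau>" by blast
  qed
  have v0: "0 \<le> 2 * v" by (simp add: v_def)
  have "weak_conv_m (\<lambda>n. distr M borel (T n)) (normal_measure 0 (2 * v))"
  proof (rule levy_continuity)
    show "real_distribution (distr M borel (T n))" for n by (intro real_distribution_distr) measurable
    show "real_distribution (normal_measure 0 (2 * v))" by (rule real_distribution_normal_measure[OF v0])
    fix u
    \<comment> \<open>The exponent - u^2 * v is that of a centred normal law with variance 2 * v,
      where v is the second moment of the intensity.\<close>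
    have "(\<lambda>n. \<integral>\<omega>. iexp (u * T0 n \<omega>) \<partial>M) \<longlonglongrightarrow> complex_of_real (exp (- (u\<^sup>2) * v))"
      unfolding T0_def v_def by (rule pc.char_limit)
    then have "(\<lambda>n. \<integral>\<omega>. iexp (u * T n \<omega>) \<partial>M) \<longlonglongrightarrow> complex_of_real (exp (- (u\<^sup>2) * v))"
      by (rule char_limit_perturb[OF T0_meas T_meas _ close])
    moreover have "char (distr M borel (T n)) u = (\<integral>\<omega>. iexp (u * T n \<omega>) \<partial>M)" for n
      unfolding char_def by (subst integral_distr) auto
    ultimately show "(\<lambda>n. char (distr M borel (T n)) u) \<longlonglongrightarrow> char (normal_measure 0 (2 * v)) u"
      using char_normal_measure[OF v0, of u] by simp
  qed
  then show ?thesis by (simp add: T_def[abs_def] v)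
qed

end
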